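(* Assume the setup below, and suppose there are constants $C,\gamma\in(0,\infty)$ such that $\max_{n\in\{0,1\}}a(m,n)\le Ce^{-\gamma|m|}$ for all $m\in\mathbb Z$. Then for $\mu$-almost every $\omega\in\Omega$, $J_\omega$ has pure point spectrum, and every eigenfunction $u$ of $J_\omega$ satisfies, for every $\epsilon\in(0,\gamma)$, an estimate $|u(m)|\le C_{\omega,\epsilon,u}e^{-(\gamma-\epsilon)|m|}$ for all $m\in\mathbb Z$, with a constant $C_{\omega,\epsilon,u}<\infty$.
   Context: Setup: $r:\mathbb R\to[0,\infty)$ is bounded, measurable, compactly supported, with $\int_{\mathbb R} r(x)\,dx=1$. $(d_n)_{n\in\mathbb Z}$ is a fixed sequence of positive reals and $r_n(x)=d_n^{-1}r(d_n^{-1}x)$. $c\in\ell^\infty(\mathbb Z)$ is real. $a\in\ell^\infty(\mathbb Z)$ is real with $a(n)\ge\delta>0$ for all $n$. $\Omega=\mathbb R^{\mathbb Z}$ and $\mu$ is the product probability measure $d\mu(\omega)=\prod_{n} r_n(\omega(n)-c(n))\,d\omega(n)$. $(J_\omega\phi)(n)=a(n)\phi(n+1)+a(n-1)\phi(n-1)+\omega(n)\phi(n)$ on $\ell^2(\mathbb Z)$. For $m,n\in\mathbb Z$, $a(m,n)=\int_\Omega\sup_{t\in\mathbb R}|\langle\delta_m,e^{-itJ_\omega}\delta_n\rangle|\,d\mu(\omega)$. *)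

theory Defs
  imports "HOL-Probability.Probability"
begin

definition in_l2 :: "(int \<Rightarrow> complex) \<Rightarrow> bool" where
  "in_l2 f \<longleftrightarrow> (\<lambda>n. (cmod (f n))^2) summable_on UNIV"

definition l2norm :: "(int \<Rightarrow> complex) \<Rightarrow> real" where
  "l2norm f = sqrt (infsum (\<lambda>n. (cmod (f n))^2) UNIV)"

definition kdelta :: "int \<Rightarrow> int \<Rightarrow> complex" where
  "kdelta n = (\<lambda>m. if m = n then 1 else 0)"

definition jacobi :: "(int \<Rightarrow> real) \<Rightarrow> (int \<Rightarrow> real) \<Rightarrow> (int \<Rightarrow> complex) \<Rightarrow> int \<Rightarrow> complex" where
  "jacobi a \<omega> \<phi> n =
     of_real (a n) * \<phi> (n + 1) + of_real (a (n - 1)) * \<phi> (n - 1) + of_real (\<omega> n) * \<phi> n"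

text \<open>Maximal (= self-adjoint) domain of J_omega.\<close>

definition jdom :: "(int \<Rightarrow> real) \<Rightarrow> (int \<Rightarrow> real) \<Rightarrow> (int \<Rightarrow> complex) set" where
  "jdom a \<omega> = {\<psi>. in_l2 \<psi> \<and> in_l2 (jacobi a \<omega> \<psi>)}"

text \<open>psi(t) = e^{-itJ} psi0 is the unique solution in the domain of J of the Schroedinger
  equation i psi'(t) = J psi(t) (derivative in the \<ell>^2 norm) with psi(0) = psi0 (Stone).\<close>

definition schrod_sol ::
  "(int \<Rightarrow> real) \<Rightarrow> (int \<Rightarrow> real) \<Rightarrow> (int \<Rightarrow> complex) \<Rightarrow> (real \<Rightarrow> int \<Rightarrow> complex) \<Rightarrow> bool" where
  "schrod_sol a \<omega> \<psi>0 \<psi> \<longleftrightarrow>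
     \<psi> 0 = \<psi>0 \<and> (\<forall>t. \<psi> t \<in> jdom a \<omega>) \<and>
     (\<forall>t. ((\<lambda>h. l2norm (\<lambda>m. (\<psi> (t + h) m - \<psi> t m) / of_real h
                              + \<i> * jacobi a \<omega> (\<psi> t) m)) \<longlongrightarrow> 0) (at 0))"

definition unitary_evol ::
  "(int \<Rightarrow> real) \<Rightarrow> (int \<Rightarrow> real) \<Rightarrow> real \<Rightarrow> (int \<Rightarrow> complex) \<Rightarrow> int \<Rightarrow> complex" where
  "unitary_evol a \<omega> t \<psi>0 = (THE \<psi>. schrod_sol a \<omega> \<psi>0 \<psi>) t"

definition matrix_elem :: "(int \<Rightarrow> real) \<Rightarrow> (int \<Rightarrow> real) \<Rightarrow> int \<Rightarrow> int \<Rightarrow> real \<Rightarrow> complex" where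
  "matrix_elem a \<omega> m n t = unitary_evol a \<omega> t (kdelta n) m"

definition scaled_density :: "(real \<Rightarrow> real) \<Rightarrow> real \<Rightarrow> real \<Rightarrow> real" where
  "scaled_density r dn x = r (x / dn) / dn"

definition mu :: "(real \<Rightarrow> real) \<Rightarrow> (int \<Rightarrow> real) \<Rightarrow> (int \<Rightarrow> real) \<Rightarrow> (int \<Rightarrow> real) measure" where
  "mu r d c = (\<Pi>\<^sub>M n\<in>UNIV. density lborel (\<lambda>x. ennreal (scaled_density r (d n) (x - c n))))"

definition a_corr :: "(real \<Rightarrow> real) \<Rightarrow> (int \<Rightarrow> real) \<Rightarrow> (int \<Rightarrow> real) \<Rightarrow> (int \<Rightarrow> real)
    \<Rightarrow> int \<Rightarrow> int \<Rightarrow> ennreal" where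
  "a_corr r d c a m n =
     (\<integral>\<^sup>+ \<omega>. ennreal (SUP t. cmod (matrix_elem a \<omega> m n t)) \<partial>(mu r d c))"

definition eigenfunction :: "(int \<Rightarrow> real) \<Rightarrow> (int \<Rightarrow> real) \<Rightarrow> (int \<Rightarrow> complex) \<Rightarrow> bool" where
  "eigenfunction a \<omega> u \<longleftrightarrow> in_l2 u \<and> u \<noteq> (\<lambda>_. 0) \<and> (\<exists>E::complex. jacobi a \<omega> u = (\<lambda>m. E * u m))"

definition pure_point :: "(int \<Rightarrow> real) \<Rightarrow> (int \<Rightarrow> real) \<Rightarrow> bool" where
  "pure_point a \<omega> \<longleftrightarrow>
     (\<forall>f. in_l2 f \<longrightarrow> (\<forall>\<epsilon>>0. \<exists>U coef. finite U \<and> (\<forall>u\<in>U. eigenfunction a \<omega> u) \<and>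
         l2norm (\<lambda>m. f m - (\<Sum>u\<in>U. coef u * u m)) < \<epsilon>))"

end

theory Submission
  imports Defs
begin

text \<open>
  Almost surely the bound on the averaged suprema makes the orbits of \<open>e\<^sup>-\<^sup>i\<^sup>t\<^sup>J\<close> started at the sites
  0 and 1 exponentially localized, uniformly in time.

  If \<open>u\<close> is an eigenfunction with energy \<open>E\<close>, a limit point \<open>v\<close> of the means over \<open>[0, T]\<close> of
  \<open>e\<^sup>i\<^sup>t\<^sup>E e\<^sup>-\<^sup>i\<^sup>t\<^sup>J \<delta>\<^sub>n\<close> is again a solution of \<open>J v = E v\<close>, inherits the exponential bound and satisfies
  \<open>\<langle>u, v\<rangle> = \<langle>u, \<delta>\<^sub>n\<rangle>\<close>. Since \<open>u 0\<close> and \<open>u 1\<close> do not both vanish, \<open>v \<noteq> 0\<close> for one of \<open>n = 0, 1\<close>, and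
  constancy of the Wronskian makes \<open>u\<close> a multiple of \<open>v\<close>.

  For pure point spectrum, a limit point \<open>B\<close> of the time averages of the projections onto
  \<open>e\<^sup>-\<^sup>i\<^sup>t\<^sup>J \<delta>\<^sub>n\<close> is compact, symmetric and commutes with \<open>J\<close>. A positive top eigenspace of \<open>B\<close> inside the orthogonal
  complement of all eigenfunctions would contain an eigenvector of \<open>J\<close>. So the quadratic mean of
  \<open>\<langle>y, e\<^sup>-\<^sup>i\<^sup>t\<^sup>J \<delta>\<^sub>n\<rangle>\<close> vanishes for every \<open>y\<close> in this complement, and since the orbit is almost periodic the
  function itself vanishes. Differentiating in \<open>t\<close> propagates this from \<open>n = 0, 1\<close> to all sites, so \<open>y = 0\<close>.

  The lower integral of a non-measurable function says nothing about almost every \<open>\<omega>\<close>, so the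
  suprema must be shown measurable: the evolution is constructed as the limit of the evolutions
  truncated to finite boxes, whose matrix elements are power series in finitely many values of \<open>\<omega>\<close>.
\<close>


section \<open>The Hilbert space of square-summable sequences\<close>

lemma in_l2_zero: "in_l2 (\<lambda>_. 0)"
  by (simp add: in_l2_def)

lemma in_l2_scale: "in_l2 f \<Longrightarrow> in_l2 (\<lambda>m. c * f m)"
  unfolding in_l2_def norm_mult power_mult_distrib by (rule summable_on_cmult_right)

lemma in_l2_scale_bounded:
  assumes "in_l2 f" "\<And>m. cmod (g m) \<le> K * cmod (f m)"
  shows "in_l2 g"
proof -
  have "(\<lambda>m. K\<^sup>2 * (cmod (f m))\<^sup>2) summable_on UNIV"
    using assms(1) unfolding in_l2_def by (rule summable_on_cmult_right)
  moreover have "(cmod (g m))\<^sup>2 \<le> K\<^sup>2 * (cmod (f m))\<^sup>2" for m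
    using power_mono[OF assms(2)[of m], of 2] by (simp add: power_mult_distrib)
  ultimately show ?thesis
    unfolding in_l2_def by (rule summable_on_comparison_test) auto
qed

lemma in_l2_add:
  assumes "in_l2 f" "in_l2 g"
  shows "in_l2 (\<lambda>m. f m + g m)"
proof -
  have "(\<lambda>m. 2 * (cmod (f m))\<^sup>2 + 2 * (cmod (g m))\<^sup>2) summable_on UNIV"
    using assms unfolding in_l2_def by (intro summable_on_add summable_on_cmult_right)
  moreover have "(cmod (f m + g m))\<^sup>2 \<le> 2 * (cmod (f m))\<^sup>2 + 2 * (cmod (g m))\<^sup>2" for m
  proof -
    have "(cmod (f m + g m))\<^sup>2 \<le> (cmod (f m) + cmod (g m))\<^sup>2"
      by (simp add: norm_triangle_ineq power_mono)
    also have "\<dots> \<le> 2 * (cmod (f m))\<^sup>2 + 2 * (cmod (g m))\<^sup>2"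
      using sum_squares_bound[of "cmod (f m)" "cmod (g m)"] by (simp add: power2_sum)
    finally show ?thesis .
  qed
  ultimately show ?thesis
    unfolding in_l2_def by (rule summable_on_comparison_test) auto
qed

lemma in_l2_diff: "in_l2 f \<Longrightarrow> in_l2 g \<Longrightarrow> in_l2 (\<lambda>m. f m - g m)"
  using in_l2_add[of f "\<lambda>m. (-1) * g m"] in_l2_scale[of g "-1"] by simp

lemma in_l2_inner_summable:
  assumes "in_l2 f" "in_l2 g"
  shows "(\<lambda>m. f m \<bullet> g m) summable_on UNIV"
proof -
  have s: "(\<lambda>m. (cmod (f m))\<^sup>2 + (cmod (g m))\<^sup>2) summable_on UNIV"
    using assms unfolding in_l2_def by (rule summable_on_add)
  have "norm (f m \<bullet> g m) \<le> (cmod (f m))\<^sup>2 + (cmod (g m))\<^sup>2" for m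
  proof -
    have "\<bar>f m \<bullet> g m\<bar> \<le> cmod (f m) * cmod (g m)" by (rule Cauchy_Schwarz_ineq2)
    moreover have "0 \<le> cmod (f m) * cmod (g m)" by simp
    ultimately show ?thesis
      using sum_squares_bound[of "cmod (f m)" "cmod (g m)"] unfolding real_norm_def by linarith
  qed
  then have "(\<lambda>m. norm (f m \<bullet> g m)) summable_on UNIV"
    by (intro summable_on_comparison_test[OF s]) auto
  then show ?thesis by (rule abs_summable_summable)
qed

text \<open>Making \<open>ell2\<close> an instance of \<open>real_inner\<close> gives access to
  limits, derivatives and topology. Its inner product is the real part of the complex one; complex
  scalars act through \<open>cscale\<close>.\<close>

typedef ell2 = "{f. in_l2 f}"
  morphisms coord Abs_ell2
  using in_l2_zero by blast

lemma in_l2_coord [simp]: "in_l2 (coord x)"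
  using coord by blast

lemma coord_Abs [simp]: "in_l2 f \<Longrightarrow> coord (Abs_ell2 f) = f"
  by (simp add: Abs_ell2_inverse)

lemma ell2_eqI: "(\<And>m. coord x m = coord y m) \<Longrightarrow> x = y"
  by (metis coord_inject ext)

definition cscale :: "complex \<Rightarrow> ell2 \<Rightarrow> ell2" where
  "cscale c x = Abs_ell2 (\<lambda>m. c * coord x m)"

lemma coord_cscale [simp]: "coord (cscale c x) m = c * coord x m"
  by (simp add: cscale_def in_l2_scale)

instantiation ell2 :: real_inner
begin

definition "0 = Abs_ell2 (\<lambda>_. 0)"
definition "x + y = Abs_ell2 (\<lambda>m. coord x m + coord y m)"
definition "x - y = Abs_ell2 (\<lambda>m. coord x m - coord y m)"
definition "- x = cscale (-1) x"
definition "s *\<^sub>R x = cscale (of_real s) x"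
definition "inner x y = infsum (\<lambda>m. coord x m \<bullet> coord y m) UNIV"
definition "norm x = l2norm (coord x)"
definition "sgn x = inverse (norm x) *\<^sub>R (x::ell2)"
definition "dist x y = norm (x - y :: ell2)"
definition "(uniformity :: (ell2 \<times> ell2) filter) = (INF e\<in>{0<..}. principal {(x, y). dist x y < e})"
definition "open (U :: ell2 set) \<longleftrightarrow> (\<forall>x\<in>U. \<forall>\<^sub>F (x', y) in uniformity. x' = x \<longrightarrow> y \<in> U)"

lemma coord_ell2 [simp]:
  "coord 0 m = 0" "coord (x + y) m = coord x m + coord y m"
  "coord (x - y) m = coord x m - coord y m" "coord (- x) m = - coord x m"
  "coord (s *\<^sub>R x) m = of_real s * coord x m"
  by (simp_all add: zero_ell2_def plus_ell2_def minus_ell2_def uminus_ell2_def scaleR_ell2_def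
      in_l2_zero in_l2_add in_l2_diff)

instance
proof
  fix x y z :: ell2 and r s :: real
  note d = ell2_eqI
  show "dist x y = norm (x - y)" by (rule dist_ell2_def)
  show "sgn x = inverse (norm x) *\<^sub>R x" by (rule sgn_ell2_def)
  show "uniformity = (INF e\<in>{0<..}. principal {(x, y). dist (x::ell2) y < e})"
    by (rule uniformity_ell2_def)
  show "open U \<longleftrightarrow> (\<forall>x\<in>U. \<forall>\<^sub>F (x', y) in uniformity. x' = x \<longrightarrow> y \<in> U)" for U :: "ell2 set"
    by (rule open_ell2_def)
  show "x + y + z = x + (y + z)" "x + y = y + x" "0 + x = x" "- x + x = 0" "x - y = x + - y"
    "r *\<^sub>R (x + y) = r *\<^sub>R x + r *\<^sub>R y" "(r + s) *\<^sub>R x = r *\<^sub>R x + s *\<^sub>R x"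
    "r *\<^sub>R s *\<^sub>R x = (r * s) *\<^sub>R x" "1 *\<^sub>R x = x"
    by (rule d; simp add: algebra_simps)+
  show "inner x y = inner y x" by (simp add: inner_ell2_def inner_commute)
  show "inner (x + y) z = inner x z + inner y z"
    by (simp add: inner_ell2_def inner_add_left infsum_add in_l2_inner_summable)
  show "inner (r *\<^sub>R x) y = r * inner x y"
    by (simp add: inner_ell2_def scaleR_conv_of_real[symmetric] infsum_cmult_right')
  have sq: "inner x x = infsum (\<lambda>m. (cmod (coord x m))\<^sup>2) UNIV" for x
    by (simp add: inner_ell2_def power2_norm_eq_inner)
  show "0 \<le> inner x x" by (simp add: sq infsum_nonneg)
  show "norm x = sqrt (inner x x)" by (simp add: sq norm_ell2_def l2norm_def)
  show "inner x x = 0 \<longleftrightarrow> x = 0"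
  proof
    assume "inner x x = 0"
    then have "(cmod (coord x m))\<^sup>2 = 0" for m
      using nonneg_infsum_le_0D[of "\<lambda>m. (cmod (coord x m))\<^sup>2" UNIV m] in_l2_coord[of x]
      by (simp add: sq in_l2_def)
    then show "x = 0" by (intro d) simp
  next
    assume "x = 0"
    then show "inner x x = 0" by (simp add: sq)
  qed
qed

end

lemma norm_sq_ell2: "(norm x)\<^sup>2 = infsum (\<lambda>m. (cmod (coord x m))\<^sup>2) UNIV"
  by (simp add: power2_norm_eq_inner inner_ell2_def)

lemma summable_coord: "(\<lambda>m. (cmod (coord x m))\<^sup>2) summable_on UNIV"
  using in_l2_coord[of x] by (simp add: in_l2_def)

lemma sum_coord_le: "finite F \<Longrightarrow> (\<Sum>m\<in>F. (cmod (coord x m))\<^sup>2) \<le> (norm x)\<^sup>2"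
  unfolding norm_sq_ell2 by (rule finite_sum_le_infsum) (auto simp: summable_coord)

lemma norm_coord_le: "cmod (coord x m) \<le> norm x"
  using sum_coord_le[of "{m}" x] by (simp add: abs_le_square_iff[symmetric])

lemma bounded_linear_coord: "bounded_linear (\<lambda>x. coord x m)"
  by (rule bounded_linear_intro[where K=1]) (auto simp: norm_coord_le scaleR_conv_of_real)

lemma coord_sum: "coord (sum f A) m = (\<Sum>i\<in>A. coord (f i) m)"
  by (induction A rule: infinite_finite_induct) auto

text \<open>Finite partial sums decide both membership and the norm bound; limits and dual vectors
  enter \<open>ell2\<close> this way.\<close>

lemma in_l2_bounded_sums:
  assumes "\<And>F. finite F \<Longrightarrow> (\<Sum>m\<in>F. (cmod (f m))\<^sup>2) \<le> K\<^sup>2" "0 \<le> K"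
  shows "in_l2 f" "norm (Abs_ell2 f) \<le> K"
proof -
  show l: "in_l2 f"
    unfolding in_l2_def
    by (rule nonneg_bdd_above_summable_on) (auto intro!: bdd_aboveI2 assms)
  have "(norm (Abs_ell2 f))\<^sup>2 \<le> K\<^sup>2"
    unfolding norm_sq_ell2 using l
    by (intro infsum_le_finite_sums) (auto simp: in_l2_def assms)
  then show "norm (Abs_ell2 f) \<le> K" using assms(2) by (rule power2_le_imp_le)
qed

subsection \<open>Finitely supported vectors and multiplication by complex scalars\<close>

definition fvec :: "int set \<Rightarrow> (int \<Rightarrow> complex) \<Rightarrow> ell2" where
  "fvec F f = Abs_ell2 (\<lambda>m. if m \<in> F then f m else 0)"

definition basis :: "int \<Rightarrow> ell2" where
  "basis n = Abs_ell2 (kdelta n)"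

lemma in_l2_finite_support:
  assumes "finite F" "\<And>m. m \<notin> F \<Longrightarrow> f m = 0"
  shows "in_l2 f"
proof -
  have "(\<lambda>m. (cmod (f m))\<^sup>2) summable_on F" using assms(1) by simp
  then show ?thesis
    unfolding in_l2_def
    by (rule summable_on_cong_neutral[THEN iffD1, rotated -1]) (auto simp: assms(2))
qed

lemma coord_fvec [simp]: "finite F \<Longrightarrow> coord (fvec F f) m = (if m \<in> F then f m else 0)"
  unfolding fvec_def by (subst coord_Abs) (rule in_l2_finite_support[of F], auto)

lemma in_l2_kdelta [simp]: "in_l2 (kdelta n)"
  by (rule in_l2_finite_support[of "{n}"]) (auto simp: kdelta_def)

lemma coord_basis [simp]: "coord (basis n) m = (if m = n then 1 else 0)"
  by (simp add: basis_def kdelta_def[symmetric]) (simp add: kdelta_def)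

lemma inner_fvec: 
  assumes "finite F"
  shows "fvec F f \<bullet> x = (\<Sum>m\<in>F. f m \<bullet> coord x m)"
proof -
  have "fvec F f \<bullet> x = infsum (\<lambda>m. f m \<bullet> coord x m) F"
    unfolding inner_ell2_def by (rule infsum_cong_neutral) (auto simp: assms)
  then show ?thesis using assms by simp
qed

lemma inner_finite_support:
  assumes "finite F" "\<And>m. m \<notin> F \<Longrightarrow> coord w m = 0"
  shows "w \<bullet> x = (\<Sum>m\<in>F. coord w m \<bullet> coord x m)"
proof -
  have "w = fvec F (coord w)" by (rule ell2_eqI) (auto simp: assms)
  then show ?thesis using inner_fvec[OF assms(1), of "coord w" x] by simp
qed

lemma norm_fvec: "finite F \<Longrightarrow> (norm (fvec F f))\<^sup>2 = (\<Sum>m\<in>F. (cmod (f m))\<^sup>2)"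
  unfolding power2_norm_eq_inner by (simp add: inner_fvec)

lemma cscale_simps [simp]:
  "cscale c (x + y) = cscale c x + cscale c y" "cscale c (x - y) = cscale c x - cscale c y"
  "cscale c (- x) = - cscale c x"
  "cscale c (cscale d x) = cscale (c * d) x" "cscale c 0 = 0" "cscale 0 x = 0" "cscale 1 x = x"
  "cscale (-1) x = - x" "cscale (of_real r) x = r *\<^sub>R x"
  by (rule ell2_eqI; simp add: algebra_simps)+

lemma cscale_neg_i: "cscale (- \<i>) x = - cscale \<i> x"
  by (rule ell2_eqI) simp

lemma cscale_scaleR: "cscale c (r *\<^sub>R x) = r *\<^sub>R cscale c x" 
  by (rule ell2_eqI) simp

lemma inner_cscale: "cscale c x \<bullet> y = x \<bullet> cscale (cnj c) y"
  unfolding inner_ell2_def by (rule infsum_cong) (simp add: inner_complex_def algebra_simps)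

lemma norm_cscale [simp]: "norm (cscale c x) = cmod c * norm x"
proof -
  have "(norm (cscale c x))\<^sup>2 = (cmod c * norm x)\<^sup>2"
    unfolding norm_sq_ell2 power_mult_distrib
    by (simp add: norm_mult power_mult_distrib infsum_cmult_right')
  then show ?thesis by simp
qed

lemma bounded_bilinear_cscale: "bounded_bilinear cscale"
proof
  show "cscale (c + d) x = cscale c x + cscale d x" "cscale (r *\<^sub>R c) x = r *\<^sub>R cscale c x" for c d x and r :: real
    by (rule ell2_eqI; simp add: scaleR_conv_of_real algebra_simps)+
  show "\<exists>K. \<forall>c x. norm (cscale c x) \<le> norm c * norm x * K" by (intro exI[of _ 1]) simp
qed (simp_all add: cscale_scaleR)

text \<open>The real inner product sees only real parts, so a complex coordinate is tested against
  two vectors, \<open>basis m\<close> and \<open>cscale \<i> (basis m)\<close>.\<close>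

lemma inner_basis: "basis m \<bullet> x = Re (coord x m)"
  by (subst inner_finite_support[of "{m}"]) (auto simp: inner_complex_def)

lemma inner_basis_i: "cscale \<i> (basis m) \<bullet> x = Im (coord x m)"
  by (subst inner_finite_support[of "{m}"]) (auto simp: inner_complex_def)

lemma norm_basis [simp]: "norm (basis m) = 1"
  by (simp add: norm_eq_sqrt_inner inner_basis)

lemma fvec_decompose:
  assumes "finite F"
  shows "fvec F f = (\<Sum>m\<in>F. Re (f m) *\<^sub>R basis m + Im (f m) *\<^sub>R cscale \<i> (basis m))"
proof (rule ell2_eqI)
  fix k
  have "coord (\<Sum>m\<in>F. Re (f m) *\<^sub>R basis m + Im (f m) *\<^sub>R cscale \<i> (basis m)) k
      = (\<Sum>m\<in>F. if k = m then f m else 0)"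
    unfolding coord_sum
    by (rule sum.cong) (auto simp: complex_eq_iff)
  then show "coord (fvec F f) k
      = coord (\<Sum>m\<in>F. Re (f m) *\<^sub>R basis m + Im (f m) *\<^sub>R cscale \<i> (basis m)) k"
    using assms by (simp add: sum.delta')
qed

text \<open>By Pythagoras the squared distance is \<open>(norm x)\<^sup>2\<close> minus a partial
  sum of the series that defines it.\<close>

lemma fvec_tendsto: "((\<lambda>F. fvec F (coord x)) \<longlongrightarrow> x) (finite_subsets_at_top UNIV)"
proof -
  have "((\<lambda>F. (norm x)\<^sup>2 - (\<Sum>m\<in>F. (cmod (coord x m))\<^sup>2)) \<longlongrightarrow> 0) (finite_subsets_at_top UNIV)"
    using tendsto_diff[OF tendsto_const[of "(norm x)\<^sup>2"] infsum_tendsto[OF summable_coord[of x]]]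
    by (simp add: norm_sq_ell2)
  then have "((\<lambda>F. (norm (fvec F (coord x) - x))\<^sup>2) \<longlongrightarrow> 0) (finite_subsets_at_top UNIV)"
  proof (rule tendsto_cong[THEN iffD1, rotated])
    show "\<forall>\<^sub>F F in finite_subsets_at_top UNIV.
        (norm x)\<^sup>2 - (\<Sum>m\<in>F. (cmod (coord x m))\<^sup>2) = (norm (fvec F (coord x) - x))\<^sup>2"
    proof (rule eventually_finite_subsets_at_top_weakI)
      fix F :: "int set" assume F: "finite F"
      have "(norm (fvec F (coord x) - x))\<^sup>2 = (norm (fvec F (coord x)))\<^sup>2 - 2 * (fvec F (coord x) \<bullet> x) + (norm x)\<^sup>2"
        unfolding power2_norm_eq_inner by (simp add: inner_diff inner_commute)
      then show "(norm x)\<^sup>2 - (\<Sum>m\<in>F. (cmod (coord x m))\<^sup>2) = (norm (fvec F (coord x) - x))\<^sup>2"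
        using F by (simp add: norm_fvec inner_fvec flip: power2_norm_eq_inner)
    qed
  qed
  then have "((\<lambda>F. sqrt ((norm (fvec F (coord x) - x))\<^sup>2)) \<longlongrightarrow> sqrt 0) (finite_subsets_at_top UNIV)"
    by (rule tendsto_real_sqrt)
  then show ?thesis
    by (subst Lim_null) (simp add: tendsto_norm_zero_iff)
qed

text \<open>The candidate is read off from the values of \<open>l\<close> on the real basis vectors.
  Testing \<open>l\<close> on truncations of the candidate itself bounds its partial sums, and
  density of finitely supported vectors does the rest.\<close>

lemma ell2_Riesz:
  fixes l :: "ell2 \<Rightarrow> real"
  assumes "bounded_linear l"
  obtains v where "\<And>w. l w = w \<bullet> v"
proof -
  interpret l: bounded_linear l by fact
  define f where "f m = Complex (l (basis m)) (l (cscale \<i> (basis m)))" for m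
  obtain K where K: "0 \<le> K" "\<And>x. \<bar>l x\<bar> \<le> norm x * K"
    using l.nonneg_bounded by (auto simp: real_norm_def)
  have lf: "l (fvec F g) = (\<Sum>m\<in>F. g m \<bullet> f m)" if "finite F" for F g
    unfolding fvec_decompose[OF that]
    by (simp add: l.sum l.add l.scale f_def inner_complex_def)
  have "(\<Sum>m\<in>F. (cmod (f m))\<^sup>2) \<le> K\<^sup>2" if "finite F" for F
  proof -
    have "(norm (fvec F f))\<^sup>2 \<le> norm (fvec F f) * K"
      using K(2)[of "fvec F f"] that
      by (simp add: lf norm_fvec flip: power2_norm_eq_inner)
    then have "norm (fvec F f) \<le> K"
      using K(1) by (cases "norm (fvec F f) = 0") (auto simp: power2_eq_square)
    then show ?thesis using norm_fvec[OF that, of f] by (metis norm_ge_zero power_mono)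
  qed
  note f = in_l2_bounded_sums[OF this K(1)]
  show ?thesis
  proof
    fix w
    have "((\<lambda>F. l (fvec F (coord w))) \<longlongrightarrow> l w) (finite_subsets_at_top UNIV)"
      by (intro l.tendsto fvec_tendsto)
    moreover have "((\<lambda>F. fvec F (coord w) \<bullet> Abs_ell2 f) \<longlongrightarrow> w \<bullet> Abs_ell2 f) (finite_subsets_at_top UNIV)"
      by (intro tendsto_intros fvec_tendsto)
    then have "((\<lambda>F. l (fvec F (coord w))) \<longlongrightarrow> w \<bullet> Abs_ell2 f) (finite_subsets_at_top UNIV)"
      by (rule tendsto_cong[THEN iffD1, rotated])
        (auto intro!: eventually_finite_subsets_at_top_weakI simp: lf inner_fvec f)
    ultimately show "l w = w \<bullet> Abs_ell2 f"
      by (rule tendsto_unique[OF finite_subsets_at_top_neq_bot])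
  qed
qed

subsection \<open>Compactness\<close>

text \<open>Tychonoff's theorem for a product of intervals. The index set is uncountable in the
  applications, so finer filters take the place of diagonal subsequences.\<close>

lemma pointwise_cluster_filter:
  fixes g :: "'t \<Rightarrow> 'i \<Rightarrow> real"
  assumes "F \<noteq> bot" and bound: "\<And>t i. \<bar>g t i\<bar> \<le> b i"
  shows "\<exists>G l. G \<le> F \<and> G \<noteq> bot \<and> (\<forall>i. ((\<lambda>t. g t i) \<longlongrightarrow> l i) G)"
proof -
  have "compact (Pi\<^sub>E UNIV (\<lambda>i. {- b i..b i}))"
    using compactin_PiE[of "\<lambda>_. euclidean" UNIV "\<lambda>i. {- b i..b i}"]
    by (simp add: euclidean_product_topology)
  moreover have "filtermap g F \<noteq> bot" using assms(1) by (simp add: filtermap_bot_iff)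
  moreover have "\<forall>\<^sub>F h in filtermap g F. h \<in> Pi\<^sub>E UNIV (\<lambda>i. {- b i..b i})"
    unfolding eventually_filtermap using bound by (intro always_eventually) (auto simp: abs_le_iff minus_le_iff)
  ultimately obtain l where l: "inf (nhds l) (filtermap g F) \<noteq> bot"
    unfolding compact_filter by blast
  define G where "G = inf (filtercomap g (nhds l)) F"
  have "G \<noteq> bot"
  proof
    assume "G = bot"
    then have "eventually (\<lambda>_. False) G" by simp
    then obtain P Q where PQ: "eventually P (filtercomap g (nhds l))" "eventually Q F"
      "\<And>x. P x \<Longrightarrow> Q x \<Longrightarrow> False"
      unfolding G_def eventually_inf by auto
    then obtain R where R: "eventually R (nhds l)" "\<And>x. R (g x) \<Longrightarrow> P x"
      unfolding eventually_filtercomap by auto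
    have "eventually (\<lambda>h. \<not> R h) (filtermap g F)"
      unfolding eventually_filtermap using PQ(2) by eventually_elim (use PQ(3) R(2) in blast)
    then have "eventually (\<lambda>_. False) (inf (nhds l) (filtermap g F))"
      unfolding eventually_inf using R(1) by blast
    then show False using l by (simp add: trivial_limit_def)
  qed
  moreover have "G \<le> F" by (simp add: G_def)
  moreover have gl: "(g \<longlongrightarrow> l) G"
    by (rule filterlim_mono[OF filterlim_filtercomap order_refl]) (simp add: G_def)
  have "((\<lambda>t. g t i) \<longlongrightarrow> l i) G" for i
    using continuous_on_tendsto_compose[OF continuous_on_product_coordinates[of i] gl] by simp
  ultimately show ?thesis by blast
qed

text \<open>A form of the Banach-Alaoglu theorem: pointwise limits of uniformly bounded linear
  functionals are bounded and linear, hence represented by vectors. The parameter \<open>p\<close>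
  makes one filter work for a whole family at once.\<close>

lemma ell2_weak_cluster_functional:
  fixes l :: "'t \<Rightarrow> 'p \<Rightarrow> ell2 \<Rightarrow> real"
  assumes "F \<noteq> bot" and lin: "\<And>t p. linear (l t p)" and bound: "\<And>t p w. \<bar>l t p w\<bar> \<le> C p * norm w"
  shows "\<exists>G y. G \<le> F \<and> G \<noteq> bot \<and> (\<forall>p w. ((\<lambda>t. l t p w) \<longlongrightarrow> w \<bullet> y p) G)"
proof -
  have "\<exists>G L. G \<le> F \<and> G \<noteq> bot \<and> (\<forall>i. ((\<lambda>t. (\<lambda>(p, w). l t p w) i) \<longlongrightarrow> L i) G)"
    by (rule pointwise_cluster_filter[OF assms(1), of _ "\<lambda>(p, w). C p * norm w"])
      (use bound in \<open>auto split: prod.splits\<close>)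
  then obtain G L where G: "G \<le> F" "G \<noteq> bot"
    and lim': "\<And>i. ((\<lambda>t. (\<lambda>(p, w). l t p w) i) \<longlongrightarrow> L i) G"
    by blast
  have lim: "((\<lambda>t. l t p w) \<longlongrightarrow> L (p, w)) G" for p w using lim'[of "(p, w)"] by simp
  have "bounded_linear (\<lambda>w. L (p, w))" for p
  proof (rule bounded_linear_intro[where K="C p"])
    show "L (p, x + y) = L (p, x) + L (p, y)" for x y
      using tendsto_unique[OF G(2) lim[of p "x + y"]] tendsto_add[OF lim[of p x] lim[of p y]]
      by (simp add: linear_add[OF lin])
    show "L (p, r *\<^sub>R x) = r *\<^sub>R L (p, x)" for r x
      using tendsto_unique[OF G(2) lim[of p "r *\<^sub>R x"]] tendsto_mult_left[OF lim[of p x], of r]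
      by (simp add: linear_scale[OF lin])
    show "norm (L (p, x)) \<le> norm x * C p" for x
      using tendsto_upperbound[OF tendsto_rabs[OF lim[of p x]] always_eventually G(2)] bound
      by (simp add: mult.commute)
  qed
  then have "\<exists>y. \<forall>w. L (p, w) = w \<bullet> y" for p using ell2_Riesz by metis
  then obtain y where "\<And>p w. L (p, w) = w \<bullet> y p" by metis
  then show ?thesis using G lim by auto
qed

lemma ell2_weak_cluster:
  fixes x :: "'t \<Rightarrow> ell2"
  assumes "F \<noteq> bot" and bound: "\<And>t. norm (x t) \<le> C"
  shows "\<exists>G y. G \<le> F \<and> G \<noteq> bot \<and> (\<forall>w. ((\<lambda>t. w \<bullet> x t) \<longlongrightarrow> w \<bullet> y) G) \<and> norm y \<le> C"
proof -
  have "linear (\<lambda>w. w \<bullet> x t)" for t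
    using bounded_linear.linear[OF bounded_linear_inner_left] .
  moreover have "\<bar>w \<bullet> x t\<bar> \<le> C * norm w" for t w
    using Cauchy_Schwarz_ineq2[of w "x t"] mult_left_mono[OF bound[of t], of "norm w"]
    by (simp add: mult.commute)
  ultimately obtain G y where G: "G \<le> F" "G \<noteq> bot" "\<And>w. ((\<lambda>t. w \<bullet> x t) \<longlongrightarrow> w \<bullet> y) G"
    using ell2_weak_cluster_functional[OF assms(1), of "\<lambda>t (_::unit) w. w \<bullet> x t" "\<lambda>_. C"] by blast
  \<comment> \<open>Testing against the limit itself gives lower semicontinuity of the norm.\<close>
  have "y \<bullet> x t \<le> norm y * C" for t
    using norm_cauchy_schwarz[of y "x t"] mult_left_mono[OF bound[of t], of "norm y"] by simp
  then have "y \<bullet> y \<le> norm y * C"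
    using tendsto_upperbound[OF G(3)[of y] always_eventually G(2)] by blast
  moreover have "0 \<le> C" using bound norm_ge_zero order_trans by blast
  ultimately have "norm y \<le> C"
    by (cases "norm y = 0") (auto simp: power2_eq_square simp flip: power2_norm_eq_inner)
  then show ?thesis using G by blast
qed

lemma weak_tendsto_coord:
  assumes "\<And>w. ((\<lambda>t. w \<bullet> x t) \<longlongrightarrow> w \<bullet> y) G"
  shows "((\<lambda>t. coord (x t) m) \<longlongrightarrow> coord y m) G"
  using assms[of "basis m"] assms[of "cscale \<i> (basis m)"]
  by (simp add: inner_basis inner_basis_i tendsto_complex_iff)

text \<open>Dominated convergence along an arbitrary filter: finitely many coordinates converge, and
  the remaining ones are controlled by the tail of \<open>4 * (\<beta> m)\<^sup>2\<close>, the 4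
  coming from \<open>cmod (coord (x t - y) m) \<le> 2 * \<beta> m\<close>.\<close>

lemma ell2_dominated_tendsto:
  assumes conv: "\<And>m. ((\<lambda>t. coord (x t) m) \<longlongrightarrow> coord y m) G"
    and bound: "\<And>t m. cmod (coord (x t) m) \<le> \<beta> m" and \<beta>: "(\<lambda>m. (\<beta> m)\<^sup>2) summable_on UNIV"
  shows "(x \<longlongrightarrow> y) G"
proof (cases "G = bot")
  case False
  have y: "cmod (coord y m) \<le> \<beta> m" for m
    using tendsto_upperbound[OF tendsto_norm[OF conv] always_eventually False] bound by blast
  have \<beta>4: "(\<lambda>m. 4 * (\<beta> m)\<^sup>2) summable_on UNIV" by (intro summable_on_cmult_right \<beta>)
  have split: "(norm (x t - y))\<^sup>2 \<le> (\<Sum>m\<in>F. (cmod (coord (x t - y) m))\<^sup>2)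
      + (infsum (\<lambda>m. 4 * (\<beta> m)\<^sup>2) UNIV - (\<Sum>m\<in>F. 4 * (\<beta> m)\<^sup>2))" if F: "finite F" for F t
  proof -
    have "(norm (x t - y))\<^sup>2 - (\<Sum>m\<in>F. (cmod (coord (x t - y) m))\<^sup>2)
        = infsum (\<lambda>m. (cmod (coord (x t - y) m))\<^sup>2) (UNIV - F)"
      using F by (subst infsum_Diff) (auto simp: summable_coord norm_sq_ell2 simp del: coord_ell2)
    also have "\<dots> \<le> infsum (\<lambda>m. 4 * (\<beta> m)\<^sup>2) (UNIV - F)"
    proof (rule infsum_mono)
      show "(\<lambda>m. (cmod (coord (x t - y) m))\<^sup>2) summable_on UNIV - F"
        using F summable_coord by (intro summable_on_cofin_subset)
      show "(\<lambda>m. 4 * (\<beta> m)\<^sup>2) summable_on UNIV - F"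
        using F \<beta>4 by (intro summable_on_cofin_subset)
      fix m
      have "cmod (coord (x t - y) m) \<le> 2 * \<beta> m"
        using norm_triangle_ineq4[of "coord (x t) m" "coord y m"] bound[of t m] y[of m] by simp
      from power_mono[OF this, of 2] show "(cmod (coord (x t - y) m))\<^sup>2 \<le> 4 * (\<beta> m)\<^sup>2"
        by (simp add: power_mult_distrib del: coord_ell2)
    qed
    also have "\<dots> = infsum (\<lambda>m. 4 * (\<beta> m)\<^sup>2) UNIV - (\<Sum>m\<in>F. 4 * (\<beta> m)\<^sup>2)"
      using F \<beta>4 by (subst infsum_Diff) auto
    finally show ?thesis by simp
  qed
  have "((\<lambda>t. (norm (x t - y))\<^sup>2) \<longlongrightarrow> 0) G"
  proof (rule order_tendstoI)
    fix a :: real assume "a < 0"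
    then show "\<forall>\<^sub>F t in G. a < (norm (x t - y))\<^sup>2"
      by (intro always_eventually allI) (meson less_le_trans zero_le_power2)
  next
    fix e :: real assume "0 < e"
    then have "\<forall>\<^sub>F F in finite_subsets_at_top UNIV. 
        infsum (\<lambda>m. 4 * (\<beta> m)\<^sup>2) UNIV - e / 2 < (\<Sum>m\<in>F. 4 * (\<beta> m)\<^sup>2)"
      by (intro order_tendstoD(1)[OF infsum_tendsto[OF \<beta>4]]) simp
    then obtain F where F: "finite F" "infsum (\<lambda>m. 4 * (\<beta> m)\<^sup>2) UNIV - e / 2 < (\<Sum>m\<in>F. 4 * (\<beta> m)\<^sup>2)"
      unfolding eventually_finite_subsets_at_top by auto
    have "((\<lambda>t. \<Sum>m\<in>F. (cmod (coord (x t - y) m))\<^sup>2) \<longlongrightarrow> (\<Sum>m\<in>F. (cmod (coord y m - coord y m))\<^sup>2)) G"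
      unfolding coord_ell2 by (intro tendsto_intros conv)
    then have "\<forall>\<^sub>F t in G. (\<Sum>m\<in>F. (cmod (coord (x t - y) m))\<^sup>2) < e / 2"
      using \<open>0 < e\<close> by (intro order_tendstoD(2)) auto
    then show "\<forall>\<^sub>F t in G. (norm (x t - y))\<^sup>2 < e"
    proof eventually_elim
      case (elim t)
      show ?case using split[OF F(1), of t] F(2) elim by linarith
    qed
  qed
  then have "((\<lambda>t. sqrt ((norm (x t - y))\<^sup>2)) \<longlongrightarrow> sqrt 0) G"
    by (rule tendsto_real_sqrt)
  then show ?thesis
    by (subst Lim_null) (simp add: tendsto_norm_zero_iff)
qed simp

text \<open>A weak limit point exists by boundedness, and domination upgrades weak to norm
  convergence.\<close>

lemma compact_coord_dominated:
  assumes \<beta>: "(\<lambda>m. (\<beta> m)\<^sup>2) summable_on UNIV"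
  shows "compact {x. \<forall>m. cmod (coord x m) \<le> \<beta> m}" (is "compact ?S")
  unfolding compact_filter
proof (intro allI impI)
  fix F :: "ell2 filter" assume F: "F \<noteq> bot" "\<forall>\<^sub>F x in F. x \<in> ?S"
  \<comment> \<open>\<open>P\<close> sends points outside the set to 0, since the cluster lemma asks
    for a bound at every index, not just eventually.\<close>
  define P where "P x = (if x \<in> ?S then x else 0)" for x
  have ex: "\<exists>x. x \<in> ?S" using F eventually_happens by blast
  then have b0: "0 \<le> \<beta> m" for m using norm_ge_zero order_trans by blast
  have P: "cmod (coord (P x) m) \<le> \<beta> m" for x m
    by (auto simp: P_def b0)
  have "norm (P x) \<le> sqrt (infsum (\<lambda>m. (\<beta> m)\<^sup>2) UNIV)" for x
  proof (rule real_le_rsqrt)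
    show "(norm (P x))\<^sup>2 \<le> infsum (\<lambda>m. (\<beta> m)\<^sup>2) UNIV"
      unfolding norm_sq_ell2 
      by (intro infsum_mono summable_coord \<beta> power_mono P) auto
  qed
  then obtain G y where G: "G \<le> F" "G \<noteq> bot" "\<And>w. ((\<lambda>t. w \<bullet> P t) \<longlongrightarrow> w \<bullet> y) G"
    using ell2_weak_cluster[OF F(1), of P] by blast
  note c = weak_tendsto_coord[of P, OF G(3)]
  have Py: "(P \<longlongrightarrow> y) G" by (rule ell2_dominated_tendsto[OF c P \<beta>])
  have "\<forall>\<^sub>F x in G. P x = x" using filter_leD[OF G(1) F(2)] by eventually_elim (simp add: P_def)
  with Py have "((\<lambda>x. x) \<longlongrightarrow> y) G" by (rule tendsto_cong[THEN iffD1, rotated])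
  then have "G \<le> inf (nhds y) F" using G(1) by (simp add: filterlim_def)
  then have "inf (nhds y) F \<noteq> bot" using G(2) by (metis bot.extremum_uniqueI)
  moreover have "y \<in> ?S"
    using tendsto_upperbound[OF tendsto_norm[OF c] always_eventually G(2)] P by blast
  ultimately show "\<exists>x\<in>?S. inf (nhds x) F \<noteq> bot" by blast
qed

text \<open>Differences between a vector and a minimizing sequence of approximants tend weakly to 0,
  which replaces the projection theorem (and completeness).\<close>

lemma subspace_dense_if_orthogonal_zero:
  fixes W :: "ell2 set"
  assumes W: "subspace W" and orth: "\<And>y. (\<And>w. w \<in> W \<Longrightarrow> w \<bullet> y = 0) \<Longrightarrow> y = 0" and "0 < \<epsilon>"
  shows "\<exists>w\<in>W. norm (f - w) < \<epsilon>"
proof -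
  define d where "d = infdist f W"
  have W0: "W \<noteq> {}" using subspace_0[OF W] by blast
  have dle: "d \<le> norm (f - w)" if "w \<in> W" for w
    using infdist_le[OF that, of f] by (simp add: d_def dist_norm)
  have d0: "0 \<le> d" by (simp add: d_def infdist_nonneg)
  have "\<exists>w\<in>W. (norm (f - w))\<^sup>2 < d\<^sup>2 + 1 / real (Suc j)" for j
  proof -
    have "d < sqrt (d\<^sup>2 + 1 / real (Suc j))"
      using d0 by (intro real_less_rsqrt) simp
    then obtain w where "w \<in> W" "dist f w < sqrt (d\<^sup>2 + 1 / real (Suc j))"
      using infdist_notempty[OF W0, of f] cINF_less_iff[OF W0, of "dist f"]
      by (auto simp: d_def)
    then show ?thesis
      by (metis dist_norm norm_ge_zero real_sqrt_less_iff real_sqrt_unique)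
  qed
  then obtain s where s: "\<And>j. s j \<in> W" "\<And>j. (norm (f - s j))\<^sup>2 < d\<^sup>2 + 1 / real (Suc j)" by metis
  define e where "e j = f - s j" for j
  \<comment> \<open>Moving from \<open>s j\<close> along \<open>w\<close> by the optimal amount
    \<open>c\<close> lowers the squared distance by
    \<open>(w \<bullet> e j)\<^sup>2 / (norm w)\<^sup>2\<close>, but not below
    \<open>d\<^sup>2\<close>, so the gain is at most \<open>1 / real (Suc j)\<close>.\<close>
  have near: "(w \<bullet> e j)\<^sup>2 \<le> (1 / real (Suc j)) * (norm w)\<^sup>2" if w: "w \<in> W" for w j
  proof (cases "w = 0")
    case False
    then have n: "0 < (norm w)\<^sup>2" by simp
    define c where "c = (w \<bullet> e j) / (norm w)\<^sup>2"
    have "s j + c *\<^sub>R w \<in> W" using W s(1) w by (simp add: subspace_add subspace_scale)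
    then have "d\<^sup>2 \<le> (norm (e j - c *\<^sub>R w))\<^sup>2"
      using dle[of "s j + c *\<^sub>R w"] d0 by (simp add: e_def diff_diff_eq power_mono)
    also have "\<dots> = (norm (e j))\<^sup>2 - 2 * c * (w \<bullet> e j) + c\<^sup>2 * (norm w)\<^sup>2"
      unfolding power2_norm_eq_inner
      by (simp add: inner_diff inner_commute algebra_simps power2_eq_square)
    also have "\<dots> = (norm (e j))\<^sup>2 - (w \<bullet> e j)\<^sup>2 / (norm w)\<^sup>2"
      using n by (simp add: c_def power2_eq_square field_simps)
    finally have "(w \<bullet> e j)\<^sup>2 / (norm w)\<^sup>2 \<le> 1 / real (Suc j)"
      using s(2)[of j] by (simp add: e_def)
    then show ?thesis using n by (simp add: pos_divide_le_eq)
  qed simp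
  have eb: "norm (e j) \<le> d + 1" for j
  proof (rule power2_le_imp_le)
    have "1 / real (Suc j) \<le> 1" by simp
    then have "(norm (e j))\<^sup>2 \<le> d\<^sup>2 + 1" using s(2)[of j] unfolding e_def by linarith
    also have "\<dots> \<le> (d + 1)\<^sup>2" using d0 by (simp add: power2_sum)
    finally show "(norm (e j))\<^sup>2 \<le> (d + 1)\<^sup>2" .
  qed (use d0 in simp)
  obtain G y where G: "G \<le> sequentially" "G \<noteq> bot" "\<And>w. ((\<lambda>j. w \<bullet> e j) \<longlongrightarrow> w \<bullet> y) G"
    using ell2_weak_cluster[OF sequentially_bot, of e, OF eb] by blast
  have lim0: "((\<lambda>j. 1 / real (Suc j)) \<longlongrightarrow> 0) G"
    using filterlim_mono[OF LIMSEQ_inverse_real_of_nat order_refl G(1)] by (simp add: inverse_eq_divide)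
  have sq0: "((\<lambda>j. g j) \<longlongrightarrow> 0) G"
    if "\<And>j. (g j)\<^sup>2 \<le> (1 / real (Suc j)) * K" for g :: "nat \<Rightarrow> real" and K
  proof -
    have "((\<lambda>j. (g j)\<^sup>2) \<longlongrightarrow> 0) G"
    proof (rule tendsto_sandwich[OF _ _ tendsto_const])
      show "((\<lambda>j. (1 / real (Suc j)) * K) \<longlongrightarrow> 0) G" using tendsto_mult_left_zero[OF lim0] .
      show "\<forall>\<^sub>F j in G. (g j)\<^sup>2 \<le> (1 / real (Suc j)) * K"
        using that by (intro always_eventually) blast
    qed simp
    from tendsto_real_sqrt[OF this] have "((\<lambda>j. \<bar>g j\<bar>) \<longlongrightarrow> 0) G" by simp
    then show ?thesis by (rule tendsto_rabs_zero_cancel)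
  qed
  have "w \<bullet> y = 0" if "w \<in> W" for w
    using tendsto_unique[OF G(2) G(3) sq0] near[OF that] by blast
  then have "y = 0" by (rule orth)
  then have fe: "((\<lambda>j. f \<bullet> e j) \<longlongrightarrow> 0) G" using G(3)[of f] by simp
  \<comment> \<open>With \<open>e j = f - s j\<close>, the squared norm splits into
    \<open>f \<bullet> e j\<close> and \<open>s j \<bullet> e j\<close>; the second is small because
    \<open>near\<close> applies to \<open>w = s j\<close>, of bounded norm.\<close>
  have "((\<lambda>j. s j \<bullet> e j) \<longlongrightarrow> 0) G"
  proof (rule sq0)
    fix j
    have "norm (s j) \<le> norm f + (d + 1)"
      using norm_triangle_ineq4[of f "e j"] eb[of j] by (simp add: e_def)
    then have "(1 / real (Suc j)) * (norm (s j))\<^sup>2 \<le> (1 / real (Suc j)) * (norm f + (d + 1))\<^sup>2"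
      by (intro mult_left_mono power_mono) auto
    then show "(s j \<bullet> e j)\<^sup>2 \<le> (1 / real (Suc j)) * (norm f + (d + 1))\<^sup>2"
      using near[OF s(1)[of j], of j] by linarith
  qed
  from tendsto_diff[OF fe this] have "((\<lambda>j. (norm (e j))\<^sup>2) \<longlongrightarrow> 0) G"
    unfolding power2_norm_eq_inner by (simp add: e_def inner_diff_left)
  then have "\<forall>\<^sub>F j in G. (norm (e j))\<^sup>2 < \<epsilon>\<^sup>2" 
    by (rule order_tendstoD(2)) (use \<open>0 < \<epsilon>\<close> in simp)
  then obtain j where "(norm (e j))\<^sup>2 < \<epsilon>\<^sup>2" using G(2) eventually_happens by blast
  then have "norm (e j) < \<epsilon>" using \<open>0 < \<epsilon>\<close> by (simp add: power2_less_imp_less)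
  then show ?thesis using s(1) unfolding e_def by blast
qed

text \<open>The form \<open>\<mu> * (w \<bullet> w) - w \<bullet> T w\<close> is non-negative on
  \<open>W\<close> and vanishes at \<open>x\<close>, so its first variation in direction
  \<open>\<mu> *\<^sub>R x - T x\<close> is zero. All conditions on \<open>T\<close> are confined to
  \<open>W\<close>, so that \<open>T\<close> may be an unbounded operator leaving a subspace of its
  domain invariant.\<close>

lemma maximizer_is_eigenvector:
  fixes T :: "'a::real_inner \<Rightarrow> 'a"
  assumes W: "subspace W" and TW: "\<And>w. w \<in> W \<Longrightarrow> T w \<in> W"
    and lin: "\<And>v w s. v \<in> W \<Longrightarrow> w \<in> W \<Longrightarrow> T (v + s *\<^sub>R w) = T v + s *\<^sub>R T w"
    and sym: "\<And>v w. v \<in> W \<Longrightarrow> w \<in> W \<Longrightarrow> v \<bullet> T w = T v \<bullet> w"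
    and le: "\<And>w. w \<in> W \<Longrightarrow> w \<bullet> T w \<le> \<mu> * (w \<bullet> w)"
    and x: "x \<in> W" "x \<bullet> T x = \<mu> * (x \<bullet> x)"
  shows "T x = \<mu> *\<^sub>R x"
proof -
  define y where "y = \<mu> *\<^sub>R x - T x"
  have yW: "y \<in> W" unfolding y_def using W x(1) TW by (simp add: subspace_diff subspace_scale)
  define q where "q = \<mu> * (y \<bullet> y) - y \<bullet> T y"
  have "0 \<le> 2 * s * (y \<bullet> y) + s\<^sup>2 * q" for s
  proof -
    have "x + s *\<^sub>R y \<in> W" using W x(1) yW by (simp add: subspace_add subspace_scale)
    from le[OF this] have "0 \<le> \<mu> * ((x + s *\<^sub>R y) \<bullet> (x + s *\<^sub>R y)) - (x + s *\<^sub>R y) \<bullet> T (x + s *\<^sub>R y)"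
      by simp
    also have "\<dots> = (\<mu> * (x \<bullet> x) - x \<bullet> T x) + 2 * s * (\<mu> * (y \<bullet> x) - y \<bullet> T x) + s\<^sup>2 * q"
      unfolding lin[OF x(1) yW] q_def using sym[OF x(1) yW]
      by (simp add: inner_add inner_commute algebra_simps power2_eq_square)
    also have "\<mu> * (y \<bullet> x) - y \<bullet> T x = y \<bullet> y" by (simp add: y_def inner_diff_right)
    finally show ?thesis using x(2) by simp
  qed
  note quad = this
  \<comment> \<open>The choice gives \<open>q < 2 * k\<close>, so
    \<open>s = - (y \<bullet> y) / k\<close> makes the quadratic negative unless
    \<open>y = 0\<close>.\<close>
  define k where "k = max 1 q"
  have k: "0 < k" "q - 2 * k < 0" by (auto simp: k_def)
  have "0 \<le> - 2 * (y \<bullet> y)\<^sup>2 / k + (y \<bullet> y)\<^sup>2 / k\<^sup>2 * q"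
    using quad[of "- (y \<bullet> y) / k"] by (simp add: power2_eq_square)
  also have "\<dots> = (y \<bullet> y)\<^sup>2 / k\<^sup>2 * (q - 2 * k)"
    using k(1) by (simp add: field_simps power2_eq_square)
  finally have "(y \<bullet> y)\<^sup>2 / k\<^sup>2 \<le> 0"
    using k(2) by (simp only: zero_le_mult_iff) linarith
  then have "(y \<bullet> y)\<^sup>2 \<le> 0" using k(1) by (simp add: pos_divide_le_eq)
  then have "y = 0" by simp
  then show ?thesis by (simp add: y_def)
qed

section \<open>The Jacobi operator and its unitary evolution\<close>

lemma in_l2_shift:
  assumes "in_l2 f"
  shows "in_l2 (\<lambda>m. f (m + k))"
proof -
  have "bij_betw (\<lambda>m. m + k) UNIV UNIV"
    by (rule bij_betw_byWitness[where f'="\<lambda>m. m - k"]) auto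
  from summable_on_reindex_bij_betw[OF this, of "\<lambda>m. (cmod (f m))\<^sup>2"]
  show ?thesis using assms by (simp add: in_l2_def)
qed

lemma jacobi_coord:
  "jacobi a \<omega> (coord (x + y)) = (\<lambda>n. jacobi a \<omega> (coord x) n + jacobi a \<omega> (coord y) n)"
  "jacobi a \<omega> (coord (x - y)) = (\<lambda>n. jacobi a \<omega> (coord x) n - jacobi a \<omega> (coord y) n)"
  "jacobi a \<omega> (coord (cscale c x)) = (\<lambda>n. c * jacobi a \<omega> (coord x) n)"
  by (rule ext; simp add: jacobi_def algebra_simps)+

text \<open>A total function that means something only on \<open>jdomain\<close>: elsewhere
  \<open>Abs_ell2\<close> is applied to a sequence that is not square-summable.\<close>

definition jop :: "(int \<Rightarrow> real) \<Rightarrow> (int \<Rightarrow> real) \<Rightarrow> ell2 \<Rightarrow> ell2" where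
  "jop a \<omega> x = Abs_ell2 (jacobi a \<omega> (coord x))"

definition jdomain :: "(int \<Rightarrow> real) \<Rightarrow> (int \<Rightarrow> real) \<Rightarrow> ell2 set" where
  "jdomain a \<omega> = {x. in_l2 (jacobi a \<omega> (coord x))}"

text \<open>No initial value is fixed, so differences and time shifts of orbits are orbits.\<close>

definition schrod_orbit :: "(int \<Rightarrow> real) \<Rightarrow> (int \<Rightarrow> real) \<Rightarrow> (real \<Rightarrow> ell2) \<Rightarrow> bool" where
  "schrod_orbit a \<omega> \<psi> \<longleftrightarrow> (\<forall>t. \<psi> t \<in> jdomain a \<omega> \<and>
     (\<psi> has_vector_derivative cscale (- \<i>) (jop a \<omega> (\<psi> t))) (at t))"

lemma coord_jop: "x \<in> jdomain a \<omega> \<Longrightarrow> coord (jop a \<omega> x) m = jacobi a \<omega> (coord x) m"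
  by (simp add: jdomain_def jop_def)

lemma jdomain_iff_jdom: "x \<in> jdomain a \<omega> \<longleftrightarrow> coord x \<in> jdom a \<omega>"
  by (simp add: jdomain_def jdom_def)

lemma jdomain_closed:
  "x \<in> jdomain a \<omega> \<Longrightarrow> y \<in> jdomain a \<omega> \<Longrightarrow> x + y \<in> jdomain a \<omega>"
  "x \<in> jdomain a \<omega> \<Longrightarrow> y \<in> jdomain a \<omega> \<Longrightarrow> x - y \<in> jdomain a \<omega>"
  "x \<in> jdomain a \<omega> \<Longrightarrow> cscale c x \<in> jdomain a \<omega>"
  "x \<in> jdomain a \<omega> \<Longrightarrow> r *\<^sub>R x \<in> jdomain a \<omega>"
  unfolding jdomain_def cscale_simps(9)[symmetric]
  by (simp_all only: mem_Collect_eq jacobi_coord in_l2_add in_l2_diff in_l2_scale)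

lemma jop_linear:
  "x \<in> jdomain a \<omega> \<Longrightarrow> y \<in> jdomain a \<omega> \<Longrightarrow> jop a \<omega> (x + y) = jop a \<omega> x + jop a \<omega> y"
  "x \<in> jdomain a \<omega> \<Longrightarrow> y \<in> jdomain a \<omega> \<Longrightarrow> jop a \<omega> (x - y) = jop a \<omega> x - jop a \<omega> y"
  "x \<in> jdomain a \<omega> \<Longrightarrow> jop a \<omega> (cscale c x) = cscale c (jop a \<omega> x)"
  "x \<in> jdomain a \<omega> \<Longrightarrow> jop a \<omega> (r *\<^sub>R x) = r *\<^sub>R jop a \<omega> x"
  unfolding cscale_simps(9)[symmetric]
  by (rule ell2_eqI; simp only: coord_ell2 coord_cscale coord_jop jdomain_closed jacobi_coord)+

lemma jdomain_finite_support:
  assumes "finite F" "\<And>m. m \<notin> F \<Longrightarrow> coord x m = 0"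
  shows "x \<in> jdomain a \<omega>"
proof -
  have "jacobi a \<omega> (coord x) m = 0" if "m \<notin> F \<union> (\<lambda>m. m - 1) ` F \<union> (\<lambda>m. m + 1) ` F" for m
  proof -
    have "m + 1 \<notin> F" "m - 1 \<notin> F" "m \<notin> F" using that by force+
    then show ?thesis by (simp add: jacobi_def assms(2))
  qed
  then show ?thesis
    unfolding jdomain_def mem_Collect_eq
    by (intro in_l2_finite_support[of "F \<union> (\<lambda>m. m - 1) ` F \<union> (\<lambda>m. m + 1) ` F"]) (use assms(1) in auto)
qed

lemma jdomain_zero: "0 \<in> jdomain a \<omega>"
  by (rule jdomain_finite_support[of "{}"]) auto

lemma jdomain_basis: "basis n \<in> jdomain a \<omega>"
  by (rule jdomain_finite_support[of "{n}"]) auto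

lemma jdomain_fvec: "finite F \<Longrightarrow> fvec F f \<in> jdomain a \<omega>"
  by (rule jdomain_finite_support[of F]) auto

lemma jop_basis:
  "jop a \<omega> (basis n) = a n *\<^sub>R basis (n + 1) + a (n - 1) *\<^sub>R basis (n - 1) + \<omega> n *\<^sub>R basis n"
  by (rule ell2_eqI) (auto simp: coord_jop jdomain_basis jacobi_def)

lemma inner_jop_basis: 
  "jop a \<omega> (basis m) \<bullet> y = Re (jacobi a \<omega> (coord y) m)"
  "cscale \<i> (jop a \<omega> (basis m)) \<bullet> y = Im (jacobi a \<omega> (coord y) m)"
proof -
  show "jop a \<omega> (basis m) \<bullet> y = Re (jacobi a \<omega> (coord y) m)"
    by (simp add: jop_basis inner_add_left inner_basis jacobi_def)
  show "cscale \<i> (jop a \<omega> (basis m)) \<bullet> y = Im (jacobi a \<omega> (coord y) m)"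
    by (simp add: jop_basis inner_add_left inner_basis_i jacobi_def cscale_scaleR)
qed

lemma inner_jop_fvec:
  assumes "finite F"
  shows "jop a \<omega> (fvec F f) \<bullet> y = (\<Sum>m\<in>F. f m \<bullet> jacobi a \<omega> (coord y) m)"
  using assms
proof (induction F)
  case empty
  have "fvec {} f = 0" by (rule ell2_eqI) simp
  moreover have "jop a \<omega> 0 = 0" by (rule ell2_eqI) (simp add: coord_jop jdomain_zero jacobi_def)
  ultimately show ?case by simp
next
  case (insert k F)
  have "fvec (insert k F) f = fvec F f + (Re (f k) *\<^sub>R basis k + Im (f k) *\<^sub>R cscale \<i> (basis k))"
    using insert by (simp add: fvec_decompose algebra_simps)
  then show ?case using insert
    by (simp add: jop_linear jdomain_closed jdomain_basis jdomain_fvec inner_add_left inner_jop_basis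
        inner_complex_def)
qed

text \<open>The domain contains that of the adjoint of \<open>J\<close> restricted to finitely
  supported vectors: choosing as test vector the truncation of
  \<open>jacobi a \<omega> (coord y)\<close> turns the linear bound into a bound of its norm by
  \<open>C\<close>.\<close>

lemma jdomain_dual:
  assumes "0 \<le> C" "\<And>F f. finite F \<Longrightarrow> \<bar>jop a \<omega> (fvec F f) \<bullet> y\<bar> \<le> C * norm (fvec F f)"
  shows "y \<in> jdomain a \<omega>" "norm (jop a \<omega> y) \<le> C"
proof -
  have "(\<Sum>m\<in>F. (cmod (jacobi a \<omega> (coord y) m))\<^sup>2) \<le> C\<^sup>2" if F: "finite F" for F
  proof -
    let ?n = "norm (fvec F (jacobi a \<omega> (coord y)))"
    have "?n\<^sup>2 \<le> C * ?n"
      using assms(2)[OF F, of "jacobi a \<omega> (coord y)"] F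
      by (simp add: inner_jop_fvec norm_fvec sum_nonneg flip: power2_norm_eq_inner)
    then have "?n \<le> C" using assms(1) by (cases "?n = 0") (auto simp: power2_eq_square)
    then show ?thesis using norm_fvec[OF F] by (metis norm_ge_zero power_mono)
  qed
  note * = in_l2_bounded_sums[OF this assms(1)]
  show "y \<in> jdomain a \<omega>" using *(1) by (simp add: jdomain_def)
  show "norm (jop a \<omega> y) \<le> C" using *(2) by (simp add: jop_def)
qed

text \<open>The norms of the two remainders coincide for \<open>h \<noteq> 0\<close>, which is all
  that the limit at 0 sees.\<close>

lemma schrod_sol_iff_orbit:
  "schrod_sol a \<omega> (coord x) (\<lambda>t. coord (\<psi> t)) \<longleftrightarrow> \<psi> 0 = x \<and> schrod_orbit a \<omega> \<psi>"
proof -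
  have "((\<lambda>h. l2norm (\<lambda>m. (coord (\<psi> (t + h)) m - coord (\<psi> t) m) / of_real h
      + \<i> * jacobi a \<omega> (coord (\<psi> t)) m)) \<longlongrightarrow> 0) (at 0)
    \<longleftrightarrow> (\<psi> has_vector_derivative cscale (- \<i>) (jop a \<omega> (\<psi> t))) (at t)" (is "(?f \<longlongrightarrow> 0) (at 0) \<longleftrightarrow> _")
    if dom: "\<psi> t \<in> jdomain a \<omega>" for t
  proof -
    let ?g = "\<lambda>h. norm (\<psi> (t + h) - \<psi> t - h *\<^sub>R cscale (- \<i>) (jop a \<omega> (\<psi> t))) / norm h"
    have "?f h = ?g h" if "h \<noteq> 0" for h
    proof -
      have "(\<lambda>m. (coord (\<psi> (t + h)) m - coord (\<psi> t) m) / of_real h + \<i> * jacobi a \<omega> (coord (\<psi> t)) m)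
        = coord (inverse h *\<^sub>R (\<psi> (t + h) - \<psi> t - h *\<^sub>R cscale (- \<i>) (jop a \<omega> (\<psi> t))))"
        using that by (auto simp: coord_jop[OF dom] field_simps)
      then show ?thesis
        by (simp add: norm_ell2_def[symmetric] divide_inverse mult.commute)
    qed
    then have "\<forall>\<^sub>F h in at 0. ?f h = ?g h"
      by (simp add: eventually_at_filter)
    then have "(?f \<longlongrightarrow> 0) (at 0) \<longleftrightarrow> (?g \<longlongrightarrow> 0) (at 0)" by (rule tendsto_cong)
    then show ?thesis
      by (simp add: has_vector_derivative_def has_derivative_at bounded_linear_scaleR_left)
  qed
  then show ?thesis
    unfolding schrod_sol_def schrod_orbit_def jdomain_iff_jdom[symmetric] coord_inject by blast
qed

lemma schrod_orbit_diff:
  assumes "schrod_orbit a \<omega> \<psi>" "schrod_orbit a \<omega> \<phi>"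
  shows "schrod_orbit a \<omega> (\<lambda>t. \<psi> t - \<phi> t)"
  using assms unfolding schrod_orbit_def
  by (auto simp: jop_linear jdomain_closed intro!: has_vector_derivative_diff)

lemma schrod_orbit_shift:
  assumes "schrod_orbit a \<omega> \<psi>"
  shows "schrod_orbit a \<omega> (\<lambda>t. \<psi> (s + t))"
proof -
  have "((\<lambda>t. \<psi> (s + t)) has_vector_derivative cscale (- \<i>) (jop a \<omega> (\<psi> (s + t)))) (at t)" for t
  proof -
    have "((\<lambda>t. s + t) has_vector_derivative 1) (at t)" by (auto intro!: derivative_eq_intros)
    moreover have "(\<psi> has_vector_derivative cscale (- \<i>) (jop a \<omega> (\<psi> (s + t)))) (at (s + t))"
      using assms by (simp add: schrod_orbit_def)
    ultimately show ?thesis using vector_diff_chain_at by (fastforce simp: o_def)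
  qed
  then show ?thesis using assms by (simp add: schrod_orbit_def)
qed

lemma schrod_orbit_inner_deriv:
  assumes "schrod_orbit a \<omega> \<psi>"
  shows "((\<lambda>t. w \<bullet> \<psi> t) has_real_derivative cscale \<i> w \<bullet> jop a \<omega> (\<psi> t)) (at t within A)"
proof -
  have "(\<psi> has_vector_derivative cscale (- \<i>) (jop a \<omega> (\<psi> t))) (at t within A)"
    using assms by (auto simp: schrod_orbit_def intro: has_vector_derivative_at_within)
  from bounded_linear.has_vector_derivative[OF bounded_linear_inner_right this, of w]
  show ?thesis by (simp add: has_real_derivative_iff_has_vector_derivative inner_cscale)
qed

lemma schrod_orbit_continuous: "schrod_orbit a \<omega> \<psi> \<Longrightarrow> continuous_on A \<psi>"
  unfolding schrod_orbit_def
  by (meson continuous_at_imp_continuous_on has_vector_derivative_continuous)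

text \<open>Only the off-diagonal is bounded. In the application the scales \<open>d n\<close> are
  arbitrary, so the potential, and with it the operator, may be unbounded.\<close>

locale jacobi_operator =
  fixes a \<omega> :: "int \<Rightarrow> real" and \<alpha> :: real
  assumes a_le: "\<And>n. \<bar>a n\<bar> \<le> \<alpha>"
begin

abbreviation "J \<equiv> jop a \<omega>"
abbreviation "D \<equiv> jdomain a \<omega>"

text \<open>On the domain, \<open>J\<close> splits into two mutually adjoint weighted shifts, which
  are bounded, and a real multiplication; no boundary terms arise.\<close>

lemma jop_symmetric:
  assumes "x \<in> D" "y \<in> D"
  shows "J x \<bullet> y = x \<bullet> J y"
proof -
  have \<alpha>0: "0 \<le> \<alpha>" using a_le[of 0] by linarith
  define R where "R x = Abs_ell2 (\<lambda>m. of_real (a m) * coord x (m + 1))" for x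
  define L where "L x = Abs_ell2 (\<lambda>m. of_real (a (m - 1)) * coord x (m - 1))" for x
  have R: "coord (R x) m = of_real (a m) * coord x (m + 1)" for x m
    unfolding R_def
    by (subst coord_Abs, rule in_l2_scale_bounded[OF in_l2_shift[OF in_l2_coord[of x], of 1], of _ \<alpha>])
      (auto simp: norm_mult intro!: mult_right_mono a_le)
  have L: "coord (L x) m = of_real (a (m - 1)) * coord x (m - 1)" for x m
    unfolding L_def
    by (subst coord_Abs, rule in_l2_scale_bounded[OF in_l2_shift[OF in_l2_coord[of x], of "-1"], of _ \<alpha>])
      (auto simp: norm_mult intro!: mult_right_mono a_le)
  have RL: "R x \<bullet> y = x \<bullet> L y" for x y
  proof -
    have "bij_betw (\<lambda>m::int. m - 1) UNIV UNIV"
      by (rule bij_betw_byWitness[where f'="\<lambda>m. m + 1"]) auto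
    from infsum_reindex_bij_betw[OF this, of "\<lambda>m. coord (R x) m \<bullet> coord y m"]
    have "R x \<bullet> y = infsum (\<lambda>m. coord (R x) (m - 1) \<bullet> coord y (m - 1)) UNIV"
      by (simp add: inner_ell2_def)
    also have "\<dots> = x \<bullet> L y"
      unfolding inner_ell2_def by (rule infsum_cong) (simp add: R L inner_complex_def algebra_simps)
    finally show ?thesis .
  qed
  \<comment> \<open>\<open>V x\<close> is defined as a difference, so it lies in the space by
    construction; on the domain it is multiplication by \<open>\<omega>\<close>.\<close>
  define V where "V x = J x - R x - L x" for x
  have V: "coord (V x) m = of_real (\<omega> m) * coord x m" if "x \<in> D" for x m
    using that by (simp add: V_def coord_jop R L jacobi_def)
  have "V x \<bullet> y = x \<bullet> V y"
    unfolding inner_ell2_def by (rule infsum_cong) (simp add: V assms inner_complex_def)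
  moreover have "J x = V x + R x + L x" for x by (simp add: V_def)
  ultimately show ?thesis
    using RL[of x y] RL[of y x] by (simp add: inner_add inner_commute)
qed

lemma inner_i_jop_eq:
  assumes "w \<in> D" "x \<in> D"
  shows "cscale \<i> w \<bullet> J x = cscale \<i> (J w) \<bullet> x"
  using jop_symmetric[of "cscale \<i> w" x] assms by (simp add: jop_linear jdomain_closed)

text \<open>Symmetry forces the quantity to be its own negative; in complex terms, the expectation
  of \<open>J\<close> at \<open>x\<close> is real.\<close>

lemma inner_i_jop_zero:
  assumes "x \<in> D"
  shows "cscale \<i> x \<bullet> J x = 0"
proof -
  have "cscale \<i> x \<bullet> J x = cscale \<i> (J x) \<bullet> x" by (rule inner_i_jop_eq[OF assms assms])
  also have "\<dots> = J x \<bullet> cscale (- \<i>) x" by (simp add: inner_cscale)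
  also have "\<dots> = - (cscale \<i> x \<bullet> J x)" by (simp add: cscale_neg_i inner_commute)
  finally show ?thesis by simp
qed

lemma schrod_orbit_norm:
  assumes "schrod_orbit a \<omega> \<psi>"
  shows "norm (\<psi> t) = norm (\<psi> s)"
proof -
  have "((\<lambda>t. \<psi> t \<bullet> \<psi> t) has_real_derivative 0) (at t)" for t
  proof -
    have *: "(\<psi> has_vector_derivative cscale (- \<i>) (J (\<psi> t))) (at t)" and dom: "\<psi> t \<in> D"
      using assms by (auto simp: schrod_orbit_def)
    have "((\<lambda>t. \<psi> t \<bullet> \<psi> t) has_vector_derivative
        (\<psi> t \<bullet> cscale (- \<i>) (J (\<psi> t)) + cscale (- \<i>) (J (\<psi> t)) \<bullet> \<psi> t)) (at t)"
      by (rule bounded_bilinear.has_vector_derivative[OF bounded_bilinear_inner * *])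
    moreover have "\<psi> t \<bullet> cscale (- \<i>) (J (\<psi> t)) = 0"
      using inner_i_jop_zero[OF dom] by (simp add: inner_cscale)
    ultimately show ?thesis
      by (simp add: has_real_derivative_iff_has_vector_derivative inner_commute)
  qed
  from DERIV_isconst_all[of "\<lambda>t. \<psi> t \<bullet> \<psi> t", of t s] this
  have "\<psi> t \<bullet> \<psi> t = \<psi> s \<bullet> \<psi> s" by blast
  then show ?thesis by (simp add: norm_eq_sqrt_inner)
qed

lemma schrod_orbit_unique:
  assumes "schrod_orbit a \<omega> \<psi>" "schrod_orbit a \<omega> \<phi>" "\<psi> 0 = \<phi> 0"
  shows "\<psi> = \<phi>"
proof
  fix t
  show "\<psi> t = \<phi> t"
    using schrod_orbit_norm[OF schrod_orbit_diff[OF assms(1,2)], of t 0] assms(3) by simp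
qed

lemma unitary_evol_eq:
  assumes "schrod_orbit a \<omega> \<psi>"
  shows "unitary_evol a \<omega> t (coord (\<psi> 0)) = coord (\<psi> t)"
proof -
  have "(THE f. schrod_sol a \<omega> (coord (\<psi> 0)) f) = (\<lambda>t. coord (\<psi> t))"
  proof (rule the_equality)
    show "schrod_sol a \<omega> (coord (\<psi> 0)) (\<lambda>t. coord (\<psi> t))"
      using assms by (simp add: schrod_sol_iff_orbit)
    fix f assume f: "schrod_sol a \<omega> (coord (\<psi> 0)) f"
    then have "in_l2 (f t)" for t by (simp add: schrod_sol_def jdom_def)
    then have f_eq: "f = (\<lambda>t. coord (Abs_ell2 (f t)))" by simp
    have "(\<lambda>t. Abs_ell2 (f t)) = \<psi>"
      using f by (subst (asm) f_eq) (auto simp: schrod_sol_iff_orbit intro!: schrod_orbit_unique assms)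
    then show "f = (\<lambda>t. coord (\<psi> t))" using f_eq by metis
  qed
  then show ?thesis by (simp add: unitary_evol_def)
qed

end

section \<open>Evolutions truncated to finite boxes\<close>

definition box_hop :: "nat \<Rightarrow> (int \<Rightarrow> real) \<Rightarrow> int \<Rightarrow> real" where
  "box_hop N a m = (if - int N \<le> m \<and> m < int N then a m else 0)"

definition box_pot :: "nat \<Rightarrow> (int \<Rightarrow> real) \<Rightarrow> int \<Rightarrow> real" where
  "box_pot N \<omega> m = (if - int N \<le> m \<and> m \<le> int N then \<omega> m else 0)"

primrec jpow :: "(int \<Rightarrow> real) \<Rightarrow> (int \<Rightarrow> real) \<Rightarrow> int \<Rightarrow> nat \<Rightarrow> int \<Rightarrow> complex" where
  "jpow a \<omega> n 0 = kdelta n"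
| "jpow a \<omega> n (Suc k) = jacobi a \<omega> (jpow a \<omega> n k)"

text \<open>Taylor coefficients in time of the entry \<open>(m, n)\<close> of the exponential of
  \<open>- \<i> * t\<close> times the box operator; \<open>jpow\<close> is column \<open>n\<close>
  of its k-th power.\<close>

definition box_coef where
  "box_coef a \<omega> N n m k = (- \<i>) ^ k * jpow (box_hop N a) (box_pot N \<omega>) n k m / fact k"

definition box_evol where
  "box_evol a \<omega> N n t m = (\<Sum>k. box_coef a \<omega> N n m k * of_real t ^ k)"

definition box_orbit where
  "box_orbit a \<omega> N n t = Abs_ell2 (box_evol a \<omega> N n t)"

text \<open>The bond \<open>m\<close> joins the sites \<open>m\<close> and \<open>m + 1\<close>,
  hence the strict bound \<open>m < int N\<close> in \<open>box_hop\<close>: no bond leaves the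
  box.\<close>

lemma jacobi_box_outside:
  assumes "m \<notin> {- int N..int N}"
  shows "jacobi (box_hop N a) (box_pot N \<omega>) f m = 0"
proof -
  have "m < - int N \<or> int N < m" using assms by auto
  then show ?thesis by (auto simp: jacobi_def box_hop_def box_pot_def)
qed

text \<open>The start site \<open>n\<close> is listed separately because it may lie outside the
  box.\<close>

lemma jpow_box_support:
  assumes "m \<notin> insert n {- int N..int N}"
  shows "jpow (box_hop N a) (box_pot N \<omega>) n k m = 0"
proof (cases k)
  case 0
  then show ?thesis using assms by (simp add: kdelta_def)
next
  case (Suc j)
  then show ?thesis using assms jacobi_box_outside[of m N] by simp
qed

text \<open>Only finitely many matrix entries of the box operator are nonzero, so its powers grow at
  most geometrically.\<close>

lemma jpow_box_bound: "\<exists>R\<ge>0. \<forall>n k m. cmod (jpow (box_hop N a) (box_pot N \<omega>) n k m) \<le> R ^ k"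
proof -
  define A where "A = (\<Sum>m\<in>{- int N..int N}. \<bar>a m\<bar>)"
  define W where "W = (\<Sum>m\<in>{- int N..int N}. \<bar>\<omega> m\<bar>)"
  have A: "\<bar>box_hop N a m\<bar> \<le> A" for m
    using member_le_sum[of m "{- int N..int N}" "\<lambda>m. \<bar>a m\<bar>"]
    by (auto simp: box_hop_def A_def intro!: sum_nonneg)
  have W: "\<bar>box_pot N \<omega> m\<bar> \<le> W" for m
    using member_le_sum[of m "{- int N..int N}" "\<lambda>m. \<bar>\<omega> m\<bar>"]
    by (auto simp: box_pot_def W_def intro!: sum_nonneg)
  have nn: "0 \<le> A" "0 \<le> W" by (auto simp: A_def W_def intro!: sum_nonneg)
  have "cmod (jpow (box_hop N a) (box_pot N \<omega>) n k m) \<le> (A + A + W) ^ k" for n k m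
  proof (induction k arbitrary: m)
    case 0
    then show ?case by (simp add: kdelta_def)
  next
    case (Suc k)
    let ?f = "jpow (box_hop N a) (box_pot N \<omega>) n k"
    have "cmod (of_real (box_hop N a m) * ?f (m + 1)) \<le> A * (A + A + W) ^ k"
      "cmod (of_real (box_hop N a (m - 1)) * ?f (m - 1)) \<le> A * (A + A + W) ^ k"
      "cmod (of_real (box_pot N \<omega> m) * ?f m) \<le> W * (A + A + W) ^ k"
      unfolding norm_mult norm_of_real by (intro mult_mono Suc.IH A W nn norm_ge_zero)+
    then show ?case
      unfolding jpow.simps jacobi_def power_Suc distrib_right
      by (intro norm_triangle_mono)
  qed
  then show ?thesis using nn by (intro exI[of _ "A + A + W"]) auto
qed

lemma summable_box_coef: "summable (\<lambda>k. box_coef a \<omega> N n m k * z ^ k)"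
proof -
  obtain R where R: "0 \<le> R" "\<And>n k m. cmod (jpow (box_hop N a) (box_pot N \<omega>) n k m) \<le> R ^ k"
    using jpow_box_bound by blast
  show ?thesis
  proof (rule summable_comparison_test')
    show "summable (\<lambda>k. inverse (fact k) * (R * cmod z) ^ k)" by (rule summable_exp)
    show "norm (box_coef a \<omega> N n m k * z ^ k) \<le> inverse (fact k) * (R * cmod z) ^ k" for k
      using mult_right_mono[OF R(2)[of n k m], of "cmod z ^ k"]
      by (simp add: box_coef_def norm_mult norm_divide norm_power power_mult_distrib divide_simps)
  qed
qed

lemma box_evol_sums: "(\<lambda>k. box_coef a \<omega> N n m k * of_real t ^ k) sums box_evol a \<omega> N n t m"
  unfolding box_evol_def by (rule summable_sums[OF summable_box_coef])

lemma box_evol_support: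
  assumes "m \<notin> insert n {- int N..int N}"
  shows "box_evol a \<omega> N n t m = 0"
  by (simp add: box_evol_def box_coef_def jpow_box_support[OF assms])

lemma coord_box_orbit: "coord (box_orbit a \<omega> N n t) = box_evol a \<omega> N n t"
  unfolding box_orbit_def
  by (intro coord_Abs in_l2_finite_support[of "insert n {- int N..int N}"] box_evol_support) auto

lemma diffs_box_coef:
  "diffs (box_coef a \<omega> N n m) k
    = - \<i> * ((- \<i>) ^ k * jpow (box_hop N a) (box_pot N \<omega>) n (Suc k) m / fact k)"
  by (simp add: diffs_def box_coef_def field_simps del: jpow.simps of_nat_Suc)

lemma diffs_box_coef_sums:
  "(\<lambda>k. diffs (box_coef a \<omega> N n m) k * of_real t ^ k) sums
     (- \<i> * jacobi (box_hop N a) (box_pot N \<omega>) (box_evol a \<omega> N n t) m)"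
proof -
  have "(\<lambda>k. - \<i> * (of_real (box_hop N a m) * (box_coef a \<omega> N n (m + 1) k * of_real t ^ k)
      + of_real (box_hop N a (m - 1)) * (box_coef a \<omega> N n (m - 1) k * of_real t ^ k)
      + of_real (box_pot N \<omega> m) * (box_coef a \<omega> N n m k * of_real t ^ k)))
    sums (- \<i> * jacobi (box_hop N a) (box_pot N \<omega>) (box_evol a \<omega> N n t) m)"
    unfolding jacobi_def by (intro sums_mult sums_add box_evol_sums)
  then show ?thesis
    by (rule sums_cong[THEN iffD1, rotated])
      (simp add: diffs_box_coef box_coef_def jacobi_def field_simps)
qed

lemma box_evol_deriv:
  "((\<lambda>t. box_evol a \<omega> N n t m) has_vector_derivative
      - \<i> * jacobi (box_hop N a) (box_pot N \<omega>) (box_evol a \<omega> N n t) m) (at t)"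
proof -
  have "((\<lambda>z. \<Sum>k. box_coef a \<omega> N n m k * z ^ k) has_field_derivative
      (\<Sum>k. diffs (box_coef a \<omega> N n m) k * of_real t ^ k)) (at (of_real t))"
    by (rule termdiffs_strong_converges_everywhere[OF summable_box_coef])
  from has_vector_derivative_real_field[OF this] show ?thesis
    using diffs_box_coef_sums[of a \<omega> N n m t] by (simp add: sums_iff box_evol_def)
qed

text \<open>\<open>J\<close> commutes with its powers, so it may act on the second index instead of the first.\<close>

lemma jpow_Suc_right:
  "jpow a \<omega> n (Suc k) m = of_real (a n) * jpow a \<omega> (n + 1) k m
     + of_real (a (n - 1)) * jpow a \<omega> (n - 1) k m + of_real (\<omega> n) * jpow a \<omega> n k m"
proof (induction k arbitrary: m)
  case 0
  then show ?case by (auto simp: jacobi_def kdelta_def)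
next
  case (Suc k)
  have "jpow a \<omega> n (Suc k) = (\<lambda>m. of_real (a n) * jpow a \<omega> (n + 1) k m
     + of_real (a (n - 1)) * jpow a \<omega> (n - 1) k m + of_real (\<omega> n) * jpow a \<omega> n k m)"
    by (rule ext) (rule Suc.IH)
  then have "jpow a \<omega> n (Suc (Suc k)) m = jacobi a \<omega> (\<lambda>m. of_real (a n) * jpow a \<omega> (n + 1) k m
     + of_real (a (n - 1)) * jpow a \<omega> (n - 1) k m + of_real (\<omega> n) * jpow a \<omega> n k m) m"
    by (simp only: jpow.simps(2)[of a \<omega> n "Suc k"])
  also have "\<dots> = of_real (a n) * jacobi a \<omega> (jpow a \<omega> (n + 1) k) m
     + of_real (a (n - 1)) * jacobi a \<omega> (jpow a \<omega> (n - 1) k) m + of_real (\<omega> n) * jacobi a \<omega> (jpow a \<omega> n k) m"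
    by (simp add: jacobi_def algebra_simps)
  finally show ?case by (simp only: jpow.simps)
qed

text \<open>Letting \<open>J\<close> act on the start site expresses its value along an orbit
  through three orbits of constant norm. This is the source of all bounds that are uniform in the
  box and in time.\<close>

lemma jop_box_orbit:
  "jop (box_hop N a) (box_pot N \<omega>) (box_orbit a \<omega> N n t)
    = box_hop N a n *\<^sub>R box_orbit a \<omega> N (n + 1) t
      + box_hop N a (n - 1) *\<^sub>R box_orbit a \<omega> N (n - 1) t + box_pot N \<omega> n *\<^sub>R box_orbit a \<omega> N n t"
proof (rule ell2_eqI)
  fix m
  have dom: "box_orbit a \<omega> N n t \<in> jdomain (box_hop N a) (box_pot N \<omega>)"
    by (rule jdomain_finite_support[of "insert n {- int N..int N}"])
      (simp, subst coord_box_orbit, rule box_evol_support)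
  have "(\<lambda>k. - \<i> * (of_real (box_hop N a n) * (box_coef a \<omega> N (n + 1) m k * of_real t ^ k)
      + of_real (box_hop N a (n - 1)) * (box_coef a \<omega> N (n - 1) m k * of_real t ^ k)
      + of_real (box_pot N \<omega> n) * (box_coef a \<omega> N n m k * of_real t ^ k)))
    sums (- \<i> * (of_real (box_hop N a n) * box_evol a \<omega> N (n + 1) t m
      + of_real (box_hop N a (n - 1)) * box_evol a \<omega> N (n - 1) t m
      + of_real (box_pot N \<omega> n) * box_evol a \<omega> N n t m))"
    by (intro sums_mult sums_add box_evol_sums)
  then have "(\<lambda>k. diffs (box_coef a \<omega> N n m) k * of_real t ^ k)
    sums (- \<i> * (of_real (box_hop N a n) * box_evol a \<omega> N (n + 1) t m
      + of_real (box_hop N a (n - 1)) * box_evol a \<omega> N (n - 1) t m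
      + of_real (box_pot N \<omega> n) * box_evol a \<omega> N n t m))"
    by (rule sums_cong[THEN iffD1, rotated])
      (simp add: diffs_box_coef jpow_Suc_right box_coef_def field_simps del: jpow.simps)
  from sums_unique2[OF this diffs_box_coef_sums]
  show "coord (jop (box_hop N a) (box_pot N \<omega>) (box_orbit a \<omega> N n t)) m
    = coord (box_hop N a n *\<^sub>R box_orbit a \<omega> N (n + 1) t
      + box_hop N a (n - 1) *\<^sub>R box_orbit a \<omega> N (n - 1) t + box_pot N \<omega> n *\<^sub>R box_orbit a \<omega> N n t) m"
    by (simp add: coord_jop[OF dom] coord_box_orbit)
qed

lemma box_orbit_schrod_orbit:
  "schrod_orbit (box_hop N a) (box_pot N \<omega>) (box_orbit a \<omega> N n)"
proof -
  let ?S = "insert n {- int N..int N}"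
  have dom: "box_orbit a \<omega> N n t \<in> jdomain (box_hop N a) (box_pot N \<omega>)" for t
    by (rule jdomain_finite_support[of ?S]) (simp, subst coord_box_orbit, rule box_evol_support)
  \<comment> \<open>All values lie in the span of finitely many basis vectors, so the derivative in
    norm follows from the coordinatewise ones.\<close>
  have repr: "x = (\<Sum>m\<in>?S. cscale (coord x m) (basis m))" if "\<And>m. m \<notin> ?S \<Longrightarrow> coord x m = 0" for x
  proof (rule ell2_eqI)
    fix k
    have "coord (\<Sum>m\<in>?S. cscale (coord x m) (basis m)) k = (\<Sum>m\<in>?S. if k = m then coord x m else 0)"
      unfolding coord_sum by (rule sum.cong) auto
    then show "coord x k = coord (\<Sum>m\<in>?S. cscale (coord x m) (basis m)) k"
      using that[of k] by (simp only: sum.delta' finite_insert finite_atLeastAtMost_int) auto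
  qed
  have "(box_orbit a \<omega> N n has_vector_derivative
      cscale (- \<i>) (jop (box_hop N a) (box_pot N \<omega>) (box_orbit a \<omega> N n t))) (at t)" for t
  proof -
    let ?D = "cscale (- \<i>) (jop (box_hop N a) (box_pot N \<omega>) (box_orbit a \<omega> N n t))"
    have D: "coord ?D m = - \<i> * jacobi (box_hop N a) (box_pot N \<omega>) (box_evol a \<omega> N n t) m" for m
      by (simp add: coord_jop[OF dom] coord_box_orbit)
    have "((\<lambda>t. \<Sum>m\<in>?S. cscale (box_evol a \<omega> N n t m) (basis m)) has_vector_derivative
      (\<Sum>m\<in>?S. cscale (coord ?D m) (basis m))) (at t)"
      unfolding D
      by (intro has_vector_derivative_sum box_evol_deriv bounded_linear.has_vector_derivative[OF
          bounded_bilinear.bounded_linear_left[OF bounded_bilinear_cscale]])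
    moreover have "(\<Sum>m\<in>?S. cscale (coord ?D m) (basis m)) = ?D"
      by (rule repr[symmetric]) (subst D, subst jacobi_box_outside, auto)
    moreover have "(\<lambda>t. \<Sum>m\<in>?S. cscale (box_evol a \<omega> N n t m) (basis m)) = box_orbit a \<omega> N n"
    proof
      fix t show "(\<Sum>m\<in>?S. cscale (box_evol a \<omega> N n t m) (basis m)) = box_orbit a \<omega> N n t"
        by (rule repr[of "box_orbit a \<omega> N n t", unfolded coord_box_orbit, OF box_evol_support, symmetric])
    qed
    ultimately show ?thesis by simp
  qed
  then show ?thesis using dom by (simp add: schrod_orbit_def)
qed

lemma box_orbit_0: "box_orbit a \<omega> N n 0 = basis n"
proof (rule ell2_eqI)
  fix m
  have "(\<lambda>k. box_coef a \<omega> N n m k * of_real 0 ^ k) sums box_coef a \<omega> N n m 0"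
    using powser_sums_zero[of "box_coef a \<omega> N n m"] by simp
  from sums_unique2[OF box_evol_sums[of a \<omega> N n m 0] this]
  show "coord (box_orbit a \<omega> N n 0) m = coord (basis n) m"
    by (simp add: coord_box_orbit box_coef_def kdelta_def)
qed

text \<open>Fatou's lemma on finite partial sums: coordinatewise limits keep a norm bound.\<close>

lemma norm_le_of_coord_limit:
  assumes "G \<noteq> bot" "\<And>m. ((\<lambda>N. coord (v N) m) \<longlongrightarrow> f m) G" "\<And>N. norm (v N) \<le> K"
  shows "in_l2 f" "norm (Abs_ell2 f) \<le> K"
proof -
  have "0 \<le> K" using assms(3) norm_ge_zero order_trans by blast
  have "(\<Sum>m\<in>F. (cmod (f m))\<^sup>2) \<le> K\<^sup>2" if "finite F" for F
  proof (rule tendsto_upperbound[OF _ always_eventually assms(1)])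
    show "((\<lambda>N. \<Sum>m\<in>F. (cmod (coord (v N) m))\<^sup>2) \<longlongrightarrow> (\<Sum>m\<in>F. (cmod (f m))\<^sup>2)) G"
      by (intro tendsto_intros assms)
    show "\<forall>N. (\<Sum>m\<in>F. (cmod (coord (v N) m))\<^sup>2) \<le> K\<^sup>2"
      using sum_coord_le[OF that] assms(3) by (meson norm_ge_zero order_trans power_mono)
  qed
  from in_l2_bounded_sums[OF this \<open>0 \<le> K\<close>] show "in_l2 f" "norm (Abs_ell2 f) \<le> K" by auto
qed

section \<open>Limits of the truncated evolutions\<close>

context jacobi_operator
begin

text \<open>Built on the definite description in \<open>unitary_evol\<close>; that a solution exists
  is obtained from the limit points of the box evolutions.\<close>

definition evol :: "int \<Rightarrow> real \<Rightarrow> ell2" where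
  "evol n t = Abs_ell2 (unitary_evol a \<omega> t (kdelta n))"

lemma box_hop_le: "\<bar>box_hop N a m\<bar> \<le> \<alpha>"
  using a_le[of m] by (auto simp: box_hop_def)

lemma box_pot_le: "\<bar>box_pot N \<omega> m\<bar> \<le> \<bar>\<omega> m\<bar>"
  by (auto simp: box_pot_def)

lemma norm_box_orbit: "norm (box_orbit a \<omega> N n t) = 1"
proof -
  interpret box: jacobi_operator "box_hop N a" "box_pot N \<omega>" \<alpha>
    by standard (rule box_hop_le)
  show ?thesis
    using box.schrod_orbit_norm[OF box_orbit_schrod_orbit, of n t 0] by (simp add: box_orbit_0)
qed

lemma norm_hopping_le:
  assumes "norm x \<le> p" "norm y \<le> q" "norm z \<le> r"
  shows "norm (box_hop N a n *\<^sub>R x + box_hop N a (n - 1) *\<^sub>R y + box_pot N \<omega> n *\<^sub>R z)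
    \<le> \<alpha> * p + \<alpha> * q + \<bar>\<omega> n\<bar> * (r::real)"
proof -
  have "0 \<le> \<alpha>" using a_le[of 0] by linarith
  then show ?thesis
    using assms box_hop_le box_pot_le
    by (intro norm_triangle_mono) (auto intro!: mult_mono)
qed

definition speed :: "int \<Rightarrow> real" where
  "speed n = 2 * \<alpha> + \<bar>\<omega> n\<bar>"

lemma norm_jop_box_orbit:
  "norm (jop (box_hop N a) (box_pot N \<omega>) (box_orbit a \<omega> N n t)) \<le> speed n"
  using norm_hopping_le[of "box_orbit a \<omega> N (n + 1) t" 1 "box_orbit a \<omega> N (n - 1) t" 1 "box_orbit a \<omega> N n t" 1 N n]
  by (simp add: jop_box_orbit norm_box_orbit speed_def)

lemma box_orbit_Lipschitz:
  "norm (box_orbit a \<omega> N n s - box_orbit a \<omega> N n t) \<le> speed n * \<bar>s - t\<bar>"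
proof -
  have "norm (box_orbit a \<omega> N n s - box_orbit a \<omega> N n t) \<le> speed n * norm (s - t)"
  proof (rule differentiable_bound[of UNIV])
    fix x :: real
    let ?d = "cscale (- \<i>) (jop (box_hop N a) (box_pot N \<omega>) (box_orbit a \<omega> N n x))"
    show "(box_orbit a \<omega> N n has_derivative (\<lambda>h. h *\<^sub>R ?d)) (at x within UNIV)"
      using box_orbit_schrod_orbit[of N a \<omega> n] by (simp add: schrod_orbit_def has_vector_derivative_def)
    have "norm ?d \<le> speed n" using norm_jop_box_orbit by simp
    then have "norm (h *\<^sub>R ?d) \<le> speed n * norm h" for h
      using mult_right_mono[of "norm ?d" "speed n" "\<bar>h\<bar>"] by (simp add: mult.commute)
    then show "onorm (\<lambda>h. h *\<^sub>R ?d) \<le> speed n" by (rule onorm_le)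
  qed auto
  then show ?thesis by simp
qed

text \<open>A Lipschitz constant of the velocity: by \<open>jop_box_orbit\<close> the velocity is a
  combination of the orbits from \<open>n + 1\<close>, \<open>n - 1\<close> and \<open>n\<close>,
  each with its own \<open>speed\<close>.\<close>

definition accel :: "int \<Rightarrow> real" where
  "accel n = \<alpha> * speed (n + 1) + \<alpha> * speed (n - 1) + \<bar>\<omega> n\<bar> * speed n"

lemma box_orbit_Taylor:
  "norm (box_orbit a \<omega> N n (t + h) - box_orbit a \<omega> N n t
      - h *\<^sub>R cscale (- \<i>) (jop (box_hop N a) (box_pot N \<omega>) (box_orbit a \<omega> N n t))) \<le> accel n * h\<^sup>2"
proof -
  let ?X = "\<lambda>n s. box_orbit a \<omega> N n s"
  let ?d = "\<lambda>s. cscale (- \<i>) (jop (box_hop N a) (box_pot N \<omega>) (?X n s))"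
  have "norm (?X n (t + h) - ?X n t - (t + h - t) *\<^sub>R ?d t) \<le> norm (t + h - t) * (accel n * \<bar>h\<bar>)"
  proof (rule vector_differentiable_bound_linearization[where S="closed_segment t (t + h)"])
    fix s assume s: "s \<in> closed_segment t (t + h)"
    show "(?X n has_vector_derivative ?d s) (at s within closed_segment t (t + h))"
      using box_orbit_schrod_orbit[of N a \<omega> n]
      by (auto simp: schrod_orbit_def intro: has_vector_derivative_at_within)
    have st: "\<bar>s - t\<bar> \<le> \<bar>h\<bar>" using segment_bound1[OF s] by simp
    have sp: "0 \<le> speed k" for k using a_le[of 0] by (simp add: speed_def)
    have L: "norm (?X k s - ?X k t) \<le> speed k * \<bar>h\<bar>" for k
      using box_orbit_Lipschitz[of N k s t] mult_left_mono[OF st sp] by (rule order_trans)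
    let ?Z = "box_hop N a n *\<^sub>R (?X (n + 1) s - ?X (n + 1) t)
        + box_hop N a (n - 1) *\<^sub>R (?X (n - 1) s - ?X (n - 1) t) + box_pot N \<omega> n *\<^sub>R (?X n s - ?X n t)"
    have "norm ?Z \<le> accel n * \<bar>h\<bar>"
      using norm_hopping_le[OF L L L, of N n "n + 1" "n - 1" n]
      by (simp add: accel_def algebra_simps)
    moreover have "?d s - ?d t = cscale (- \<i>) ?Z"
      unfolding jop_box_orbit by (rule ell2_eqI) (simp add: algebra_simps)
    ultimately show "norm (?d s - ?d t) \<le> accel n * \<bar>h\<bar>" by (simp only: norm_cscale) simp
  qed auto
  then show ?thesis by (simp add: power2_eq_square mult.left_commute)
qed

text \<open>The second-order Taylor bound is uniform in the box and survives weak limits, so every weak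
  limit point of the truncated evolutions solves the Schroedinger equation.\<close>

lemma box_orbit_cluster:
  assumes F: "F \<noteq> bot" "F \<le> sequentially"
  shows "\<exists>G \<phi>. G \<le> F \<and> G \<noteq> bot
    \<and> (\<forall>n t m. ((\<lambda>N. coord (box_orbit a \<omega> N n t) m) \<longlongrightarrow> coord (\<phi> n t) m) G)
    \<and> (\<forall>n. schrod_orbit a \<omega> (\<phi> n) \<and> \<phi> n 0 = basis n)
    \<and> (\<forall>n t. J (\<phi> n t) = a n *\<^sub>R \<phi> (n + 1) t + a (n - 1) *\<^sub>R \<phi> (n - 1) t + \<omega> n *\<^sub>R \<phi> n t)"
proof -
  let ?X = "box_orbit a \<omega>"
  let ?JN = "\<lambda>N. jop (box_hop N a) (box_pot N \<omega>)"
  \<comment> \<open>One filter serves all start sites and all times, so relations between them pass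
    to the limit.\<close>
  have "\<exists>G y. G \<le> F \<and> G \<noteq> bot \<and> (\<forall>p w. ((\<lambda>N. w \<bullet> (\<lambda>(n, t). ?X N n t) p) \<longlongrightarrow> w \<bullet> y p) G)"
  proof (rule ell2_weak_cluster_functional[OF F(1), where C="\<lambda>_. 1"])
    show "linear (\<lambda>w. w \<bullet> x)" for x :: ell2
      using bounded_linear.linear[OF bounded_linear_inner_left] .
    show "\<bar>w \<bullet> (\<lambda>(n, t). ?X N n t) p\<bar> \<le> 1 * norm w" for N p and w
      using Cauchy_Schwarz_ineq2[of w "?X N (fst p) (snd p)"] by (simp add: norm_box_orbit split_beta)
  qed
  then obtain G y where G: "G \<le> F" "G \<noteq> bot"
    and weak: "\<And>p w. ((\<lambda>N. w \<bullet> (\<lambda>(n, t). ?X N n t) p) \<longlongrightarrow> w \<bullet> y p) G" by blast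
  define \<phi> where "\<phi> n t = y (n, t)" for n t
  have c: "((\<lambda>N. coord (?X N n t) m) \<longlongrightarrow> coord (\<phi> n t) m) G" for n t m
    using weak_tendsto_coord[OF weak[of _ "(n, t)"], of m] by (simp add: \<phi>_def)
  \<comment> \<open>At a fixed site the truncation is invisible as soon as \<open>N\<close> exceeds
    \<open>\<bar>m\<bar>\<close>.\<close>
  have ev: "\<forall>\<^sub>F N in G. box_hop N a m = a m \<and> box_hop N a (m - 1) = a (m - 1) \<and> box_pot N \<omega> m = \<omega> m" for m
  proof (rule filter_leD[OF order_trans[OF G(1) F(2)]])
    show "\<forall>\<^sub>F N in sequentially. box_hop N a m = a m \<and> box_hop N a (m - 1) = a (m - 1) \<and> box_pot N \<omega> m = \<omega> m"
      using eventually_ge_at_top[of "nat (\<bar>m\<bar> + 1)"]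
      by eventually_elim (auto simp: box_hop_def box_pot_def)
  qed
  have dom_box: "?X N n t \<in> jdomain (box_hop N a) (box_pot N \<omega>)" for N n t
    using box_orbit_schrod_orbit[of N a \<omega> n] by (simp add: schrod_orbit_def)
  have cJ: "((\<lambda>N. coord (?JN N (?X N n t)) m) \<longlongrightarrow> jacobi a \<omega> (coord (\<phi> n t)) m) G" for n t m
  proof -
    have "((\<lambda>N. jacobi a \<omega> (coord (?X N n t)) m) \<longlongrightarrow> jacobi a \<omega> (coord (\<phi> n t)) m) G"
      unfolding jacobi_def by (intro tendsto_intros c)
    moreover have "\<forall>\<^sub>F N in G. jacobi a \<omega> (coord (?X N n t)) m = coord (?JN N (?X N n t)) m"
      using ev[of m] by eventually_elim (simp add: coord_jop[OF dom_box] jacobi_def)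
    ultimately show ?thesis by (rule Lim_transform_eventually)
  qed
  have dom: "\<phi> n t \<in> D" for n t
    using norm_le_of_coord_limit(1)[OF G(2) cJ norm_jop_box_orbit] by (simp add: jdomain_def)
  have cJ': "((\<lambda>N. coord (?JN N (?X N n t)) m) \<longlongrightarrow> coord (J (\<phi> n t)) m) G" for n t m
    using cJ by (simp add: coord_jop[OF dom])
  have Taylor: "norm (\<phi> n (t + h) - \<phi> n t - h *\<^sub>R cscale (- \<i>) (J (\<phi> n t))) \<le> accel n * h\<^sup>2" for n t h
  proof -
    let ?v = "\<phi> n (t + h) - \<phi> n t - h *\<^sub>R cscale (- \<i>) (J (\<phi> n t))"
    have "((\<lambda>N. coord (?X N n (t + h) - ?X N n t - h *\<^sub>R cscale (- \<i>) (?JN N (?X N n t))) m)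
        \<longlongrightarrow> coord ?v m) G" for m
      unfolding coord_ell2 coord_cscale by (intro tendsto_intros c cJ')
    from norm_le_of_coord_limit(2)[OF G(2) this box_orbit_Taylor] show ?thesis
      by (simp only: coord_inverse)
  qed
  have "(\<phi> n has_vector_derivative cscale (- \<i>) (J (\<phi> n t))) (at t)" for n t
  proof -
    let ?g = "\<lambda>h. norm (\<phi> n (t + h) - \<phi> n t - h *\<^sub>R cscale (- \<i>) (J (\<phi> n t))) / norm h"
    have "(?g \<longlongrightarrow> 0) (at 0)"
    proof (rule tendsto_sandwich[OF _ _ tendsto_const])
      show "\<forall>\<^sub>F h in at 0. 0 \<le> ?g h" by simp
      show "\<forall>\<^sub>F h in at 0. ?g h \<le> accel n * \<bar>h\<bar>"
        using Taylor[of n t]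
        by (auto simp: eventually_at_filter divide_le_eq power2_eq_square mult.assoc)
      have "((\<lambda>h. accel n * \<bar>h\<bar>) \<longlongrightarrow> accel n * \<bar>0\<bar>) (at 0)" by (intro tendsto_intros)
      then show "((\<lambda>h. accel n * \<bar>h\<bar>) \<longlongrightarrow> 0) (at 0)" by simp
    qed
    then show ?thesis
      by (simp add: has_vector_derivative_def has_derivative_at bounded_linear_scaleR_left)
  qed
  then have orb: "schrod_orbit a \<omega> (\<phi> n)" for n using dom by (simp add: schrod_orbit_def)
  have init: "\<phi> n 0 = basis n" for n
    by (rule ell2_eqI, rule tendsto_unique[OF G(2) c]) (simp add: box_orbit_0)
  have comm: "J (\<phi> n t) = a n *\<^sub>R \<phi> (n + 1) t + a (n - 1) *\<^sub>R \<phi> (n - 1) t + \<omega> n *\<^sub>R \<phi> n t" for n t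
  proof (rule ell2_eqI, rule tendsto_unique[OF G(2) cJ'])
    fix m
    let ?L = "\<lambda>N. a n *\<^sub>R ?X N (n + 1) t + a (n - 1) *\<^sub>R ?X N (n - 1) t + \<omega> n *\<^sub>R ?X N n t"
    have "((\<lambda>N. coord (?L N) m)
      \<longlongrightarrow> coord (a n *\<^sub>R \<phi> (n + 1) t + a (n - 1) *\<^sub>R \<phi> (n - 1) t + \<omega> n *\<^sub>R \<phi> n t) m) G"
      unfolding coord_ell2 by (intro tendsto_intros c)
    moreover have "\<forall>\<^sub>F N in G. coord (?L N) m = coord (?JN N (?X N n t)) m"
      using ev[of n] by eventually_elim (simp only: jop_box_orbit)
    ultimately show "((\<lambda>N. coord (?JN N (?X N n t)) m)
      \<longlongrightarrow> coord (a n *\<^sub>R \<phi> (n + 1) t + a (n - 1) *\<^sub>R \<phi> (n - 1) t + \<omega> n *\<^sub>R \<phi> n t) m) G"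
      by (rule Lim_transform_eventually)
  qed
  show ?thesis using G c orb init comm by blast
qed

lemma evol_eq_orbit:
  assumes "schrod_orbit a \<omega> \<phi>" "\<phi> 0 = basis n"
  shows "evol n = \<phi>"
proof
  fix t
  have "coord (\<phi> 0) = kdelta n" using assms(2) by (simp add: basis_def)
  then show "evol n t = \<phi> t"
    using unitary_evol_eq[OF assms(1), of t] by (simp add: evol_def coord_inverse)
qed

lemma box_orbit_cluster_evol:
  assumes F: "F \<noteq> bot" "F \<le> sequentially"
  shows "\<exists>G. G \<le> F \<and> G \<noteq> bot
    \<and> (\<forall>n t m. ((\<lambda>N. coord (box_orbit a \<omega> N n t) m) \<longlongrightarrow> coord (evol n t) m) G)"
proof -
  from box_orbit_cluster[OF F] obtain G \<phi> where *: "G \<le> F" "G \<noteq> bot"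
    "\<forall>n t m. ((\<lambda>N. coord (box_orbit a \<omega> N n t) m) \<longlongrightarrow> coord (\<phi> n t) m) G"
    "\<forall>n. schrod_orbit a \<omega> (\<phi> n) \<and> \<phi> n 0 = basis n"
    by blast
  then have "evol n = \<phi> n" for n using evol_eq_orbit by blast
  then show ?thesis using * by metis
qed

lemma evol:
  shows evol_orbit: "schrod_orbit a \<omega> (evol n)" and evol_0: "evol n 0 = basis n"
    and evol_step: "J (evol n t) = a n *\<^sub>R evol (n + 1) t + a (n - 1) *\<^sub>R evol (n - 1) t + \<omega> n *\<^sub>R evol n t"
proof -
  from box_orbit_cluster[OF sequentially_bot order_refl] obtain \<phi> where *:
    "\<forall>n. schrod_orbit a \<omega> (\<phi> n) \<and> \<phi> n 0 = basis n"
    "\<forall>n t. J (\<phi> n t) = a n *\<^sub>R \<phi> (n + 1) t + a (n - 1) *\<^sub>R \<phi> (n - 1) t + \<omega> n *\<^sub>R \<phi> n t"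
    by blast
  then have "evol n = \<phi> n" for n using evol_eq_orbit by blast
  then show "schrod_orbit a \<omega> (evol n)" "evol n 0 = basis n"
    "J (evol n t) = a n *\<^sub>R evol (n + 1) t + a (n - 1) *\<^sub>R evol (n - 1) t + \<omega> n *\<^sub>R evol n t"
    using * by simp_all
qed

lemma norm_evol: "norm (evol n t) = 1"
  using schrod_orbit_norm[OF evol_orbit, of n t 0] by (simp add: evol_0)

lemma matrix_elem_eq: "matrix_elem a \<omega> m n t = coord (evol n t) m"
proof -
  have "coord (evol n 0) = kdelta n" by (simp add: evol_0 basis_def)
  then show ?thesis
    using unitary_evol_eq[OF evol_orbit, of t n] by (simp add: matrix_elem_def)
qed

text \<open>If convergence failed, the filter of bad indices would still have a finer one along
  which the boxes converge to the unique orbit, a contradiction.\<close>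

lemma box_evol_tendsto: "(\<lambda>N. box_evol a \<omega> N n t m) \<longlonglongrightarrow> matrix_elem a \<omega> m n t"
proof (rule ccontr)
  assume "\<not> ?thesis"
  then obtain e where e: "0 < e" "\<not> (\<forall>\<^sub>F N in sequentially. dist (box_evol a \<omega> N n t m) (matrix_elem a \<omega> m n t) < e)"
    unfolding tendsto_iff by blast
  let ?P = "{N. \<not> dist (box_evol a \<omega> N n t m) (matrix_elem a \<omega> m n t) < e}"
  define F where "F = inf sequentially (principal ?P)"
  have "F \<noteq> bot" "F \<le> sequentially"
    using e(2) by (auto simp: F_def trivial_limit_def eventually_inf_principal)
  from box_orbit_cluster_evol[OF this] obtain G where G: "G \<le> F" "G \<noteq> bot"
    "((\<lambda>N. box_evol a \<omega> N n t m) \<longlongrightarrow> matrix_elem a \<omega> m n t) G"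
    by (auto simp: coord_box_orbit matrix_elem_eq)
  have "\<forall>\<^sub>F N in G. dist (box_evol a \<omega> N n t m) (matrix_elem a \<omega> m n t) < e"
    using G(3) e(1) by (rule tendstoD)
  moreover have "\<forall>\<^sub>F N in G. \<not> dist (box_evol a \<omega> N n t m) (matrix_elem a \<omega> m n t) < e"
    by (rule filter_leD[OF G(1)]) (simp add: F_def eventually_inf_principal)
  ultimately have "\<forall>\<^sub>F N in G. False" by eventually_elim simp
  then show False using G(2) by (simp add: trivial_limit_def)
qed

end

text \<open>Coefficients of the box evolution are polynomials in finitely many values of
  \<open>\<omega>\<close>, and the boxes converge for every \<open>\<omega>\<close>, so
  measurability passes to the pointwise limit.\<close>

lemma matrix_elem_measurable:
  assumes a: "\<And>n. \<bar>a n\<bar> \<le> \<alpha>" and M: "\<And>m. (\<lambda>\<omega>. \<omega> m) \<in> borel_measurable M"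
  shows "(\<lambda>\<omega>. matrix_elem a \<omega> m n t) \<in> borel_measurable M"
proof (rule borel_measurable_LIMSEQ_metric)
  fix N
  have "(\<lambda>\<omega>. box_pot N \<omega> m) \<in> borel_measurable M" for m
    using M by (cases "- int N \<le> m \<and> m \<le> int N") (simp_all add: box_pot_def)
  then have pot: "(\<lambda>\<omega>. complex_of_real (box_pot N \<omega> m)) \<in> borel_measurable M" for m
    by (rule measurable_compose) (intro borel_measurable_continuous_onI continuous_intros)
  have "(\<lambda>\<omega>. jpow (box_hop N a) (box_pot N \<omega>) n k m) \<in> borel_measurable M" for k m
  proof (induction k arbitrary: m)
    case (Suc k)
    show ?case unfolding jpow.simps jacobi_def
      by (intro borel_measurable_add borel_measurable_times pot Suc.IH borel_measurable_const)
  qed simp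
  then show "(\<lambda>\<omega>. box_evol a \<omega> N n t m) \<in> borel_measurable M"
    unfolding box_evol_def box_coef_def
    by (intro borel_measurable_suminf borel_measurable_times borel_measurable_divide borel_measurable_const)
next
  fix \<omega> :: "int \<Rightarrow> real"
  interpret jacobi_operator a \<omega> \<alpha> by standard (rule a)
  show "(\<lambda>N. box_evol a \<omega> N n t m) \<longlonglongrightarrow> matrix_elem a \<omega> m n t" by (rule box_evol_tendsto)
qed

section \<open>Ergodic means and decay of eigenfunctions\<close>

text \<open>For \<open>T \<le> 0\<close> the average is \<open>0\<close>.\<close>

definition avg :: "(real \<Rightarrow> real) \<Rightarrow> real \<Rightarrow> real" where
  "avg f T = integral {0..T} f / T"

lemma avg_add:
  "continuous_on UNIV f \<Longrightarrow> continuous_on UNIV g \<Longrightarrow> avg (\<lambda>t. f t + g t) T = avg f T + avg g T"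
  unfolding avg_def
  by (subst integral_add) (auto simp: add_divide_distrib intro!: integrable_continuous_real intro: continuous_on_subset)

lemma avg_diff:
  "continuous_on UNIV f \<Longrightarrow> continuous_on UNIV g \<Longrightarrow> avg (\<lambda>t. f t - g t) T = avg f T - avg g T"
  unfolding avg_def
  by (subst integral_diff) (auto simp: diff_divide_distrib intro!: integrable_continuous_real intro: continuous_on_subset)

lemma avg_cmult: "avg (\<lambda>t. c * f t) T = c * avg f T"
  by (simp add: avg_def)

lemma avg_bound:
  assumes f: "continuous_on UNIV f" and K: "\<And>t. \<bar>f t\<bar> \<le> K"
  shows "\<bar>avg f T\<bar> \<le> K"
proof (cases "0 < T")
  case True
  have "(f has_integral integral {0..T} f) (cbox 0 T)"
    using integrable_continuous_real[OF continuous_on_subset[OF f]] by auto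
  moreover have "0 \<le> K" using K[of 0] by linarith
  ultimately have "norm (integral {0..T} f) \<le> K * measure lborel (cbox 0 T)"
    using K by (intro has_integral_bound[of K f]) auto
  then have "\<bar>integral {0..T} f\<bar> \<le> K * T" using True by simp
  then show ?thesis using True by (simp add: avg_def divide_le_eq)
next
  case False
  then have "avg f T = 0" by (cases "T = 0") (auto simp: avg_def)
  then show ?thesis using K[of 0] by auto
qed

lemma avg_mono:
  assumes "continuous_on UNIV f" "continuous_on UNIV g" "\<And>t. f t \<le> g t"
  shows "avg f T \<le> avg g T"
proof (cases "0 < T")
  case True
  have "integral {0..T} f \<le> integral {0..T} g"
    by (intro integral_le integrable_continuous_real continuous_on_subset[OF assms(1)]
        continuous_on_subset[OF assms(2)]) (auto simp: assms(3))
  then show ?thesis using True by (simp add: avg_def divide_right_mono)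
next
  case False
  then show ?thesis by (cases "T = 0") (auto simp: avg_def)
qed

text \<open>By the fundamental theorem the integral is a difference of two bounded values, and
  division by \<open>T\<close> sends it to 0.\<close>

lemma avg_derivative_tendsto_0:
  assumes g: "\<And>t. (g has_real_derivative f t) (at t)" and K: "\<And>t. \<bar>g t\<bar> \<le> K"
  shows "(avg f \<longlongrightarrow> 0) at_top"
proof (rule Lim_null_comparison)
  have "norm (avg f T) \<le> (2 * K) * inverse T" if "0 < T" for T
  proof -
    have "(f has_integral (g T - g 0)) {0..T}"
      using that g
      by (intro fundamental_theorem_of_calculus)
        (auto simp: has_real_derivative_iff_has_vector_derivative[symmetric]
          intro: has_field_derivative_at_within)
    then have "avg f T = (g T - g 0) / T" by (simp add: avg_def integral_unique)
    moreover have "\<bar>g T - g 0\<bar> \<le> 2 * K" using K[of T] K[of 0] by linarith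
    ultimately show ?thesis using that by (simp add: divide_inverse abs_mult mult_right_mono)
  qed
  then show "\<forall>\<^sub>F T in at_top. norm (avg f T) \<le> (2 * K) * inverse T"
    by (intro eventually_mono[OF eventually_gt_at_top[of 0]])
  show "((\<lambda>T. 2 * K * inverse T) \<longlongrightarrow> 0) at_top"
    using tendsto_mult_right_zero[OF tendsto_inverse_0_at_top[OF filterlim_ident]] by simp
qed

lemma avg_const: "0 < T \<Longrightarrow> avg (\<lambda>t. c) T = c"
  by (simp add: avg_def)

text \<open>The shift moves the window to \<open>{\<sigma>..T + \<sigma>}\<close>; non-negativity
  allows adding \<open>{0..\<sigma>}\<close>, and the excess \<open>{T..T + \<sigma>}\<close>
  contributes at most \<open>\<sigma> * M\<close>.\<close>

lemma avg_shift_le: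
  assumes g: "continuous_on UNIV g" and M: "\<And>t. 0 \<le> g t" "\<And>t. g t \<le> M" and "0 \<le> \<sigma>" "0 < T"
  shows "avg (\<lambda>t. g (t + \<sigma>)) T \<le> avg g T + \<sigma> * M / T"
proof -
  have int: "g integrable_on {a..b}" for a b
    by (intro integrable_continuous_real continuous_on_subset[OF g]) auto
  have "integral {0..T} (\<lambda>t. g (t + \<sigma>)) = integral {\<sigma>..T + \<sigma>} g"
    using integral_shift_Icc_real[of 0 T g \<sigma>] by (simp add: o_def add.commute)
  also have "\<dots> \<le> integral {0..T + \<sigma>} g"
    using assms by (intro integral_subset_le int) auto
  also have "\<dots> = integral {0..T} g + integral {T..T + \<sigma>} g"
    using assms by (intro Henstock_Kurzweil_Integration.integral_combine[symmetric] int) auto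
  also have "integral {T..T + \<sigma>} g \<le> integral {T..T + \<sigma>} (\<lambda>_. M)"
    by (intro integral_le int) (auto simp: M)
  finally have "integral {0..T} (\<lambda>t. g (t + \<sigma>)) \<le> integral {0..T} g + \<sigma> * M"
    using \<open>0 \<le> \<sigma>\<close> by (simp add: mult.commute)
  then show ?thesis
    using \<open>0 < T\<close> by (simp add: avg_def divide_right_mono flip: add_divide_distrib)
qed

section \<open>Uniqueness of square-summable solutions up to scalars\<close>

lemma ell2_coord_small: "0 < e \<Longrightarrow> \<exists>F. finite F \<and> (\<forall>m. m \<notin> F \<longrightarrow> cmod (coord x m) < e)"
proof -
  assume "0 < e"
  then have "\<forall>\<^sub>F F in finite_subsets_at_top UNIV. dist (fvec F (coord x)) x < e"
    by (rule tendstoD[OF fvec_tendsto])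
  then obtain F where F: "finite F" "norm (fvec F (coord x) - x) < e"
    unfolding eventually_finite_subsets_at_top dist_norm by auto
  have "cmod (coord x m) < e" if "m \<notin> F" for m
    using norm_coord_le[of "fvec F (coord x) - x" m] F that by simp
  then show ?thesis using F(1) by blast
qed

lemma inner_cscale_self: "x \<bullet> cscale c x = Re c * (norm x)\<^sup>2"
proof -
  have "x \<bullet> cscale c x = infsum (\<lambda>m. Re c * (cmod (coord x m))\<^sup>2) UNIV"
    unfolding inner_ell2_def cmod_power2
    by (rule infsum_cong) (simp add: inner_complex_def algebra_simps power2_eq_square)
  then show ?thesis by (simp add: norm_sq_ell2 infsum_cmult_right')
qed

text \<open>Nonvanishing off-diagonal entries let the three-term recursion be solved in both
  directions.\<close>

lemma jacobi_zero_if_consecutive_zero: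
  assumes a: "\<And>n. a n \<noteq> 0" and z: "\<And>m. jacobi a \<omega> z m = 0" "z k = 0" "z (k + 1) = 0"
  shows "z m = 0"
proof -
  have up: "z (k + int j) = 0 \<and> z (k + int j + 1) = 0" for j
  proof (induction j)
    case (Suc j)
    then have "of_real (a (k + int j + 1)) * z (k + int j + 1 + 1) = 0"
      using z(1)[of "k + int j + 1"] by (simp add: jacobi_def)
    then show ?case using a Suc by (simp add: algebra_simps)
  qed (use z in auto)
  have down: "z (k - int j) = 0 \<and> z (k - int j + 1) = 0" for j
  proof (induction j)
    case (Suc j)
    then have "of_real (a (k - int j - 1)) * z (k - int j - 1) = 0"
      using z(1)[of "k - int j"] by (simp add: jacobi_def)
    then show ?case using a Suc by (simp add: algebra_simps)
  qed (use z in auto)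
  show ?thesis
  proof (cases "k \<le> m")
    case True then show ?thesis using up[of "nat (m - k)"] by simp
  next
    case False then show ?thesis using down[of "nat (k - m)"] by simp
  qed
qed

context jacobi_operator
begin

text \<open>Square-summable solutions have vanishing Wronskian.\<close>

lemma kernel_one_dimensional:
  assumes a: "\<And>n. a n \<noteq> 0" and x: "\<And>m. jacobi a \<omega> (coord x) m = 0"
    and y: "\<And>m. jacobi a \<omega> (coord y) m = 0"
  shows "coord y k * coord x m = coord x k * coord y m"
proof -
  let ?u = "coord x" and ?v = "coord y"
  define W where "W m = of_real (a m) * (?u m * ?v (m + 1) - ?u (m + 1) * ?v m)" for m
  have step: "W m = W (m - 1)" for m
  proof -
    have "?u m * jacobi a \<omega> ?v m - ?v m * jacobi a \<omega> ?u m = 0" by (simp add: x y)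
    then show ?thesis by (simp add: W_def jacobi_def algebra_simps)
  qed
  have "W m = W 0" for m
  proof (induction m rule: int_induct[of _ 0])
    case (step1 i) then show ?case using step[of "i + 1"] by simp
  next
    case (step2 i) then show ?case using step[of i] by simp
  qed simp
  then have const: "W m = W n" for m n by metis
  have "0 \<le> \<alpha>" using a_le[of 0] by linarith
  \<comment> \<open>The constant Wronskian may be evaluated anywhere, in particular at a pair of
    neighbouring sites where both values of \<open>?u\<close> are below \<open>e\<close>.\<close>
  have W0: "cmod (W n) \<le> 2 * \<alpha> * norm y * e" if e0: "0 < e" for e n
  proof -
    obtain F where F: "finite F" "\<And>m. m \<notin> F \<Longrightarrow> cmod (?u m) < e"
      using ell2_coord_small[OF e0] by blast
    have "finite (F \<union> (\<lambda>m. m - 1) ` F)" using F(1) by simp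
    then obtain m :: int where m: "m \<notin> F \<union> (\<lambda>m. m - 1) ` F"
      using ex_new_if_finite[OF infinite_UNIV_int] by blast
    then have "m \<notin> F" "m + 1 \<notin> F" by (auto simp: image_iff algebra_simps)
    then have "cmod (?u m) * cmod (?v (m + 1)) \<le> e * norm y" "cmod (?u (m + 1)) * cmod (?v m) \<le> e * norm y"
      using F(2) e0 by (auto intro!: mult_mono norm_coord_le simp: less_imp_le)
    then have "cmod (?u m * ?v (m + 1) - ?u (m + 1) * ?v m) \<le> e * norm y + e * norm y"
      by (intro order_trans[OF norm_triangle_ineq4] add_mono) (simp_all add: norm_mult)
    then have "cmod (W m) \<le> \<alpha> * (e * norm y + e * norm y)"
      unfolding W_def norm_mult using a_le[of m] \<open>0 \<le> \<alpha>\<close> by (intro mult_mono) auto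
    then show ?thesis using const[of n m] by (simp add: algebra_simps)
  qed
  have "W n = 0" for n
  proof -
    have "((\<lambda>e. 2 * \<alpha> * norm y * e) \<longlongrightarrow> 2 * \<alpha> * norm y * 0) (at_right 0)"
      by (intro tendsto_intros)
    moreover have "\<forall>\<^sub>F e in at_right 0. cmod (W n) \<le> 2 * \<alpha> * norm y * e"
      using W0 by (auto simp: eventually_at_filter)
    ultimately have "cmod (W n) \<le> 2 * \<alpha> * norm y * 0"
      by (rule tendsto_lowerbound) simp
    then show ?thesis by simp
  qed
  then have det: "?u m * ?v (m + 1) = ?u (m + 1) * ?v m" for m using a by (simp add: W_def)
  \<comment> \<open>This combination solves the same equation, vanishes at \<open>k\<close> by
    construction and at \<open>k + 1\<close> by the Wronskian identity.\<close>
  define z where "z m = ?v k * ?u m - ?u k * ?v m" for m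
  have "jacobi a \<omega> z m = ?v k * jacobi a \<omega> ?u m - ?u k * jacobi a \<omega> ?v m" for m
    by (simp add: z_def jacobi_def algebra_simps)
  then have "jacobi a \<omega> z m = 0" for m by (simp add: x y)
  moreover have "z k = 0" "z (k + 1) = 0" using det[of k] by (simp_all add: z_def algebra_simps)
  ultimately have "z m = 0" using jacobi_zero_if_consecutive_zero[of a \<omega> z k m] a by blast
  then show ?thesis by (simp add: z_def)
qed

section \<open>Ergodic means at a shifted energy\<close>

lemma schrod_orbit_inner_deriv_dom:
  assumes "schrod_orbit a \<omega> \<psi>" "w \<in> D"
  shows "((\<lambda>t. w \<bullet> \<psi> t) has_real_derivative cscale \<i> (J w) \<bullet> \<psi> t) (at t)"
  using schrod_orbit_inner_deriv[OF assms(1), of w t UNIV] assms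
  by (simp add: inner_i_jop_eq schrod_orbit_def)

lemma orbit_continuous_inner:
  "schrod_orbit a \<omega> \<psi> \<Longrightarrow> continuous_on UNIV (\<lambda>t. w \<bullet> \<psi> t)"
  by (intro continuous_intros schrod_orbit_continuous)

text \<open>A weak mean ergodic theorem at energy 0. Means of time derivatives tend to 0, so the
  limit is annihilated by \<open>J\<close>; inner products with the kernel are constant in time,
  hence survive averaging. The factor 2 comes from bounding real and imaginary parts
  separately.\<close>

lemma ergodic_mean:
  assumes g: "schrod_orbit a \<omega> g" and \<beta>: "\<And>t m. cmod (coord (g t) m) \<le> \<beta> m"
  shows "\<exists>v. (\<forall>m. cmod (coord v m) \<le> 2 * \<beta> m) \<and> (\<forall>m. jacobi a \<omega> (coord v) m = 0)
    \<and> (\<forall>x\<in>D. J x = 0 \<longrightarrow> x \<bullet> v = x \<bullet> g 0)"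
proof -
  define l where "l T (p::unit) w = avg (\<lambda>t. w \<bullet> g t) T" for T p w
  note cont = orbit_continuous_inner[OF g]
  have ng: "norm (g t) = norm (g 0)" for t by (rule schrod_orbit_norm[OF g])
  have bnd: "\<bar>w \<bullet> g t\<bar> \<le> norm (g 0) * norm w" for w t
    using Cauchy_Schwarz_ineq2[of w "g t"] ng[of t] by (simp add: mult.commute)
  have "\<exists>G v. G \<le> at_top \<and> G \<noteq> bot \<and> (\<forall>p w. ((\<lambda>T. l T p w) \<longlongrightarrow> w \<bullet> v p) G)"
  proof (rule ell2_weak_cluster_functional[OF trivial_limit_at_top_linorder, where C="\<lambda>_. norm (g 0)"])
    show "linear (l T p)" for T p
      by (rule linearI) (simp_all add: l_def inner_add_left avg_add cont avg_cmult)
    show "\<bar>l T p w\<bar> \<le> norm (g 0) * norm w" for T p w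
      unfolding l_def by (rule avg_bound[OF cont bnd])
  qed
  then obtain G v where G: "G \<le> at_top" "G \<noteq> bot"
    and lim: "\<And>w. ((\<lambda>T. avg (\<lambda>t. w \<bullet> g t) T) \<longlongrightarrow> w \<bullet> v ()) G"
    unfolding l_def by blast
  have lim_le: "\<bar>w \<bullet> v ()\<bar> \<le> K" if "\<And>t. \<bar>w \<bullet> g t\<bar> \<le> K" for w K
    using tendsto_upperbound[OF tendsto_rabs[OF lim[of w]] always_eventually G(2), of K]
      avg_bound[OF cont that] by blast
  have "cmod (coord (v ()) m) \<le> 2 * \<beta> m" for m
  proof -
    have "\<bar>Re (coord (v ()) m)\<bar> \<le> \<beta> m"
      using lim_le[of "basis m" "\<beta> m"] order_trans[OF abs_Re_le_cmod \<beta>] by (simp add: inner_basis)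
    moreover have "\<bar>Im (coord (v ()) m)\<bar> \<le> \<beta> m"
      using lim_le[of "cscale \<i> (basis m)" "\<beta> m"] order_trans[OF abs_Im_le_cmod \<beta>]
      by (simp add: inner_basis_i)
    ultimately show ?thesis using cmod_le[of "coord (v ()) m"] by linarith
  qed
  moreover have zero: "cscale \<i> (J w) \<bullet> v () = 0" if "w \<in> D" for w
  proof (rule tendsto_unique[OF G(2) lim])
    show "((\<lambda>T. avg (\<lambda>t. cscale \<i> (J w) \<bullet> g t) T) \<longlongrightarrow> 0) G"
      by (rule filterlim_mono[OF avg_derivative_tendsto_0[OF schrod_orbit_inner_deriv_dom[OF g that] bnd]
            order_refl G(1)])
  qed
  have "jacobi a \<omega> (coord (v ())) m = 0" for m
    using zero[OF jdomain_basis[of m]] zero[OF jdomain_closed(3)[OF jdomain_basis[of m]], of "- \<i>"]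
    by (simp add: inner_jop_basis jop_linear jdomain_basis complex_eq_iff)
  moreover have "x \<bullet> v () = x \<bullet> g 0" if "x \<in> D" "J x = 0" for x
  proof (rule tendsto_unique[OF G(2) lim])
    have "((\<lambda>t. x \<bullet> g t) has_real_derivative 0) (at t)" for t
      using schrod_orbit_inner_deriv_dom[OF g that(1), of t] that(2) by simp
    from DERIV_isconst_all[of "\<lambda>t. x \<bullet> g t"] this have c: "x \<bullet> g t = x \<bullet> g 0" for t by blast
    have "\<forall>\<^sub>F T in at_top. x \<bullet> g 0 = avg (\<lambda>t. x \<bullet> g t) T"
      using eventually_gt_at_top[of 0] by eventually_elim (subst c, simp add: avg_const)
    then have "\<forall>\<^sub>F T in G. x \<bullet> g 0 = avg (\<lambda>t. x \<bullet> g t) T" by (rule filter_leD[OF G(1)])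
    then show "((\<lambda>T. avg (\<lambda>t. x \<bullet> g t) T) \<longlongrightarrow> x \<bullet> g 0) G"
      by (rule Lim_transform_eventually[OF tendsto_const])
  qed
  ultimately show ?thesis by blast
qed

text \<open>The phase moves the energy \<open>e\<close> to 0, where \<open>ergodic_mean\<close>
  applies, without changing moduli.\<close>

lemma schrod_orbit_energy_shift:
  assumes "schrod_orbit a \<omega> \<psi>"
  shows "schrod_orbit a (\<lambda>m. \<omega> m - e) (\<lambda>t. cscale (cis (e * t)) (\<psi> t))"
proof -
  have jac: "jacobi a (\<lambda>m. \<omega> m - e) f = (\<lambda>m. jacobi a \<omega> f m - of_real e * f m)" for f
    by (rule ext) (simp add: jacobi_def algebra_simps)
  have dom: "x \<in> jdomain a (\<lambda>m. \<omega> m - e)" if "x \<in> D" for x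
    using that by (simp add: jdomain_def jac in_l2_diff in_l2_scale)
  have "((\<lambda>t. cscale (cis (e * t)) (\<psi> t)) has_vector_derivative
      cscale (- \<i>) (jop a (\<lambda>m. \<omega> m - e) (cscale (cis (e * t)) (\<psi> t)))) (at t)" for t
  proof -
    have \<psi>: "\<psi> t \<in> D" "(\<psi> has_vector_derivative cscale (- \<i>) (J (\<psi> t))) (at t)"
      using assms by (auto simp: schrod_orbit_def)
    have "((\<lambda>t. cis (e * t)) has_vector_derivative e *\<^sub>R (\<i> * cis (e * t))) (at t)"
      unfolding has_vector_derivative_def by (auto intro!: derivative_eq_intros simp: mult.commute)
    from bounded_bilinear.has_vector_derivative[OF bounded_bilinear_cscale this \<psi>(2)]
    show ?thesis
      by (rule has_vector_derivative_eq_rhs)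
        (rule ell2_eqI, simp add: coord_jop dom jdomain_closed \<psi>(1) jac jacobi_coord scaleR_conv_of_real algebra_simps)
  qed
  then show ?thesis
    using assms by (auto simp: schrod_orbit_def intro!: dom jdomain_closed)
qed

text \<open>The definition admits complex energies; symmetry makes them real.\<close>

lemma eigenvectorE:
  assumes "eigenfunction a \<omega> u"
  obtains x e where "coord x = u" "x \<noteq> 0" "x \<in> D" "J x = (e::real) *\<^sub>R x" "jacobi a \<omega> u = (\<lambda>m. of_real e * u m)"
proof -
  from assms obtain E where u: "in_l2 u" "u \<noteq> (\<lambda>_. 0)" "jacobi a \<omega> u = (\<lambda>m. E * u m)"
    unfolding eigenfunction_def by blast
  define x where "x = Abs_ell2 u"
  have x: "coord x = u" using u(1) by (simp add: x_def)
  have dom: "x \<in> D" using u by (simp add: jdomain_def x in_l2_scale)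
  have Jx: "J x = cscale E x" by (rule ell2_eqI) (simp add: coord_jop[OF dom] x u(3))
  have "x \<noteq> 0" using u(2) x by (metis coord_ell2(1) ext)
  moreover have "Im E * (norm x)\<^sup>2 = 0"
    using inner_i_jop_zero[OF dom] inner_cscale_self[of x "- \<i> * E"]
    by (simp add: Jx inner_cscale)
  ultimately have "E = of_real (Re E)" by (simp add: complex_eq_iff)
  then show ?thesis using that[of x "Re E"] x dom Jx u(3) \<open>x \<noteq> 0\<close> by (metis cscale_simps(9))
qed

lemma eigenfunction_dominated:
  assumes a: "\<And>n. a n \<noteq> 0" and \<beta>: "\<And>n t m. n \<in> {0, 1} \<Longrightarrow> cmod (coord (evol n t) m) \<le> \<beta> m"
    and u: "eigenfunction a \<omega> u"
  shows "\<exists>K. \<forall>m. cmod (u m) \<le> K * \<beta> m"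
proof -
  obtain x e where x: "coord x = u" "x \<noteq> 0" "x \<in> D" "J x = (e::real) *\<^sub>R x"
    "jacobi a \<omega> u = (\<lambda>m. of_real e * u m)"
    by (rule eigenvectorE[OF u])
  interpret sh: jacobi_operator a "\<lambda>m. \<omega> m - e" \<alpha> by standard (rule a_le)
  have jac: "jacobi a (\<lambda>m. \<omega> m - e) f m = jacobi a \<omega> f m - of_real e * f m" for f m
    by (simp add: jacobi_def algebra_simps)
  have ker: "jacobi a (\<lambda>m. \<omega> m - e) (coord x) m = 0" for m by (simp add: jac x(1,5))
  have xd: "x \<in> sh.D" by (simp add: jdomain_def ker[abs_def] in_l2_zero)
  have Jx: "sh.J x = 0" by (rule ell2_eqI) (simp add: coord_jop[OF xd] ker)
  obtain n where n: "n \<in> {0, 1}" "u n \<noteq> 0"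
    using jacobi_zero_if_consecutive_zero[OF a ker, of 0] x(1,2)
    by (metis add_0 coord_ell2(1) ell2_eqI insertCI)
  \<comment> \<open>The real inner product with \<open>basis n\<close> detects only the real part of
    \<open>u n\<close>, so \<open>u\<close> is multiplied by \<open>\<i>\<close> if that part
    vanishes.\<close>
  obtain x' where x': "x' \<in> sh.D" "sh.J x' = 0" "Re (coord x' n) \<noteq> 0"
  proof (cases "Re (u n) = 0")
    case False then show ?thesis using that[of x] xd Jx x(1) by simp
  next
    case True
    then have "Re (coord (cscale \<i> x) n) \<noteq> 0" using n(2) x(1) by (simp add: complex_eq_iff)
    then show ?thesis using that[of "cscale \<i> x"] xd Jx by (simp add: jdomain_closed jop_linear)
  qed
  have "cmod (coord (cscale (cis (e * t)) (evol n t)) m) \<le> \<beta> m" for t m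
    using \<beta>[OF n(1)] by (simp add: norm_mult)
  from sh.ergodic_mean[OF schrod_orbit_energy_shift[OF evol_orbit] this]
  obtain v where v: "\<And>m. cmod (coord v m) \<le> 2 * \<beta> m" "\<And>m. jacobi a (\<lambda>m. \<omega> m - e) (coord v) m = 0"
    "\<And>x. x \<in> sh.D \<Longrightarrow> sh.J x = 0 \<Longrightarrow> x \<bullet> v = x \<bullet> evol n 0"
    by (auto simp: cis_zero)
  have "x' \<bullet> v = Re (coord x' n)"
    using v(3)[OF x'(1,2)] by (simp add: evol_0 inner_commute[of x'] inner_basis)
  then have "v \<noteq> 0" using x'(3) by auto
  then obtain k where k: "coord v k \<noteq> 0" by (metis coord_ell2(1) ell2_eqI)
  have "cmod (u m) \<le> (cmod (u k) / cmod (coord v k) * 2) * \<beta> m" for m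
  proof -
    have "coord v k * u m = u k * coord v m"
      using sh.kernel_one_dimensional[OF a ker v(2), of k m] by (simp add: x(1))
    then have "u m = u k / coord v k * coord v m" using k by (simp add: field_simps)
    then have "cmod (u m) = cmod (u k) / cmod (coord v k) * cmod (coord v m)"
      by (simp add: norm_mult norm_divide)
    also have "\<dots> \<le> cmod (u k) / cmod (coord v k) * (2 * \<beta> m)"
      by (intro mult_left_mono v) auto
    finally show ?thesis by (simp add: mult.assoc)
  qed
  then show ?thesis by blast
qed

end

section \<open>Localized orbits and pure point spectrum\<close>

lemma ell2_eq_basisI:
  assumes "\<And>m. basis m \<bullet> x = basis m \<bullet> y" "\<And>m. cscale \<i> (basis m) \<bullet> x = cscale \<i> (basis m) \<bullet> y"
  shows "x = y"
  by (rule ell2_eqI) (use assms in \<open>simp add: inner_basis inner_basis_i complex_eq_iff\<close>)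

text \<open>Domination by a square-summable \<open>\<beta>\<close> confines the orbit to a compact
  set; the bound on \<open>J\<close> along the orbit lets the time averages map into the
  domain.\<close>

locale localized_orbit = jacobi_operator +
  fixes \<phi> :: "real \<Rightarrow> ell2" and \<beta> :: "int \<Rightarrow> real" and C :: real
  assumes orbit: "schrod_orbit a \<omega> \<phi>" and norm_orbit: "\<And>t. norm (\<phi> t) = 1"
    and dominated: "\<And>t m. cmod (coord (\<phi> t) m) \<le> \<beta> m" and \<beta>_l2: "(\<lambda>m. (\<beta> m)\<^sup>2) summable_on UNIV"
    and norm_jop_orbit: "\<And>t. norm (J (\<phi> t)) \<le> C"
begin

text \<open>With the complex inner product, \<open>corr w x t\<close> is the real part of
  \<open>\<langle>w, \<phi> t\<rangle> \<langle>\<phi> t, x\<rangle>\<close>.\<close>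

definition corr :: "ell2 \<Rightarrow> ell2 \<Rightarrow> real \<Rightarrow> real" where
  "corr w x t = (w \<bullet> \<phi> t) * (x \<bullet> \<phi> t) + (cscale \<i> w \<bullet> \<phi> t) * (cscale \<i> x \<bullet> \<phi> t)"

lemma orbit_dom: "\<phi> t \<in> D"
  using orbit by (simp add: schrod_orbit_def)

lemma abs_inner_orbit_le: "\<bar>x \<bullet> \<phi> t\<bar> \<le> norm x"
  using Cauchy_Schwarz_ineq2[of x "\<phi> t"] by (simp add: norm_orbit)

lemma continuous_corr: "continuous_on UNIV (corr w x)"
  unfolding corr_def by (intro continuous_intros orbit_continuous_inner orbit)

lemma corr_bound:
  assumes "\<bar>w \<bullet> \<phi> t\<bar> \<le> K" "\<bar>cscale \<i> w \<bullet> \<phi> t\<bar> \<le> K"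
  shows "\<bar>corr w x t\<bar> \<le> 2 * K * norm x"
proof -
  have "\<bar>(w \<bullet> \<phi> t) * (x \<bullet> \<phi> t)\<bar> \<le> K * norm x"
    unfolding abs_mult using assms abs_inner_orbit_le by (intro mult_mono) auto
  moreover have "\<bar>(cscale \<i> w \<bullet> \<phi> t) * (cscale \<i> x \<bullet> \<phi> t)\<bar> \<le> K * norm x"
    unfolding abs_mult using assms abs_inner_orbit_le[of "cscale \<i> x"] by (intro mult_mono) auto
  ultimately show ?thesis unfolding corr_def by linarith
qed

lemma corr_le: "\<bar>corr w x t\<bar> \<le> 2 * norm w * norm x"
  using corr_bound[of w t "norm w"] abs_inner_orbit_le[of w] abs_inner_orbit_le[of "cscale \<i> w"] by simp

text \<open>Taking \<open>x\<close> as the parameter of the cluster lemma gives one filter for all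
  \<open>x\<close>, hence an operator \<open>B\<close>.\<close>

lemma corr_cluster:
  "\<exists>G B. G \<le> at_top \<and> G \<noteq> bot \<and> (\<forall>x w. (avg (corr w x) \<longlongrightarrow> w \<bullet> B x) G)"
proof (rule ell2_weak_cluster_functional[OF trivial_limit_at_top_linorder, where C="\<lambda>x. 2 * norm x"])
  show "linear (\<lambda>w. avg (corr w x) T)" for T x
  proof (rule linearI)
    fix w z r
    have "corr (w + z) x = (\<lambda>t. corr w x t + corr z x t)" "corr (r *\<^sub>R w) x = (\<lambda>t. r * corr w x t)"
      by (rule ext; simp add: corr_def inner_add_left cscale_scaleR algebra_simps)+
    then show "avg (corr (w + z) x) T = avg (corr w x) T + avg (corr z x) T"
      "avg (corr (r *\<^sub>R w) x) T = r *\<^sub>R avg (corr w x) T"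
      by (simp_all add: avg_add continuous_corr avg_cmult)
  qed
  show "\<bar>avg (corr w x) T\<bar> \<le> 2 * norm x * norm w" for T x w
    using corr_le[of w x] by (intro avg_bound continuous_corr) (simp add: mult.commute mult.left_commute)
qed

end

text \<open>\<open>B\<close> is a limit point of the time averages of the rank-one projections onto the orbit.\<close>

locale orbit_average = localized_orbit +
  fixes G :: "real filter" and B :: "ell2 \<Rightarrow> ell2"
  assumes G: "G \<le> at_top" "G \<noteq> bot" and B: "\<And>x w. (avg (corr w x) \<longlongrightarrow> w \<bullet> B x) G"
begin

lemma inner_B_bound:
  assumes "\<And>t. \<bar>corr w x t\<bar> \<le> K"
  shows "\<bar>w \<bullet> B x\<bar> \<le> K"
  using tendsto_upperbound[OF tendsto_rabs[OF B] always_eventually G(2)]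
    avg_bound[OF continuous_corr assms] by blast

lemma B_sym: "w \<bullet> B x = B w \<bullet> x"
proof -
  have "corr w x = corr x w" by (rule ext) (simp add: corr_def mult.commute)
  then show ?thesis using tendsto_unique[OF G(2) B[of w x]] B[of x w] by (simp add: inner_commute)
qed

text \<open>Moving \<open>B\<close> across with \<open>B_sym\<close> reduces additivity to that of
  the inner product.\<close>

lemma B_add: "B (x + y) = B x + B y"
  by (rule iffD1[OF vector_eq_ldot]) (simp add: B_sym inner_add_right)

lemma B_scale: "B (r *\<^sub>R x) = r *\<^sub>R B x"
  by (rule iffD1[OF vector_eq_ldot]) (simp add: B_sym)

lemma norm_B: "norm (B x) \<le> 2 * norm x"
proof -
  have "\<bar>B x \<bullet> B x\<bar> \<le> 2 * norm (B x) * norm x" by (rule inner_B_bound[OF corr_le])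
  then have "norm (B x) * norm (B x) \<le> norm (B x) * (2 * norm x)"
    by (simp add: power2_eq_square mult.commute mult.left_commute flip: power2_norm_eq_inner)
  then show ?thesis by (cases "norm (B x) = 0") auto
qed

lemma bounded_linear_B: "bounded_linear B"
  by (rule bounded_linear_intro[where K=2]) (simp_all add: B_add B_scale norm_B mult.commute[of _ 2])

text \<open>Domination by a multiple of \<open>\<beta>\<close> means that \<open>B\<close> maps the
  unit ball into a compact set. One factor 2 comes from the two products in \<open>corr\<close>,
  another from real and imaginary parts.\<close>

lemma coord_B: "cmod (coord (B x) m) \<le> 4 * \<beta> m * norm x"
proof -
  have re: "\<bar>basis m \<bullet> \<phi> t\<bar> \<le> \<beta> m" and im: "\<bar>cscale \<i> (basis m) \<bullet> \<phi> t\<bar> \<le> \<beta> m" for t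
    using dominated[of t m] abs_Re_le_cmod[of "coord (\<phi> t) m"] abs_Im_le_cmod[of "coord (\<phi> t) m"]
    unfolding inner_basis inner_basis_i by linarith+
  have im': "\<bar>cscale \<i> (cscale \<i> (basis m)) \<bullet> \<phi> t\<bar> \<le> \<beta> m" for t
    using re[of t] by simp
  have "\<bar>basis m \<bullet> B x\<bar> \<le> 2 * \<beta> m * norm x" "\<bar>cscale \<i> (basis m) \<bullet> B x\<bar> \<le> 2 * \<beta> m * norm x"
    using re im im' by (intro inner_B_bound corr_bound; blast)+
  then show ?thesis using cmod_le[of "coord (B x) m"] unfolding inner_basis inner_basis_i by linarith
qed

text \<open>The function \<open>corr w (cscale \<i> x)\<close> is bounded and its time derivative is
  the difference of the two correlations, so that difference averages to 0. The \<open>\<i>\<close>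
  compensates the one in the Schroedinger equation.\<close>

lemma B_jop_weak:
  assumes "w \<in> D" "x \<in> D"
  shows "J w \<bullet> B x = w \<bullet> B (J x)"
proof -
  have neg: "J (- v) = - J v" if "v \<in> D" for v using jop_linear(3)[OF that, of "-1"] by simp
  have "(corr w (cscale \<i> x) has_real_derivative corr (J w) x t - corr w (J x) t) (at t)" for t
    unfolding corr_def
    by (rule derivative_eq_intros schrod_orbit_inner_deriv_dom[OF orbit] assms jdomain_closed refl)+
      (simp add: jop_linear neg assms algebra_simps)
  from avg_derivative_tendsto_0[OF this corr_le]
  have "(avg (\<lambda>t. corr (J w) x t - corr w (J x) t) \<longlongrightarrow> 0) G"
    by (rule filterlim_mono[OF _ order_refl G(1)])
  moreover have "avg (\<lambda>t. corr (J w) x t - corr w (J x) t) = (\<lambda>T. avg (corr (J w) x) T - avg (corr w (J x)) T)"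
    by (rule ext) (rule avg_diff[OF continuous_corr continuous_corr])
  ultimately have "((\<lambda>T. avg (corr (J w) x) T - avg (corr w (J x)) T) \<longlongrightarrow> 0) G" by simp
  from tendsto_unique[OF G(2) this tendsto_diff[OF B B]] show ?thesis by simp
qed

text \<open>Inside the correlation \<open>J\<close> can be moved from the test vector to the orbit,
  where it is bounded by \<open>C\<close>; \<open>jdomain_dual\<close> then applies.\<close>

lemma B_dom: "B x \<in> D" and norm_jop_B: "norm (J (B x)) \<le> 2 * C * norm x"
proof -
  have "0 \<le> C" using norm_jop_orbit[of 0] norm_ge_zero order_trans by blast
  have "\<bar>J (fvec F f) \<bullet> B x\<bar> \<le> (2 * C * norm x) * norm (fvec F f)" if "finite F" for F f
  proof -
    let ?z = "fvec F f"
    have z: "?z \<in> D" using that by (rule jdomain_fvec)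
    have *: "\<bar>J w \<bullet> \<phi> t\<bar> \<le> norm w * C" if "w \<in> D" for w t
      unfolding jop_symmetric[OF that orbit_dom]
      by (intro order_trans[OF Cauchy_Schwarz_ineq2] mult_left_mono norm_jop_orbit) auto
    have "\<bar>corr (J ?z) x t\<bar> \<le> 2 * (norm ?z * C) * norm x" for t
    proof (rule corr_bound)
      show "\<bar>J ?z \<bullet> \<phi> t\<bar> \<le> norm ?z * C" by (rule *[OF z])
      show "\<bar>cscale \<i> (J ?z) \<bullet> \<phi> t\<bar> \<le> norm ?z * C"
        using *[OF jdomain_closed(3)[OF z, of \<i>], of t] by (simp add: jop_linear z)
    qed
    from inner_B_bound[OF this] show ?thesis by (simp add: algebra_simps)
  qed
  from jdomain_dual[OF _ this] \<open>0 \<le> C\<close> show "B x \<in> D" "norm (J (B x)) \<le> 2 * C * norm x" by auto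
qed

lemma jop_B_commute:
  assumes "x \<in> D"
  shows "J (B x) = B (J x)"
proof -
  have "w \<bullet> J (B x) = w \<bullet> B (J x)" if "w \<in> D" for w
    using B_jop_weak[OF that assms] jop_symmetric[OF that B_dom] by simp
  then show ?thesis
    by (intro ell2_eq_basisI) (auto intro: jdomain_basis jdomain_closed)
qed

lemma bounded_linear_jop_B: "bounded_linear (\<lambda>x. J (B x))"
  by (rule bounded_linear_intro[where K="2 * C"])
    (simp_all add: B_add B_scale jop_linear B_dom norm_jop_B mult.commute[of _ "2 * C"])

text \<open>Compactness of \<open>B\<close>: weak convergence gives the coordinates by symmetry, and
  domination makes the convergence strong.\<close>

lemma B_weak_to_strong:
  assumes weak: "\<And>w. ((\<lambda>j. w \<bullet> x j) \<longlongrightarrow> w \<bullet> y) F" and bound: "\<And>j. norm (x j) \<le> 1"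
  shows "((\<lambda>j. B (x j)) \<longlongrightarrow> B y) F"
proof (rule ell2_dominated_tendsto)
  show "((\<lambda>j. coord (B (x j)) m) \<longlongrightarrow> coord (B y) m) F" for m
    by (rule weak_tendsto_coord) (simp add: B_sym weak)
  have \<beta>0: "0 \<le> \<beta> m" for m using dominated[of 0 m] norm_ge_zero order_trans by blast
  show "cmod (coord (B (x j)) m) \<le> 4 * \<beta> m" for j m
    using coord_B[of "x j" m] mult_left_mono[OF bound[of j], of "4 * \<beta> m"] \<beta>0[of m] by simp
  show "(\<lambda>m. (4 * \<beta> m)\<^sup>2) summable_on UNIV"
    unfolding power_mult_distrib by (rule summable_on_cmult_right[OF \<beta>_l2])
qed

end

section \<open>The orthogonal complement of the eigenfunctions\<close>

definition eig_perp :: "(int \<Rightarrow> real) \<Rightarrow> (int \<Rightarrow> real) \<Rightarrow> ell2 set" where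
  "eig_perp a \<omega> = {y. \<forall>u. eigenfunction a \<omega> (coord u) \<longrightarrow> u \<bullet> y = 0}"

lemma subspace_eig_perp: "subspace (eig_perp a \<omega>)"
  by (auto simp: subspace_def eig_perp_def inner_add_right)

lemma closed_eig_perp: "closed (eig_perp a \<omega>)"
proof -
  have "eig_perp a \<omega> = (\<Inter>u\<in>{u. eigenfunction a \<omega> (coord u)}. {y. u \<bullet> y = 0})"
    by (auto simp: eig_perp_def)
  moreover have "closed {y. u \<bullet> y = 0}" for u :: ell2
    by (intro closed_Collect_eq continuous_intros)
  ultimately show ?thesis by auto
qed

lemma eigenfunction_coord_iff:
  "eigenfunction a \<omega> (coord x) \<longleftrightarrow> x \<noteq> 0 \<and> x \<in> jdomain a \<omega> \<and> (\<exists>E. jop a \<omega> x = cscale E x)"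
proof -
  have z: "coord x = (\<lambda>_. 0) \<longleftrightarrow> x = 0" by (metis coord_ell2(1) ell2_eqI ext)
  have *: "x \<in> jdomain a \<omega> \<and> jop a \<omega> x = cscale E x \<longleftrightarrow> jacobi a \<omega> (coord x) = (\<lambda>m. E * coord x m)" for E
  proof
    assume *: "x \<in> jdomain a \<omega> \<and> jop a \<omega> x = cscale E x"
    show "jacobi a \<omega> (coord x) = (\<lambda>m. E * coord x m)"
    proof
      fix m
      have "coord (jop a \<omega> x) m = coord (cscale E x) m" using * by simp
      then show "jacobi a \<omega> (coord x) m = E * coord x m" using * coord_jop[of x a \<omega> m] by simp
    qed
  next
    assume *: "jacobi a \<omega> (coord x) = (\<lambda>m. E * coord x m)"
    then have "x \<in> jdomain a \<omega>" by (simp add: jdomain_def in_l2_scale)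
    then show "x \<in> jdomain a \<omega> \<and> jop a \<omega> x = cscale E x"
      using * by (auto intro!: ell2_eqI simp: coord_jop)
  qed
  show ?thesis unfolding eigenfunction_def using z * in_l2_coord by metis
qed

lemma eig_perp_inner:
  assumes "y \<in> eig_perp a \<omega>" "u \<in> jdomain a \<omega>" "jop a \<omega> u = cscale E u"
  shows "u \<bullet> y = 0"
  using assms by (cases "u = 0") (auto simp: eig_perp_def eigenfunction_coord_iff)

text \<open>Nonzero complex multiples of eigenfunctions are eigenfunctions, so orthogonality to all
  of them for the real inner product is orthogonality for the complex one.\<close>

lemma eig_perp_cscale:
  assumes "y \<in> eig_perp a \<omega>"
  shows "cscale c y \<in> eig_perp a \<omega>"
proof -
  have "u \<bullet> cscale c y = 0" if "u \<in> jdomain a \<omega>" "jop a \<omega> u = cscale E u" for u E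
  proof -
    have "cscale (cnj c) u \<bullet> y = 0"
      using that by (intro eig_perp_inner[OF assms, of _ E]) (simp_all add: jdomain_closed jop_linear mult.commute)
    then show ?thesis by (simp add: inner_cscale)
  qed
  then show ?thesis by (auto simp: eig_perp_def eigenfunction_coord_iff)
qed

context orbit_average
begin

lemma B_eig_perp:
  assumes "y \<in> eig_perp a \<omega>"
  shows "B y \<in> eig_perp a \<omega>"
proof -
  have "u \<bullet> B y = 0" if u: "u \<in> D" "J u = cscale E u" for u E
  proof -
    \<comment> \<open>\<open>B\<close> was built from real functionals, so its complex linearity
      must be checked before it can preserve eigenspaces, whose \<open>E\<close> is a complex number
      here.\<close>
    have "B (cscale E u) = cscale E (B u)"
    proof -
      have ci: "B (cscale \<i> v) = cscale \<i> (B v)" for v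
      proof -
        have "w \<bullet> B (cscale \<i> v) = w \<bullet> cscale \<i> (B v)" for w
        proof -
          have "corr w (cscale \<i> v) = corr (cscale (- \<i>) w) v"
            by (rule ext) (simp add: corr_def cscale_neg_i algebra_simps)
          then have "w \<bullet> B (cscale \<i> v) = cscale (- \<i>) w \<bullet> B v"
            using tendsto_unique[OF G(2) B[of w "cscale \<i> v"]] B[of "cscale (- \<i>) w" v] by simp
          then show ?thesis by (simp add: inner_cscale)
        qed
        then show ?thesis using vector_eq_ldot by blast
      qed
      have split: "cscale E v = Re E *\<^sub>R v + Im E *\<^sub>R cscale \<i> v" for v
        by (rule ell2_eqI) (simp add: complex_eq_iff)
      show ?thesis by (simp add: split B_add B_scale ci)
    qed
    then have "J (B u) = cscale E (B u)" using jop_B_commute[OF u(1)] u(2) by simp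
    from eig_perp_inner[OF assms B_dom this] show ?thesis using B_sym by simp
  qed
  then show ?thesis by (auto simp: eig_perp_def eigenfunction_coord_iff)
qed

lemma jop_eig_perp:
  assumes "y \<in> eig_perp a \<omega>" "y \<in> D"
  shows "J y \<in> eig_perp a \<omega>"
proof -
  have "u \<bullet> J y = 0" if u: "u \<in> D" "J u = cscale E u" for u E
  proof -
    have "cscale E u \<bullet> y = 0"
      using u by (intro eig_perp_inner[OF assms(1), of _ E]) (simp_all add: jdomain_closed jop_linear)
    then show ?thesis using jop_symmetric[OF u(1) assms(2)] u(2) by simp
  qed
  then show ?thesis by (auto simp: eig_perp_def eigenfunction_coord_iff)
qed

text \<open>A positive value would give a top eigenspace of the compact operator \<open>B\<close> inside the
  orthogonal complement of the eigenfunctions; this eigenspace is invariant under \<open>J\<close> and has a compact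
  unit sphere, so it contains an eigenvector of \<open>J\<close>.\<close>

lemma B_nonpos_on_eig_perp:
  assumes y: "y \<in> eig_perp a \<omega>"
  shows "y \<bullet> B y \<le> 0"
proof (rule ccontr)
  assume "\<not> y \<bullet> B y \<le> 0"
  then have pos: "0 < y \<bullet> B y" by simp
  then have "y \<noteq> 0" by auto
  let ?H = "eig_perp a \<omega>"
  note sub = subspace_eig_perp[of a \<omega>]
  \<comment> \<open>The supremum is taken over the ball, not the sphere, because the ball survives
    weak limits.\<close>
  define Q where "Q = (\<lambda>x. x \<bullet> B x) ` {x \<in> ?H. norm x \<le> 1}"
  define \<mu> where "\<mu> = Sup Q"
  have bdd: "bdd_above Q"
  proof -
    have "x \<bullet> B x \<le> 2" if "norm x \<le> 1" for x
    proof -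
      have "x \<bullet> B x \<le> norm x * norm (B x)" by (rule norm_cauchy_schwarz)
      also have "\<dots> \<le> 1 * 2" using that norm_B[of x] by (intro mult_mono) auto
      finally show ?thesis by simp
    qed
    then show ?thesis by (auto simp: Q_def intro!: bdd_aboveI)
  qed
  have normalize: "(inverse (norm x) *\<^sub>R x) \<bullet> B (inverse (norm x) *\<^sub>R x) = (x \<bullet> B x) / (x \<bullet> x)" if "x \<noteq> 0" for x
    using that by (simp add: B_scale field_simps power2_eq_square flip: power2_norm_eq_inner)
  have le\<mu>: "x \<bullet> B x \<le> \<mu> * (x \<bullet> x)" if x: "x \<in> ?H" for x
  proof (cases "x = 0")
    case False
    have "inverse (norm x) *\<^sub>R x \<in> {x \<in> ?H. norm x \<le> 1}"
      using x False by (simp add: subspace_scale[OF sub])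
    then have "(inverse (norm x) *\<^sub>R x) \<bullet> B (inverse (norm x) *\<^sub>R x) \<le> \<mu>"
      unfolding \<mu>_def Q_def by (intro cSup_upper bdd[unfolded Q_def] imageI)
    then show ?thesis using False by (simp only: normalize[OF False]) (simp add: pos_divide_le_eq)
  qed simp
  have "0 < \<mu>"
    using le\<mu>[OF y] pos by (smt (verit) inner_ge_zero mult_nonpos_nonneg)
  have "\<exists>x. x \<in> ?H \<and> norm x \<le> 1 \<and> \<mu> - 1 / real (Suc j) < x \<bullet> B x" for j
  proof -
    have "Q \<noteq> {}" using subspace_0[OF sub] by (force simp: Q_def)
    then have "\<exists>q\<in>Q. \<mu> - 1 / real (Suc j) < q"
      using bdd unfolding \<mu>_def by (intro less_cSupD) auto
    then show ?thesis by (auto simp: Q_def)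
  qed
  then obtain x where x: "\<And>j. x j \<in> ?H" "\<And>j. norm (x j) \<le> 1" "\<And>j. \<mu> - 1 / real (Suc j) < x j \<bullet> B (x j)"
    by metis
  obtain F z where F: "F \<le> sequentially" "F \<noteq> bot" and weak: "\<And>w. ((\<lambda>j. w \<bullet> x j) \<longlongrightarrow> w \<bullet> z) F"
    and z1: "norm z \<le> 1"
    using ell2_weak_cluster[OF sequentially_bot, of x, OF x(2)] by blast
  have zH: "z \<in> ?H"
    unfolding eig_perp_def
  proof (intro CollectI allI impI)
    fix u assume "eigenfunction a \<omega> (coord u)"
    then have "u \<bullet> x j = 0" for j using x(1)[of j] by (simp add: eig_perp_def)
    then have "((\<lambda>j. u \<bullet> x j) \<longlongrightarrow> 0) F" by simp
    then show "u \<bullet> z = 0" using tendsto_unique[OF F(2) weak[of u]] by blast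
  qed
  \<comment> \<open>Compactness of \<open>B\<close> makes its quadratic form converge along the
    weakly convergent maximizing sequence, so the supremum is attained at \<open>z\<close>.\<close>
  have "((\<lambda>j. B z \<bullet> x j + x j \<bullet> (B (x j) - B z)) \<longlongrightarrow> B z \<bullet> z + 0) F"
  proof (rule tendsto_add[OF weak Lim_null_comparison])
    show "((\<lambda>j. norm (B (x j) - B z)) \<longlongrightarrow> 0) F"
      using B_weak_to_strong[OF weak x(2)] by (simp add: tendsto_norm_zero_iff LIM_zero_iff)
    show "\<forall>\<^sub>F j in F. norm (x j \<bullet> (B (x j) - B z)) \<le> norm (B (x j) - B z)"
    proof (intro always_eventually allI)
      fix j
      have "\<bar>x j \<bullet> (B (x j) - B z)\<bar> \<le> norm (x j) * norm (B (x j) - B z)" by (rule Cauchy_Schwarz_ineq2)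
      also have "\<dots> \<le> 1 * norm (B (x j) - B z)" by (intro mult_right_mono x(2)) simp
      finally show "norm (x j \<bullet> (B (x j) - B z)) \<le> norm (B (x j) - B z)" by simp
    qed
  qed
  then have "((\<lambda>j. x j \<bullet> B (x j)) \<longlongrightarrow> z \<bullet> B z) F"
    by (simp add: inner_diff_right inner_commute)
  moreover have "((\<lambda>j. \<mu> - 1 / real (Suc j)) \<longlongrightarrow> \<mu> - 0) F"
    using filterlim_mono[OF LIMSEQ_inverse_real_of_nat order_refl F(1)]
    by (intro tendsto_intros) (simp add: inverse_eq_divide)
  ultimately have "\<mu> - 0 \<le> z \<bullet> B z"
    using x(3) by (intro tendsto_le[OF F(2)]) (auto intro!: always_eventually less_imp_le)
  moreover have "\<mu> * (z \<bullet> z) \<le> \<mu>"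
    using z1 \<open>0 < \<mu>\<close> power_le_one[of "norm z" 2] by (simp add: mult_le_cancel_left1 flip: power2_norm_eq_inner)
  ultimately have z\<mu>: "z \<bullet> B z = \<mu> * (z \<bullet> z)" "0 < z \<bullet> B z" using le\<mu>[OF zH] \<open>0 < \<mu>\<close> by linarith+
  have Bz: "B z = \<mu> *\<^sub>R z"
  proof (rule maximizer_is_eigenvector[OF sub])
    show "B (v + s *\<^sub>R w) = B v + s *\<^sub>R B w" for v w s by (simp add: B_add B_scale)
  qed (use B_eig_perp B_sym le\<mu> zH z\<mu> in auto)
  have "z \<noteq> 0" using z\<mu>(2) by auto
  define V where "V = {x \<in> ?H. B x = \<mu> *\<^sub>R x}"
  have subV: "subspace V"
  proof -
    have "B 0 = 0" using B_scale[of 0 0] by simp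
    then show ?thesis
      using sub unfolding V_def subspace_def by (auto simp: B_add B_scale scaleR_add_right)
  qed
  \<comment> \<open>Since \<open>\<mu> > 0\<close>, vectors of \<open>V\<close> are images under
    \<open>B\<close>: they lie in the domain, and \<open>J\<close> is bounded on
    \<open>V\<close>.\<close>
  have Vx: "x = inverse \<mu> *\<^sub>R B x" if "x \<in> V" for x using that \<open>0 < \<mu>\<close> by (simp add: V_def)
  have VD: "x \<in> D" if "x \<in> V" for x
    using jdomain_closed(4)[OF B_dom[of x], of "inverse \<mu>"] Vx[OF that] by simp
  have JV: "J x = inverse \<mu> *\<^sub>R J (B x)" if "x \<in> V" for x
    using jop_linear(4)[OF B_dom[of x], of "inverse \<mu>"] Vx[OF that] by simp
  have VJ: "J x \<in> V" if "x \<in> V" for x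
  proof -
    have "B (J x) = J (\<mu> *\<^sub>R x)" using jop_B_commute[OF VD[OF that]] that by (simp add: V_def)
    then show ?thesis using that VD[OF that] jop_eig_perp by (simp add: V_def jop_linear)
  qed
  \<comment> \<open>The unit sphere of \<open>V\<close> is closed and dominated by
    \<open>(4 / \<mu>) * \<beta> m\<close>, thus compact; the form of \<open>J\<close> attains its
    maximum there, and the maximizer is an eigenvector.\<close>
  define S where "S = {x \<in> V. norm x = 1}"
  have "compact S"
  proof (rule compact_Int_closed[of "{x. \<forall>m. cmod (coord x m) \<le> (4 / \<mu>) * \<beta> m}" S, THEN back_subst[of compact]])
    show "compact {x. \<forall>m. cmod (coord x m) \<le> (4 / \<mu>) * \<beta> m}"
      by (rule compact_coord_dominated, unfold power_mult_distrib) (rule summable_on_cmult_right[OF \<beta>_l2])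
    have "S = ?H \<inter> {x. B x = \<mu> *\<^sub>R x} \<inter> {x. norm x = 1}" by (auto simp: S_def V_def)
    then show "closed S"
      by (auto intro!: closed_Int closed_eig_perp closed_Collect_eq continuous_intros
          bounded_linear.continuous_on[OF bounded_linear_B])
    show "{x. \<forall>m. cmod (coord x m) \<le> (4 / \<mu>) * \<beta> m} \<inter> S = S"
    proof -
      have "cmod (coord x m) \<le> (4 / \<mu>) * \<beta> m" if "x \<in> S" for x m
      proof -
        have "coord x m = of_real (inverse \<mu>) * coord (B x) m"
          using Vx[of x] that by (metis (no_types, lifting) S_def coord_ell2(5) mem_Collect_eq)
        then have "cmod (coord x m) = inverse \<mu> * cmod (coord (B x) m)"
          using \<open>0 < \<mu>\<close> by (simp add: norm_mult norm_inverse)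
        also have "\<dots> \<le> inverse \<mu> * (4 * \<beta> m)"
          using coord_B[of x m] that \<open>0 < \<mu>\<close> by (intro mult_left_mono) (auto simp: S_def)
        finally show ?thesis by (simp add: field_simps)
      qed
      then show ?thesis by blast
    qed
  qed
  moreover have "inverse (norm z) *\<^sub>R z \<in> S"
    using \<open>z \<noteq> 0\<close> zH Bz subV by (simp add: S_def V_def subspace_scale[OF sub] B_scale)
  then have "S \<noteq> {}" by blast
  moreover have "continuous_on S (\<lambda>x. x \<bullet> J (B x))"
    by (intro continuous_intros bounded_linear.continuous_on[OF bounded_linear_jop_B])
  ultimately have "\<exists>x\<in>S. \<forall>w\<in>S. w \<bullet> J (B w) \<le> x \<bullet> J (B x)" by (rule continuous_attains_sup)
  then obtain x1 where x1: "x1 \<in> S" "\<And>w. w \<in> S \<Longrightarrow> w \<bullet> J (B w) \<le> x1 \<bullet> J (B x1)"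
    by blast
  define \<nu> where "\<nu> = inverse \<mu> * (x1 \<bullet> J (B x1))"
  have qle: "w \<bullet> J w \<le> \<nu> * (w \<bullet> w)" if w: "w \<in> V" for w
  proof (cases "w = 0")
    case False
    let ?w = "inverse (norm w) *\<^sub>R w"
    have "?w \<in> S" using w False subspace_scale[OF subV] by (simp add: S_def)
    from x1(2)[OF this] \<open>0 < \<mu>\<close> have "inverse \<mu> * (?w \<bullet> J (B ?w)) \<le> \<nu>"
      unfolding \<nu>_def by (intro mult_left_mono) auto
    moreover have "inverse \<mu> * (?w \<bullet> J (B ?w)) = ?w \<bullet> J ?w"
      using JV[OF subspace_scale[OF subV w]] by simp
    moreover have "?w \<bullet> J ?w = (w \<bullet> J w) / (w \<bullet> w)"
      using False by (simp add: jop_linear VD[OF w] field_simps power2_eq_square flip: power2_norm_eq_inner)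
    ultimately have "(w \<bullet> J w) / (w \<bullet> w) \<le> \<nu>" by linarith
    then show ?thesis using False by (simp add: pos_divide_le_eq)
  qed simp
  have x1V: "x1 \<in> V" "norm x1 = 1" using x1(1) by (auto simp: S_def)
  have "J x1 = \<nu> *\<^sub>R x1"
  proof (rule maximizer_is_eigenvector[OF subV VJ _ _ qle x1V(1)])
    show "J (v + s *\<^sub>R w) = J v + s *\<^sub>R J w" if "v \<in> V" "w \<in> V" for v w s
      using VD that by (simp add: jop_linear jdomain_closed)
    show "v \<bullet> J w = J v \<bullet> w" if "v \<in> V" "w \<in> V" for v w
      using VD that by (simp add: jop_symmetric)
    show "x1 \<bullet> J x1 = \<nu> * (x1 \<bullet> x1)"
      using JV[OF x1V(1)] x1V(2) by (simp add: \<nu>_def flip: power2_norm_eq_inner)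
  qed
  then have "J x1 = cscale (of_real \<nu>) x1" by simp
  moreover have "x1 \<in> ?H" using x1V(1) by (simp add: V_def)
  ultimately have "x1 \<bullet> x1 = 0" using eig_perp_inner[OF _ VD[OF x1V(1)]] by blast
  then show False using x1V(2) by simp
qed

text \<open>By precompactness of the orbit, an almost periodic function with vanishing quadratic mean
  vanishes.\<close>

lemma eig_perp_orthogonal_orbit:
  assumes y: "y \<in> eig_perp a \<omega>"
  shows "y \<bullet> \<phi> s = 0"
proof (rule ccontr)
  assume ne: "y \<bullet> \<phi> s \<noteq> 0"
  \<comment> \<open>Half of the value at \<open>s\<close>: an orbit point within \<open>e\<close> of
    \<open>\<phi> s\<close> changes the inner product by at most \<open>norm y * e = c\<close>,
    which leaves at least \<open>c\<close>.\<close>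
  define c where "c = \<bar>y \<bullet> \<phi> s\<bar> / 2"
  define g where "g t = (y \<bullet> \<phi> t)\<^sup>2" for t
  have "0 < c" using ne by (simp add: c_def)
  have "y \<noteq> 0" using ne by auto
  define e where "e = c / norm y"
  have "0 < e" using \<open>0 < c\<close> \<open>y \<noteq> 0\<close> by (simp add: e_def)
  have comp: "compact (closure (range \<phi>))"
  proof -
    let ?S = "{x. \<forall>m. cmod (coord x m) \<le> \<beta> m}"
    have S: "compact ?S" by (rule compact_coord_dominated[OF \<beta>_l2])
    have "closure (range \<phi>) \<subseteq> ?S"
      by (rule closure_minimal) (use dominated compact_imp_closed[OF S] in auto)
    then show ?thesis using compact_Int_closed[OF S closed_closure, of "range \<phi>"] by (simp add: Int_absorb1)
  qed
  have "closure (range \<phi>) \<subseteq> (\<Union>t\<in>UNIV. ball (\<phi> t) e)"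
    using \<open>0 < e\<close> by (auto simp: closure_approachable dist_commute)
  then obtain F where F: "finite F" "closure (range \<phi>) \<subseteq> (\<Union>t\<in>F. ball (\<phi> t) e)"
    by (rule compactE_image[OF comp open_ball])
  \<comment> \<open>\<open>R\<close> is so large that all shifts \<open>R + s - \<tau>\<close> are
    non-negative, as \<open>avg_shift_le\<close> requires.\<close>
  define R where "R = (\<Sum>\<tau>\<in>F. \<bar>\<tau>\<bar>) + \<bar>s\<bar>"
  have R: "0 \<le> R + s - \<tau>" if "\<tau> \<in> F" for \<tau>
    using member_le_sum[OF that, of abs] F(1) by (simp add: R_def)
  \<comment> \<open>Some net point \<open>\<phi> \<tau>\<close> is close to
    \<open>\<phi> (t + R)\<close>; evolving both by the time \<open>s - \<tau>\<close> keeps their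
    distance and brings the first to \<open>\<phi> s\<close>.\<close>
  have near: "\<exists>\<tau>\<in>F. c\<^sup>2 \<le> g (t + (R + s - \<tau>))" for t
  proof -
    have "\<phi> (t + R) \<in> closure (range \<phi>)" by (rule subsetD[OF closure_subset rangeI])
    then obtain \<tau> where \<tau>: "\<tau> \<in> F" "norm (\<phi> \<tau> - \<phi> (t + R)) < e"
      using F(2) by (auto simp: dist_norm)
    have "norm (\<phi> (\<tau> + (s - \<tau>)) - \<phi> (t + R + (s - \<tau>))) = norm (\<phi> (\<tau> + 0) - \<phi> (t + R + 0))"
      by (rule schrod_orbit_norm[OF schrod_orbit_diff[OF schrod_orbit_shift[OF orbit] schrod_orbit_shift[OF orbit]]])
    then have d: "norm (\<phi> s - \<phi> (t + (R + s - \<tau>))) < e" using \<tau>(2) by (simp add: algebra_simps)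
    have "\<bar>y \<bullet> (\<phi> s - \<phi> (t + (R + s - \<tau>)))\<bar> \<le> norm y * norm (\<phi> s - \<phi> (t + (R + s - \<tau>)))"
      by (rule Cauchy_Schwarz_ineq2)
    also have "\<dots> \<le> norm y * e" using d by (intro mult_left_mono) auto
    also have "\<dots> = c" using \<open>y \<noteq> 0\<close> by (simp add: e_def)
    finally have "c \<le> \<bar>y \<bullet> \<phi> (t + (R + s - \<tau>))\<bar>"
      unfolding c_def inner_diff_right by linarith
    then have "c\<^sup>2 \<le> g (t + (R + s - \<tau>))"
      unfolding g_def using \<open>0 < c\<close> by (metis less_imp_le power2_abs power_mono)
    then show ?thesis using \<tau>(1) by blast
  qed
  have gc: "continuous_on UNIV g"
    unfolding g_def by (intro continuous_intros orbit_continuous_inner orbit)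
  have gs: "continuous_on UNIV (\<lambda>t. g (t + k))" for k
    by (rule continuous_on_compose2[OF gc]) (auto intro: continuous_intros)
  have g0: "0 \<le> g t" for t by (simp add: g_def)
  have gM: "g t \<le> (norm y)\<^sup>2" for t
    unfolding g_def using power_mono[OF abs_inner_orbit_le[of y t], of 2] by simp
  let ?K = "\<Sum>\<tau>\<in>F. (R + s - \<tau>) * (norm y)\<^sup>2"
  \<comment> \<open>At every time one of finitely many shifted copies of \<open>g\<close> is at
    least \<open>c\<^sup>2\<close>, so their averages sum to at least \<open>c\<^sup>2\<close>; each
    shift costs a multiple of \<open>1 / T\<close>.\<close>
  have low: "c\<^sup>2 \<le> real (card F) * avg g T + ?K / T" if "0 < T" for T
  proof -
    have avg_sum: "avg (\<lambda>t. \<Sum>\<tau>\<in>F'. g (t + (R + s - \<tau>))) T = (\<Sum>\<tau>\<in>F'. avg (\<lambda>t. g (t + (R + s - \<tau>))) T)"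
      if "finite F'" for F'
      using that by (induction F') (simp_all add: avg_add gs continuous_on_sum avg_def[of "\<lambda>_. 0"])
    have "c\<^sup>2 \<le> (\<Sum>\<tau>\<in>F. g (t + (R + s - \<tau>)))" for t
    proof -
      obtain \<tau> where "\<tau> \<in> F" "c\<^sup>2 \<le> g (t + (R + s - \<tau>))" using near by blast
      then show ?thesis using member_le_sum[of \<tau> F "\<lambda>\<tau>. g (t + (R + s - \<tau>))"] g0 F(1) by force
    qed
    then have "avg (\<lambda>_. c\<^sup>2) T \<le> avg (\<lambda>t. \<Sum>\<tau>\<in>F. g (t + (R + s - \<tau>))) T"
      by (intro avg_mono continuous_on_sum gs continuous_on_const)
    then have "c\<^sup>2 \<le> (\<Sum>\<tau>\<in>F. avg (\<lambda>t. g (t + (R + s - \<tau>))) T)"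
      using that by (simp add: avg_const avg_sum F(1))
    also have "\<dots> \<le> (\<Sum>\<tau>\<in>F. avg g T + (R + s - \<tau>) * (norm y)\<^sup>2 / T)"
      by (intro sum_mono avg_shift_le gc g0 gM R that)
    also have "\<dots> = real (card F) * avg g T + ?K / T"
      by (simp add: sum.distrib sum_divide_distrib)
    finally show ?thesis .
  qed
  have "\<forall>\<^sub>F T in G. c\<^sup>2 \<le> real (card F) * avg (corr y y) T + ?K / T"
  proof (rule filter_leD[OF G(1)])
    show "\<forall>\<^sub>F T in at_top. c\<^sup>2 \<le> real (card F) * avg (corr y y) T + ?K / T"
      using eventually_gt_at_top[of 0]
    proof eventually_elim
      case (elim T)
      have "avg g T \<le> avg (corr y y) T"
        by (intro avg_mono gc continuous_corr) (simp add: g_def corr_def power2_eq_square)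
      from mult_left_mono[OF this, of "real (card F)"] low[OF elim] show ?case by linarith
    qed
  qed
  moreover have "((\<lambda>T. real (card F) * avg (corr y y) T + ?K / T) \<longlongrightarrow> real (card F) * (y \<bullet> B y) + 0) G"
  proof (intro tendsto_intros B)
    show "((\<lambda>T. ?K / T) \<longlongrightarrow> 0) G"
      by (rule filterlim_mono[OF _ order_refl G(1)])
        (rule real_tendsto_divide_at_top[OF tendsto_const filterlim_ident])
  qed
  ultimately have "c\<^sup>2 \<le> real (card F) * (y \<bullet> B y) + 0"
    using tendsto_lowerbound[OF _ _ G(2)] by blast
  also have "\<dots> \<le> 0" using B_nonpos_on_eig_perp[OF y] by (simp add: mult_nonneg_nonpos)
  finally show False using \<open>0 < c\<close> by simp
qed

end

section \<open>Completeness of the eigenfunctions\<close>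

context jacobi_operator
begin

lemma eig_perp_orthogonal_evol:
  assumes \<beta>: "\<And>t m. cmod (coord (evol n t) m) \<le> \<beta> m" and \<beta>_l2: "(\<lambda>m. (\<beta> m)\<^sup>2) summable_on UNIV"
    and y: "y \<in> eig_perp a \<omega>"
  shows "y \<bullet> evol n t = 0"
proof -
  interpret localized_orbit a \<omega> \<alpha> "evol n" \<beta> "\<bar>a n\<bar> + \<bar>a (n - 1)\<bar> + \<bar>\<omega> n\<bar>"
  proof
    show "norm (J (evol n t)) \<le> \<bar>a n\<bar> + \<bar>a (n - 1)\<bar> + \<bar>\<omega> n\<bar>" for t
      unfolding evol_step by (intro norm_triangle_mono) (simp_all add: norm_evol)
  qed (use evol_orbit norm_evol \<beta> \<beta>_l2 in auto)
  obtain G B where "G \<le> at_top" "G \<noteq> bot" "\<forall>x w. (avg (corr w x) \<longlongrightarrow> w \<bullet> B x) G"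
    using corr_cluster by blast
  then interpret orbit_average a \<omega> \<alpha> "evol n" \<beta> "\<bar>a n\<bar> + \<bar>a (n - 1)\<bar> + \<bar>\<omega> n\<bar>" G B
    by unfold_locales auto
  show ?thesis by (rule eig_perp_orthogonal_orbit[OF y])
qed

lemma pure_point_if_localized:
  assumes a: "\<And>n. a n \<noteq> 0" and \<beta>: "\<And>n t m. n \<in> {0, 1} \<Longrightarrow> cmod (coord (evol n t) m) \<le> \<beta> m"
    and \<beta>_l2: "(\<lambda>m. (\<beta> m)\<^sup>2) summable_on UNIV"
  shows "pure_point a \<omega>"
proof -
  \<comment> \<open>Differentiating an identically vanishing inner product brings in
    \<open>J\<close>; the test vector \<open>cscale (- \<i>) y\<close> absorbs the factor from the
    Schroedinger equation.\<close>
  have jstep: "\<forall>y\<in>eig_perp a \<omega>. \<forall>t. y \<bullet> J (evol n t) = 0"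
    if "\<forall>y\<in>eig_perp a \<omega>. \<forall>t. y \<bullet> evol n t = 0" for n
  proof (intro ballI allI)
    fix y t assume y: "y \<in> eig_perp a \<omega>"
    have "((\<lambda>t. cscale (- \<i>) y \<bullet> evol n t) has_real_derivative cscale \<i> (cscale (- \<i>) y) \<bullet> J (evol n t)) (at t)"
      by (rule schrod_orbit_inner_deriv[OF evol_orbit])
    moreover have "(\<lambda>t. cscale (- \<i>) y \<bullet> evol n t) = (\<lambda>_. 0)"
      using that eig_perp_cscale[OF y] by blast
    ultimately show "y \<bullet> J (evol n t) = 0"
      using DERIV_unique[OF _ DERIV_const] by fastforce
  qed
  have base: "\<forall>y\<in>eig_perp a \<omega>. \<forall>t. y \<bullet> evol n t = 0" if "n \<in> {0, 1}" for n
    using eig_perp_orthogonal_evol[OF \<beta>[OF that] \<beta>_l2] by blast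
  let ?P = "\<lambda>n. \<forall>y\<in>eig_perp a \<omega>. \<forall>t. y \<bullet> evol n t = 0"
  \<comment> \<open>With \<open>J\<close> rewritten by \<open>evol_step\<close>, vanishing at
    \<open>n\<close> leaves a relation between the two neighbours, solvable for either since
    \<open>a\<close> never vanishes.\<close>
  have rec: "a n * (y \<bullet> evol (n + 1) t) + a (n - 1) * (y \<bullet> evol (n - 1) t) = 0"
    if "?P n" "y \<in> eig_perp a \<omega>" for n y t
    using jstep[OF that(1)] that by (simp add: evol_step inner_add_right)
  have up: "?P (int j) \<and> ?P (int j + 1)" for j
  proof (induction j)
    case (Suc j)
    have "y \<bullet> evol (int j + 1 + 1) t = 0" if "y \<in> eig_perp a \<omega>" for y t
      using rec[of "int j + 1" y t] Suc that a[of "int j + 1"] by simp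
    then show ?case using Suc by (simp add: algebra_simps)
  qed (use base in auto)
  have down: "?P (- int j) \<and> ?P (- int j + 1)" for j
  proof (induction j)
    case (Suc j)
    have "?P (- int j - 1)"
    proof (intro ballI allI)
      fix y t assume "y \<in> eig_perp a \<omega>"
      then show "y \<bullet> evol (- int j - 1) t = 0"
        using rec[of "- int j" y t] Suc a[of "- int j - 1"] by simp
    qed
    moreover have "- int (Suc j) = - int j - 1" by simp
    ultimately show ?case using Suc by (simp only: diff_add_cancel, blast)
  qed (use base in auto)
  have all: "?P n" for n
    using up[of "nat n"] down[of "nat (- n)"] by (cases "0 \<le> n") auto
  have perp: "y = 0" if y: "y \<in> eig_perp a \<omega>" for y
  proof (rule ell2_eq_basisI)
    fix m
    have "y \<bullet> basis m = 0" using all[of m] y evol_0[of m] by metis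
    then show "basis m \<bullet> y = basis m \<bullet> 0" by (simp add: inner_commute)
    have "cscale (- \<i>) y \<bullet> basis m = 0"
      using all[of m] eig_perp_cscale[OF y] evol_0[of m] by metis
    then show "cscale \<i> (basis m) \<bullet> y = cscale \<i> (basis m) \<bullet> 0"
      by (subst inner_cscale) (simp add: inner_commute)
  qed
  \<comment> \<open>The real span suffices, since real orthogonality to all eigenfunctions already
    forces \<open>y = 0\<close>.\<close>
  let ?E = "{u. eigenfunction a \<omega> (coord u)}"
  have orth: "y = 0" if "\<And>w. w \<in> span ?E \<Longrightarrow> w \<bullet> y = 0" for y
    using that by (intro perp) (auto simp: eig_perp_def span_base)
  show ?thesis
    unfolding pure_point_def
  proof (intro allI impI)
    fix f and \<epsilon> :: real assume f: "in_l2 f" and "0 < \<epsilon>"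
    from subspace_dense_if_orthogonal_zero[OF subspace_span orth \<open>0 < \<epsilon>\<close>]
    obtain w where w: "w \<in> span ?E" "norm (Abs_ell2 f - w) < \<epsilon>" by blast
    then obtain A r where A: "finite A" "A \<subseteq> ?E" "w = (\<Sum>v\<in>A. r v *\<^sub>R v)"
      by (auto simp: span_explicit)
    \<comment> \<open>The approximant is a sum over vectors, whereas the definition sums over
      sequences; injectivity of \<open>coord\<close> carries the coefficients over.\<close>
    have inj: "inj_on coord A" by (simp add: inj_on_def coord_inject)
    have "(\<lambda>m. f m - (\<Sum>u\<in>coord ` A. complex_of_real (r (Abs_ell2 u)) * u m)) = coord (Abs_ell2 f - w)"
      using f by (auto simp: sum.reindex[OF inj] coord_inverse A(3) coord_sum)
    then have "l2norm (\<lambda>m. f m - (\<Sum>u\<in>coord ` A. complex_of_real (r (Abs_ell2 u)) * u m)) < \<epsilon>"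
      using w(2) by (simp add: norm_ell2_def)
    then show "\<exists>U coef. finite U \<and> (\<forall>u\<in>U. eigenfunction a \<omega> u) \<and>
         l2norm (\<lambda>m. f m - (\<Sum>u\<in>U. coef u * u m)) < \<epsilon>"
      using A by (intro exI[of _ "coord ` A"] exI[of _ "\<lambda>u. complex_of_real (r (Abs_ell2 u))"]) auto
  qed
qed

end

section \<open>Almost sure localization\<close>

lemma summable_on_exp_abs:
  assumes "0 < c"
  shows "(\<lambda>m::int. exp (- c * \<bar>real_of_int m\<bar>)) summable_on UNIV"
proof -
  have "summable (\<lambda>k::nat. exp (- c) ^ k)" using assms by (intro summable_geometric) simp
  then have nat: "(\<lambda>k::nat. exp (- c * real k)) summable_on UNIV"
    unfolding exp_of_nat2_mult by (subst summable_on_UNIV_nonneg_real_iff) auto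
  have "(\<lambda>m::int. exp (- c * \<bar>real_of_int m\<bar>)) summable_on range int"
    using nat by (simp add: summable_on_reindex o_def)
  moreover have "(\<lambda>m::int. exp (- c * \<bar>real_of_int m\<bar>)) summable_on range (\<lambda>k. - int k)"
    using nat by (simp add: summable_on_reindex o_def inj_on_def)
  moreover have "range int \<union> range (\<lambda>k. - int k) = UNIV"
  proof -
    have "m \<in> range int \<union> range (\<lambda>k. - int k)" for m :: int by (cases m rule: int_cases2) auto
    then show ?thesis by blast
  qed
  ultimately show ?thesis using summable_on_union by metis
qed

context
  fixes a :: "int \<Rightarrow> real" and \<alpha> :: real
  assumes a_le: "\<And>n. \<bar>a n\<bar> \<le> \<alpha>"
begin

lemma matrix_elem_le_1: "cmod (matrix_elem a \<omega> m n t) \<le> 1"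
proof -
  interpret jacobi_operator a \<omega> \<alpha> by standard (rule a_le)
  show ?thesis using norm_coord_le[of "evol n t" m] by (simp add: matrix_elem_eq norm_evol)
qed

lemma matrix_elem_le_SUP: "cmod (matrix_elem a \<omega> m n t) \<le> (SUP t. cmod (matrix_elem a \<omega> m n t))"
  by (rule cSUP_upper) (auto intro!: bdd_aboveI2 matrix_elem_le_1)

text \<open>Orbits are continuous in time and the rationals are dense. The countable supremum is the
  one that is visibly measurable in \<open>\<omega>\<close>.\<close>

lemma SUP_matrix_elem_rational:
  "(SUP t. cmod (matrix_elem a \<omega> m n t)) = (SUP t\<in>\<rat>. cmod (matrix_elem a \<omega> m n t))"
proof (rule antisym)
  interpret jacobi_operator a \<omega> \<alpha> by standard (rule a_le)
  let ?f = "\<lambda>t. cmod (matrix_elem a \<omega> m n t)"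
  have bdd: "bdd_above (?f ` A)" for A by (rule bdd_aboveI2[OF matrix_elem_le_1])
  have "continuous_on UNIV ?f"
    unfolding matrix_elem_eq
    by (intro continuous_intros bounded_linear.continuous_on[OF bounded_linear_coord]
        schrod_orbit_continuous[OF evol_orbit])
  then have "closed {t. ?f t \<le> (SUP t\<in>\<rat>. ?f t)}"
    by (intro closed_Collect_le continuous_on_const)
  moreover have "\<rat> \<subseteq> {t. ?f t \<le> (SUP t\<in>\<rat>. ?f t)}" using cSUP_upper[OF _ bdd] by blast
  ultimately have "closure \<rat> \<subseteq> {t. ?f t \<le> (SUP t\<in>\<rat>. ?f t)}" by (rule closure_minimal[rotated])
  then show "(SUP t. ?f t) \<le> (SUP t\<in>\<rat>. ?f t)"
    unfolding Rats_closure_real by (intro cSUP_least) auto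
  show "(SUP t\<in>\<rat>. ?f t) \<le> (SUP t. ?f t)"
    by (intro cSUP_subset_mono bdd) (auto intro: Rats_0)
qed

lemma SUP_matrix_elem_measurable:
  assumes "\<And>m. (\<lambda>\<omega>. \<omega> m) \<in> borel_measurable M"
  shows "(\<lambda>\<omega>. SUP t. cmod (matrix_elem a \<omega> m n t)) \<in> borel_measurable M"
  unfolding SUP_matrix_elem_rational
proof (rule borel_measurable_cSUP[OF countable_rat])
  show "(\<lambda>\<omega>. cmod (matrix_elem a \<omega> m n t)) \<in> borel_measurable M" for t
    using matrix_elem_measurable[of a \<alpha>, OF a_le assms] by (rule measurable_compose[OF _ borel_measurable_norm])
qed (rule bdd_aboveI2[OF matrix_elem_le_1])

text \<open>Weighted with \<open>exp (\<kappa> * \<bar>real_of_int m\<bar>)\<close>, the expected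
  suprema are summable because \<open>\<kappa> < \<gamma>\<close>. Hence the weighted sum is almost
  surely finite, and its value serves as \<open>K\<close>.\<close>

lemma AE_exponential_localization:
  assumes M: "\<And>m. (\<lambda>\<omega>. \<omega> m) \<in> borel_measurable M" and "0 < C" "\<kappa> < \<gamma>"
    and decay: "\<And>m n. n \<in> {0, 1} \<Longrightarrow> (\<integral>\<^sup>+ \<omega>. ennreal (SUP t. cmod (matrix_elem a \<omega> m n t)) \<partial>M)
      \<le> ennreal (C * exp (- \<gamma> * \<bar>real_of_int m\<bar>))"
  shows "AE \<omega> in M. \<exists>K\<ge>0. \<forall>n\<in>{0, 1}. \<forall>t m. cmod (matrix_elem a \<omega> m n t) \<le> K * exp (- \<kappa> * \<bar>real_of_int m\<bar>)"
proof -
  define S where "S m n \<omega> = (SUP t. cmod (matrix_elem a \<omega> m n t))" for m n \<omega>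
  have S_meas [measurable]: "S m n \<in> borel_measurable M" for m n
    unfolding S_def by (rule SUP_matrix_elem_measurable[OF M])
  \<comment> \<open>Sites are grouped by absolute value to get a series over the naturals; for
    \<open>k = 0\<close> the two sites coincide, so each term counts at most four suprema.\<close>
  define X where "X k \<omega> = ennreal (exp (\<kappa> * real k)) * (\<Sum>(m, n)\<in>{int k, - int k} \<times> {0, 1}. ennreal (S m n \<omega>))" for k \<omega>
  have X_meas [measurable]: "X k \<in> borel_measurable M" for k
    unfolding X_def by measurable
  have "(\<integral>\<^sup>+ \<omega>. X k \<omega> \<partial>M) \<le> ennreal (4 * C * exp (- (\<gamma> - \<kappa>)) ^ k)" for k
  proof -
    have "(\<integral>\<^sup>+ \<omega>. X k \<omega> \<partial>M)
        = ennreal (exp (\<kappa> * real k)) * (\<Sum>p\<in>{int k, - int k} \<times> {0, 1}. \<integral>\<^sup>+ \<omega>. ennreal (S (fst p) (snd p) \<omega>) \<partial>M)"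
      unfolding X_def split_beta by (simp add: nn_integral_cmult nn_integral_sum)
    also have "\<dots> \<le> ennreal (exp (\<kappa> * real k)) * (\<Sum>p\<in>{int k, - int k} \<times> {0::int, 1}. ennreal (C * exp (- \<gamma> * real k)))"
    proof (intro mult_left_mono sum_mono)
      fix p assume "p \<in> {int k, - int k} \<times> {0::int, 1}"
      then show "(\<integral>\<^sup>+ \<omega>. ennreal (S (fst p) (snd p) \<omega>) \<partial>M) \<le> ennreal (C * exp (- \<gamma> * real k))"
        using decay[of "snd p" "fst p"] unfolding S_def by auto
    qed simp
    also have "\<dots> \<le> ennreal (exp (\<kappa> * real k)) * (4 * ennreal (C * exp (- \<gamma> * real k)))"
    proof (intro mult_left_mono)
      have "card ({int k, - int k} \<times> {0::int, 1}) \<le> 4"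
        unfolding card_cartesian_product by (cases "k = 0") (auto simp: card_insert_if)
      then have "of_nat (card ({int k, - int k} \<times> {0::int, 1})) \<le> (4::ennreal)"
        by (metis of_nat_mono of_nat_numeral)
      then show "(\<Sum>p\<in>{int k, - int k} \<times> {0::int, 1}. ennreal (C * exp (- \<gamma> * real k))) \<le> 4 * ennreal (C * exp (- \<gamma> * real k))"
        unfolding sum_constant by (rule mult_right_mono) simp
    qed simp
    also have "\<dots> = ennreal (exp (\<kappa> * real k) * (4 * (C * exp (- \<gamma> * real k))))"
      using \<open>0 < C\<close> by (simp add: ennreal_mult)
    also have "exp (\<kappa> * real k) * (4 * (C * exp (- \<gamma> * real k))) = 4 * C * exp (- (\<gamma> - \<kappa>)) ^ k"
      by (simp add: exp_of_nat2_mult[symmetric] exp_add[symmetric] algebra_simps)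
    finally show ?thesis .
  qed
  then have "(\<integral>\<^sup>+ \<omega>. (\<Sum>k. X k \<omega>) \<partial>M) \<le> (\<Sum>k. ennreal (4 * C * exp (- (\<gamma> - \<kappa>)) ^ k))"
    unfolding nn_integral_suminf[OF X_meas] by (intro suminf_le) auto
  also have "\<dots> < \<infinity>"
  proof -
    have "summable (\<lambda>k. 4 * C * exp (- (\<gamma> - \<kappa>)) ^ k)"
      using \<open>\<kappa> < \<gamma>\<close> by (intro summable_mult summable_geometric) simp
    then show ?thesis using \<open>0 < C\<close> by (subst suminf_ennreal2) auto
  qed
  finally have "AE \<omega> in M. (\<Sum>k. X k \<omega>) \<noteq> \<infinity>"
    by (intro nn_integral_PInf_AE) auto
  then show ?thesis
  proof eventually_elim
    case (elim \<omega>)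
    define K where "K = enn2real (\<Sum>k. X k \<omega>)"
    have K: "(\<Sum>k. X k \<omega>) = ennreal K" using elim by (simp add: K_def less_top)
    have "0 \<le> K" by (simp add: K_def)
    moreover have "cmod (matrix_elem a \<omega> m n t) \<le> K * exp (- \<kappa> * \<bar>real_of_int m\<bar>)" if n: "n \<in> {0, 1}" for n t m
    proof -
      define k where "k = nat \<bar>m\<bar>"
      have k: "real k = \<bar>real_of_int m\<bar>" by (simp add: k_def)
      have "(m, n) \<in> {int k, - int k} \<times> {0, 1}" using n by (auto simp: k_def)
      then have "ennreal (S m n \<omega>) \<le> (\<Sum>(m, n)\<in>{int k, - int k} \<times> {0, 1}. ennreal (S m n \<omega>))"
        using member_le_sum[of "(m, n)" "{int k, - int k} \<times> {0, 1}" "\<lambda>(m, n). ennreal (S m n \<omega>)"] by simp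
      then have "ennreal (exp (\<kappa> * real k)) * ennreal (S m n \<omega>) \<le> X k \<omega>"
        unfolding X_def by (rule mult_left_mono) simp
      also have "\<dots> \<le> (\<Sum>k. X k \<omega>)"
        using sum_le_suminf[of "\<lambda>k. X k \<omega>" "{k}"] by simp
      finally have "ennreal (exp (\<kappa> * real k) * S m n \<omega>) \<le> ennreal K"
        by (simp add: K ennreal_mult')
      then have "exp (\<kappa> * real k) * S m n \<omega> \<le> K" using \<open>0 \<le> K\<close> by simp
      then have "S m n \<omega> \<le> K * exp (- \<kappa> * real k)" by (simp add: exp_minus field_simps)
      then show ?thesis using matrix_elem_le_SUP[of \<omega> m n t] unfolding S_def k by simp
    qed
    ultimately show ?case by blast
  qed
qed

end

theorem theorem2p4:
  fixes r :: "real \<Rightarrow> real" and d c a :: "int \<Rightarrow> real" and \<delta> C \<gamma> :: real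
  assumes r_nonneg: "\<And>x. r x \<ge> 0"
    and r_bounded: "bounded (range r)"
    and r_meas: "r \<in> borel_measurable lborel"
    and r_supp: "\<exists>R. \<forall>x. \<bar>x\<bar> > R \<longrightarrow> r x = 0"
    and r_int: "(\<integral>\<^sup>+ x. ennreal (r x) \<partial>lborel) = 1"
    and d_pos: "\<And>n. d n > 0"
    and c_bounded: "bounded (range c)"
    and a_bounded: "bounded (range a)"
    and \<delta>_pos: "\<delta> > 0"
    and a_lower: "\<And>n. a n \<ge> \<delta>"
    and C_pos: "C > 0" and \<gamma>_pos: "\<gamma> > 0"
    and decay: "\<And>m. max (a_corr r d c a m 0) (a_corr r d c a m 1)
                        \<le> ennreal (C * exp (- \<gamma> * \<bar>real_of_int m\<bar>))"
  shows "AE \<omega> in mu r d c.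
           pure_point a \<omega> \<and>
           (\<forall>u. eigenfunction a \<omega> u \<longrightarrow>
              (\<forall>\<epsilon>. 0 < \<epsilon> \<and> \<epsilon> < \<gamma> \<longrightarrow>
                 (\<exists>K::real. \<forall>m. cmod (u m) \<le> K * exp (- (\<gamma> - \<epsilon>) * \<bar>real_of_int m\<bar>))))"
proof -
  obtain \<alpha> where a_le: "\<And>n. \<bar>a n\<bar> \<le> \<alpha>"
    using a_bounded by (auto simp: bounded_iff)
  have a_nz: "a n \<noteq> 0" for n using a_lower[of n] \<delta>_pos by auto
  have M: "(\<lambda>\<omega>. \<omega> m) \<in> borel_measurable (mu r d c)" for m
  proof -
    let ?N = "\<lambda>n. density lborel (\<lambda>x. ennreal (scaled_density r (d n) (x - c n)))"
    have "(\<lambda>\<omega>. \<omega> m) \<in> measurable (Pi\<^sub>M UNIV ?N) (?N m)"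
      by (rule measurable_component_singleton) simp
    also have "measurable (Pi\<^sub>M UNIV ?N) (?N m) = borel_measurable (mu r d c)"
      unfolding mu_def by (rule measurable_cong_sets) simp_all
    finally show ?thesis .
  qed
  \<comment> \<open>Rates increasing to \<open>\<gamma>\<close>: countably many suffice for every
    \<open>\<epsilon>\<close>, so one null set serves all. The shift by 2 makes already the first
    rate, \<open>\<gamma> / 2\<close>, positive.\<close>
  define \<kappa> where "\<kappa> j = \<gamma> - \<gamma> / real (j + 2)" for j :: nat
  have \<kappa>: "\<kappa> j < \<gamma>" "0 < \<kappa> j" for j
    using \<gamma>_pos by (auto simp: \<kappa>_def field_simps intro: add_pos_nonneg)
  have "AE \<omega> in mu r d c. \<forall>j. \<exists>K\<ge>0. \<forall>n\<in>{0, 1}. \<forall>t m.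
      cmod (matrix_elem a \<omega> m n t) \<le> K * exp (- \<kappa> j * \<bar>real_of_int m\<bar>)"
    unfolding AE_all_countable
  proof
    fix j
    show "AE \<omega> in mu r d c. \<exists>K\<ge>0. \<forall>n\<in>{0, 1}. \<forall>t m.
      cmod (matrix_elem a \<omega> m n t) \<le> K * exp (- \<kappa> j * \<bar>real_of_int m\<bar>)"
    proof (rule AE_exponential_localization[OF a_le M C_pos \<kappa>(1)])
      show "(\<integral>\<^sup>+ \<omega>. ennreal (SUP t. cmod (matrix_elem a \<omega> m n t)) \<partial>mu r d c)
        \<le> ennreal (C * exp (- \<gamma> * \<bar>real_of_int m\<bar>))" if "n \<in> {0, 1}" for m n
        using decay[of m] that unfolding a_corr_def by auto
    qed
  qed
  then show ?thesis
  proof eventually_elim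
    case (elim \<omega>)
    interpret jacobi_operator a \<omega> \<alpha> by standard (rule a_le)
    from elim obtain K where K: "\<And>j. 0 \<le> K j"
      "\<And>j n t m. n \<in> {0, 1} \<Longrightarrow> cmod (coord (evol n t) m) \<le> K j * exp (- \<kappa> j * \<bar>real_of_int m\<bar>)"
      unfolding matrix_elem_eq by metis
    \<comment> \<open>The rate with index 0 is enough here: any positive rate yields a
      square-summable bound.\<close>
    have "pure_point a \<omega>"
    proof (rule pure_point_if_localized[OF a_nz K(2)[of _ _ _ 0]])
      have "(\<lambda>m. (K 0)\<^sup>2 * exp (- (2 * \<kappa> 0) * \<bar>real_of_int m\<bar>)) summable_on UNIV"
        using \<kappa>(2)[of 0] by (intro summable_on_cmult_right summable_on_exp_abs) simp
      then show "(\<lambda>m. (K 0 * exp (- \<kappa> 0 * \<bar>real_of_int m\<bar>))\<^sup>2) summable_on UNIV"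
        by (simp add: power_mult_distrib exp_double[symmetric] algebra_simps)
    qed
    moreover have "\<exists>K::real. \<forall>m. cmod (u m) \<le> K * exp (- (\<gamma> - \<epsilon>) * \<bar>real_of_int m\<bar>)"
      if u: "eigenfunction a \<omega> u" and \<epsilon>: "0 < \<epsilon>" for u \<epsilon>
    proof -
      \<comment> \<open>This choice ensures \<open>\<gamma> / real (j + 2) \<le> \<epsilon>\<close>,
        so the rate \<open>\<kappa> j\<close> is at least the required one.\<close>
      obtain j :: nat where "\<gamma> / \<epsilon> \<le> real j" using real_arch_simple by blast
      then have "\<gamma> \<le> real (j + 2) * \<epsilon>" using \<epsilon> by (simp add: pos_divide_le_eq algebra_simps)
      then have j: "\<gamma> - \<epsilon> \<le> \<kappa> j" by (simp add: \<kappa>_def pos_divide_le_eq mult.commute)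
      obtain L where L: "\<And>m. cmod (u m) \<le> L * (K j * exp (- \<kappa> j * \<bar>real_of_int m\<bar>))"
        using eigenfunction_dominated[OF a_nz K(2)[of _ _ _ j] u] by blast
      \<comment> \<open>The sign of \<open>L\<close> is not known, so its absolute value is used to
        keep the comparison of exponentials monotone.\<close>
      have "cmod (u m) \<le> (\<bar>L\<bar> * K j) * exp (- (\<gamma> - \<epsilon>) * \<bar>real_of_int m\<bar>)" for m
      proof -
        have "cmod (u m) \<le> \<bar>L\<bar> * (K j * exp (- \<kappa> j * \<bar>real_of_int m\<bar>))"
          using L[of m] K(1)[of j] by (meson abs_ge_self exp_ge_zero mult_nonneg_nonneg mult_right_mono order_trans)
        also have "\<dots> \<le> \<bar>L\<bar> * (K j * exp (- (\<gamma> - \<epsilon>) * \<bar>real_of_int m\<bar>))"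
          using K(1)[of j] j mult_right_mono[OF j, of "\<bar>real_of_int m\<bar>"]
          by (intro mult_left_mono) (auto simp: algebra_simps)
        finally show ?thesis by (simp add: mult.assoc)
      qed
      then show ?thesis by blast
    qed
    ultimately show ?case by blast
  qed
qed

end
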